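(* Let $\mathbb K$ be an algebraically closed field of characteristic $0$ and $R=\mathbb K[x,y,z]$. Let $I\subset R$ be an artinian ideal generated by $2d+1$ polynomials $l_1^d,\dots,l_{2d+1}^d$, where the $l_i$ are distinct linear forms in $\mathbb P^2$. Let $Z=\{l_1^\vee,\dots,l_{2d+1}^\vee\}$ be the corresponding set of points in the dual plane $\mathbb P^{2\vee}$. If there are no more than $d+1$ aligned points in $Z$, then the following conditions are equivalent: 1. The ideal $I$ fails the SLP at the range $2$ in degree $d-2$. 2. The derivation bundle $\mathcal D_0(Z)$ is unstable with splitting type $(d-s,d+s)$, with $s\ge1$.
   Context: Distinct linear forms means pairwise non-proportional (they define distinct lines). For a nonzero linear form $l$, $l^\vee\in\mathbb P^{2\vee}$ is the point dual to the line $l=0$. Aligned points are points lying on a common line. SLP. $I$ fails the Strong Lefschetz Property (SLP) at range $k$ in degree $t$ if for a general (equivalently, every) linear form $L$ the multiplication map $\times L^k\colon (R/I)_t\to(R/I)_{t+k}$ does not have maximal rank, i.e. is neither injective nor surjective. Derivation bundle. Let $f=\prod_j l_j$, of degree $m=2d+1$. The derivation bundle $\mathcal D_0(Z)$ is the rank $2$ vector bundle on $\mathbb P^2$ defined as the kernel of the Jacobian map $(\partial f)\colon\mathscr O_{\mathbb P^2}^3\to\mathscr O_{\mathbb P^2}(m-1)$ given by the partial derivatives of $f$. Its (general) splitting type is the pair $(a,b)$ with $a\le b$, such that $\mathcal D_0(Z)\otimes\mathscr O_l\cong\mathscr O_l(-a)\oplus\mathscr O_l(-b)$ for a general line $l\subset\mathbb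 P^2$; one has $a+b+1=m$. Unstable means not semistable in the sense of slope (Mumford–Takemoto) stability. *)

theory Defs
  imports
    "HOL-Computational_Algebra.Polynomial"
    "HOL-Computational_Algebra.Fraction_Field"
    "HOL-Combinatorics.Permutations"
    "HOL-Library.Poly_Mapping"
    "HOL-Library.Numeral_Type"
    "HOL-Library.Function_Algebras"
    "HOL-Library.Set_Algebras"
begin

section \<open>The graded ring K[x,y,z]\<close>

type_synonym 'k mpoly3 = "(3 \<Rightarrow>\<^sub>0 nat) \<Rightarrow>\<^sub>0 'k"

text \<open>Degrees are integers; the components of negative degree are zero.\<close>

definition hom_part :: "int \<Rightarrow> 'k::comm_ring_1 mpoly3 set" where
  "hom_part t = {p. \<forall>m\<in>Poly_Mapping.keys p. int (\<Sum>i\<in>UNIV. Poly_Mapping.lookup m i) = t}"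

definition eval :: "'k::comm_ring_1 mpoly3 \<Rightarrow> (3 \<Rightarrow> 'k) \<Rightarrow> 'k" where
  "eval p v = (\<Sum>m\<in>Poly_Mapping.keys p.
     Poly_Mapping.lookup p m * (\<Prod>i\<in>UNIV. v i ^ Poly_Mapping.lookup m i))"

definition pdiff :: "3 \<Rightarrow> 'k::comm_ring_1 mpoly3 \<Rightarrow> 'k mpoly3" where
  "pdiff i p = (\<Sum>m\<in>Poly_Mapping.keys p.
     Poly_Mapping.single (m - Poly_Mapping.single i 1)
       (of_nat (Poly_Mapping.lookup m i) * Poly_Mapping.lookup p m))"

definition linear_form :: "'k::comm_ring_1 mpoly3 \<Rightarrow> bool" where
  "linear_form l \<longleftrightarrow> l \<in> hom_part 1 \<and> l \<noteq> 0"

text \<open>Points of the projective plane and of its dual are given by homogeneous coordinates.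
  The dual point of a linear form is its coefficient vector.\<close>

definition dual_point :: "'k::comm_ring_1 mpoly3 \<Rightarrow> 3 \<Rightarrow> 'k" where
  "dual_point l = (\<lambda>i. Poly_Mapping.lookup l (Poly_Mapping.single i 1))"

definition vscale :: "'a::times \<Rightarrow> ('i \<Rightarrow> 'a) \<Rightarrow> 'i \<Rightarrow> 'a" (infixr \<open>\<cdot>\<close> 75) where
  "c \<cdot> v = (\<lambda>i. c * v i)"

definition proportional :: "(3 \<Rightarrow> 'k::field) \<Rightarrow> (3 \<Rightarrow> 'k) \<Rightarrow> bool" where
  "proportional v w \<longleftrightarrow> (\<exists>c. c \<noteq> 0 \<and> v = c \<cdot> w)"

definition aligned :: "(3 \<Rightarrow> 'k::field) set \<Rightarrow> bool" where
  "aligned S \<longleftrightarrow> (\<exists>u. u \<noteq> 0 \<and> (\<forall>p\<in>S. (\<Sum>i\<in>UNIV. u i * p i) = 0))"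

text \<open>``General'': for all linear forms in some nonempty Zariski open subset of the dual plane.\<close>

definition for_general_linear_form :: "('k::field mpoly3 \<Rightarrow> bool) \<Rightarrow> bool" where
  "for_general_linear_form P \<longleftrightarrow>
     (\<exists>G t. G \<in> hom_part t \<and> G \<noteq> 0 \<and>
        (\<forall>L. linear_form L \<and> eval G (dual_point L) \<noteq> 0 \<longrightarrow> P L))"


section \<open>Artinian ideals and the Strong Lefschetz Property\<close>

abbreviation is_ideal :: "'a::comm_ring_1 set \<Rightarrow> bool" where
  "is_ideal \<equiv> module.subspace (*)"

abbreviation ideal_gen :: "'a::comm_ring_1 set \<Rightarrow> 'a set" where
  "ideal_gen \<equiv> module.span (*)"

text \<open>The quotient ring satisfies the descending chain condition on ideals.\<close>

definition artinian_ideal :: "'a::comm_ring_1 set \<Rightarrow> bool" where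
  "artinian_ideal I \<longleftrightarrow> is_ideal I \<and>
     (\<forall>J :: nat \<Rightarrow> 'a set.
        (\<forall>n. is_ideal (J n) \<and> I \<subseteq> J n \<and> J (Suc n) \<subseteq> J n)
          \<longrightarrow> (\<exists>N. \<forall>n\<ge>N. J n = J N))"

text \<open>The degree \<open>t\<close> part of \<open>R/I\<close>, as a set of cosets, for a homogeneous ideal \<open>I\<close>.\<close>

definition quot_part :: "'k::comm_ring_1 mpoly3 set \<Rightarrow> int \<Rightarrow> 'k mpoly3 set set" where
  "quot_part I t = (\<lambda>p. p +o I) ` hom_part t"

definition quot_mult :: "'k::comm_ring_1 mpoly3 set \<Rightarrow> 'k mpoly3 \<Rightarrow> 'k mpoly3 set \<Rightarrow> 'k mpoly3 set" where
  "quot_mult I q C = (q *o C) + I"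

definition fails_SLP :: "'k::field mpoly3 set \<Rightarrow> nat \<Rightarrow> int \<Rightarrow> bool" where
  "fails_SLP I k t \<longleftrightarrow> for_general_linear_form (\<lambda>L.
     \<not> inj_on (quot_mult I (L ^ k)) (quot_part I t) \<and>
     quot_mult I (L ^ k) ` quot_part I t \<noteq> quot_part I (t + int k))"


section \<open>Sheaves on the projective plane\<close>

text \<open>Closed points are nonzero coordinate vectors up to scalars. Sheaves are specified by their
  sections over the affine open sets \<open>D\<^sub>+(h)\<close>, with \<open>h\<close> a form of positive degree.\<close>

type_synonym 'k point = "3 \<Rightarrow> 'k"
type_synonym 'k ratfun = "'k mpoly3 fract"

definition basic_open :: "'k::field point set \<Rightarrow> bool" where
  "basic_open U \<longleftrightarrow>
     (\<exists>h n. n > 0 \<and> h \<in> hom_part n \<and> h \<noteq> 0 \<and> U = {p. p \<noteq> 0 \<and> eval h p \<noteq> 0})"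

text \<open>Sections of \<open>O(n)\<close>: rational functions that near every point are quotients
  of forms whose degrees differ by \<open>n\<close>.\<close>

definition twist :: "int \<Rightarrow> 'k::field point set \<Rightarrow> 'k ratfun set" where
  "twist n U = {q. \<forall>p\<in>U. \<exists>g h t. g \<in> hom_part (t + n) \<and> h \<in> hom_part t \<and>
      eval h p \<noteq> 0 \<and> q = Fract g h}"

abbreviation reg :: "'k::field point set \<Rightarrow> 'k ratfun set" where
  "reg U \<equiv> twist 0 U"

text \<open>The sheaves below are subsheaves of constant sheaves of vectors of rational functions;
  restriction of sections is inclusion.\<close>

type_synonym ('k, 'i) sheaf = "'k point set \<Rightarrow> ('i \<Rightarrow> 'k ratfun) set"

definition twist_sum :: "('i \<Rightarrow> int) \<Rightarrow> ('k::field, 'i) sheaf" where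
  "twist_sum a U = {v. \<forall>i. v i \<in> twist (a i) U}"

definition reg_span :: "'k::field point set \<Rightarrow> ('i \<Rightarrow> 'k ratfun) set \<Rightarrow> ('i \<Rightarrow> 'k ratfun) set" where
  "reg_span U S =
     {v. \<exists>T c. finite T \<and> T \<subseteq> S \<and> (\<forall>t\<in>T. c t \<in> reg U) \<and> v = (\<Sum>t\<in>T. c t \<cdot> t)}"

text \<open>The kernel of the Jacobian map \<open>O\<^sup>3 \<rightarrow> O(m-1)\<close> of a form \<open>f\<close> of degree \<open>m\<close>.\<close>

definition derivation_bundle :: "'k::field mpoly3 \<Rightarrow> ('k, 3) sheaf" where
  "derivation_bundle f U =
     {s \<in> twist_sum (\<lambda>_. 0) U. (\<Sum>i\<in>UNIV. s i * Fract (pdiff i f) 1) = 0}"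


subsection \<open>Restriction to a line and splitting type\<close>

text \<open>The image of \<open>L : O(-1) \<rightarrow> O\<close>, whose cokernel is the structure sheaf of the line \<open>L = 0\<close>.\<close>

definition line_ideal :: "'k::field mpoly3 \<Rightarrow> 'k point set \<Rightarrow> 'k ratfun set" where
  "line_ideal L U = (\<lambda>g. Fract L 1 * g) ` twist (- 1) U"

definition line_sub :: "'k::field mpoly3 \<Rightarrow> ('k, 'i) sheaf \<Rightarrow> ('k, 'i) sheaf" where
  "line_sub L E U = reg_span U {g \<cdot> v | g v. g \<in> line_ideal L U \<and> v \<in> E U}"

text \<open>Over an affine \<open>U\<close> the sections of \<open>E \<otimes> O\<^sub>l\<close> are
  \<open>E(U) \<otimes> O(U)/I\<^sub>l(U) = E(U)/I\<^sub>l(U)E(U)\<close>, here a set of cosets.\<close>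

definition line_restr ::
  "'k::field mpoly3 \<Rightarrow> ('k, 'i) sheaf \<Rightarrow> 'k point set \<Rightarrow> ('i \<Rightarrow> 'k ratfun) set set" where
  "line_restr L E U = (\<lambda>v. v +o line_sub L E U) ` E U"

text \<open>Isomorphism of \<open>E \<otimes> O\<^sub>l\<close> and \<open>G \<otimes> O\<^sub>l\<close>: linear bijections of the
  sections over the basic open sets that commute with the restriction maps.\<close>

definition line_iso ::
  "'k::field mpoly3 \<Rightarrow> ('k, 'i) sheaf \<Rightarrow> ('k, 'j) sheaf \<Rightarrow> bool" where
  "line_iso L E G \<longleftrightarrow>
     (\<exists>\<phi> :: 'k point set \<Rightarrow> ('i \<Rightarrow> 'k ratfun) set \<Rightarrow> ('j \<Rightarrow> 'k ratfun) set.
       \<forall>U. basic_open U \<longrightarrow>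
         bij_betw (\<phi> U) (line_restr L E U) (line_restr L G U) \<and>
         (\<forall>C\<in>line_restr L E U. \<forall>C'\<in>line_restr L E U. \<phi> U (C + C') = \<phi> U C + \<phi> U C') \<and>
         (\<forall>g\<in>reg U. \<forall>C\<in>line_restr L E U.
            \<phi> U ((\<cdot>) g ` C + line_sub L E U) = (\<cdot>) g ` \<phi> U C + line_sub L G U) \<and>
         (\<forall>V. basic_open V \<and> V \<subseteq> U \<longrightarrow>
            (\<forall>C\<in>line_restr L E U.
               \<phi> V (C + line_sub L E V) = \<phi> U C + line_sub L G V)))"

definition splitting_type :: "('k::field, 'i) sheaf \<Rightarrow> int \<Rightarrow> int \<Rightarrow> bool" where
  "splitting_type E a b \<longleftrightarrow> a \<le> b \<and>
     for_general_linear_form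
       (\<lambda>L. line_iso L E (twist_sum (\<lambda>i::bool. if i then - b else - a)))"


subsection \<open>Slope semistability\<close>

text \<open>The notions below are meant for coherent subsheaves of \<open>O\<^sup>n\<close>. Their sections have coordinates
  in the function field of the plane, the degree \<open>0\<close> subfield of \<open>K(x,y,z)\<close>, so dimensions
  over the two fields agree.\<close>

definition coherent :: "('k::field, 'i) sheaf \<Rightarrow> bool" where
  "coherent E \<longleftrightarrow> (\<forall>U. basic_open U \<longrightarrow>
     (\<exists>S. finite S \<and> E U = reg_span U S) \<and>
     (\<forall>V. basic_open V \<and> V \<subseteq> U \<longrightarrow> E V = reg_span V (E U)))"

definition subsheaf :: "('k::field, 'i) sheaf \<Rightarrow> ('k, 'i) sheaf \<Rightarrow> bool" where
  "subsheaf F E \<longleftrightarrow> (\<forall>U. basic_open U \<longrightarrow> F U \<subseteq> E U)"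

definition rank :: "('k::field, 'i) sheaf \<Rightarrow> nat" where
  "rank E = vector_space.dim (\<cdot>) (\<Union>U\<in>Collect basic_open. E U)"

text \<open>\<open>v\<^sub>0 \<and> \<dots> \<and> v\<^bsub>r-1\<^esub>\<close>, given by its coordinates, the minors of \<open>v\<close>.\<close>

definition wedge :: "nat \<Rightarrow> (nat \<Rightarrow> 'i \<Rightarrow> 'a::comm_ring_1) \<Rightarrow> (nat \<Rightarrow> 'i) \<Rightarrow> 'a" where
  "wedge r v = (\<lambda>\<sigma>. \<Sum>\<pi> | \<pi> permutes {..<r}. of_int (sign \<pi>) * (\<Prod>j<r. v j (\<sigma> (\<pi> j))))"

text \<open>The exterior power modulo torsion.\<close>

definition ext_power :: "nat \<Rightarrow> ('k::field, 'i) sheaf \<Rightarrow> ('k, nat \<Rightarrow> 'i) sheaf" where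
  "ext_power r E U = reg_span U {wedge r v | v. \<forall>j<r. v j \<in> E U}"

text \<open>The first Chern class of a torsion free sheaf \<open>E\<close> is the integer \<open>k\<close> such that
  \<open>det E = (\<Lambda>\<^sup>r E)\<^sup>*\<^sup>* \<cong> O(k)\<close>, that is, such that \<open>\<Lambda>\<^sup>r E\<close> modulo torsion is isomorphic to \<open>O(k)\<close>
  outside a finite set of points. A morphism from \<open>O(k)\<close> to a constant sheaf
  is multiplication by some \<open>\<omega>\<close>.\<close>

definition has_c1 :: "('k::field, 'i) sheaf \<Rightarrow> int \<Rightarrow> bool" where
  "has_c1 E k \<longleftrightarrow> (\<exists>\<omega> W. finite W \<and>
     (\<forall>p. p \<noteq> 0 \<and> (\<forall>w\<in>W. \<not> proportional p w) \<longrightarrow>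
        (\<exists>U. basic_open U \<and> p \<in> U \<and>
           ext_power (rank E) E U = (\<lambda>g. g \<cdot> \<omega>) ` twist k U)))"

definition semistable :: "('k::field, 'i) sheaf \<Rightarrow> bool" where
  "semistable E \<longleftrightarrow>
     (\<forall>F c e. coherent F \<and> subsheaf F E \<and> 0 < rank F \<and> rank F < rank E \<and>
        has_c1 F c \<and> has_c1 E e \<longrightarrow>
        real_of_int c / real (rank F) \<le> real_of_int e / real (rank E))"

abbreviation unstable :: "('k::field, 'i) sheaf \<Rightarrow> bool" where
  "unstable E \<equiv> \<not> semistable E"

end

theory Submission
  imports Defs
    "Berlekamp_Zassenhaus.Unique_Factorization_Poly"
    "Jordan_Normal_Form.Determinant"
begin

text \<open>All conditions are read off from the syzygies, on a general line \<open>L = 0\<close>, of the partial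
  derivatives of the product \<open>f\<close> of the linear forms. A functional on the forms of degree \<open>d\<close> that kills
  the multiples of \<open>L\<^sup>2\<close> and the powers \<open>l\<^sub>i\<^sup>d\<close> amounts to a pair of univariate polynomials with prescribed
  ratios at the \<open>2 d + 1\<close> points where the lines meet \<open>L = 0\<close>, and such pairs are the syzygies of
  degree at most \<open>d - 1\<close>. Hence \<open>L\<^sup>2\<close> fails to be surjective in degree \<open>d - 2\<close> iff there is such a syzygy.
  The hypothesis on aligned points makes the powers \<open>l\<^sub>i\<^sup>d\<close> independent, so that source and target have
  the same dimension and injectivity fails at the same time.

  A nonzero syzygy of minimal degree \<open>a \<le> d\<close> is nowhere zero on the line, and completing it to a
  basis splits the restricted bundle as \<open>O(-a) \<oplus> O(-(2 d - a))\<close>. Conversely the generators of a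
  summand \<open>O(-a)\<close> glue to a syzygy of degree at most \<open>a\<close>. If \<open>a < d\<close> on the general line, then by the
  argument of Grauert and Muelich the syzygy does not change along a pencil of lines through a point
  and so comes from a syzygy of degree \<open>a\<close> on the plane, which spans a subsheaf of slope
  \<open>-a > -d\<close>.\<close>

hide_const (open) Polynomial.order Divisibility.prime

section \<open>Polynomials in three variables\<close>

text \<open>The proof rests on a count: modulo the square of \<open>L\<close> a form of degree d has
  (d + 1) + d coefficients, as many as there are powers. The matrix of the powers is square, so a
  functional killing all of them exists iff they are dependent modulo that square. The number d
  returns as half the degree 2 d of the partial derivatives: the bundle has rank 2 and first Chern
  class -2 d, so syzygies of degree below d are those of slope above the average. A line is given by
  two parameters \<open>u\<close>, \<open>v\<close>. General means off the zero set of one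
  polynomial in them, and such conditions are combined by multiplying the polynomials. On the
  generic line the parameters are indeterminates; linear systems are solved there without fractions,
  so that solutions can be specialised and differentiated. The obstacle is the descent to the plane:
  a syzygy on the generic line may carry a factor that depends on the line. It has to be made
  primitive by a gcd before it is constant along pencils.\<close>

lemma UNIV_3: "(UNIV :: 3 set) = {0, 1, 2}"
proof -
  have "x = 0 \<or> x = 1 \<or> x = 2" for x :: 3
  proof (induct x)
    case (of_int z)
    then have "z = 0 \<or> z = 1 \<or> z = 2" by auto
    then show ?case by auto
  qed
  then show ?thesis by auto
qed

lemma distinct_3 [simp]: "(0::3) \<noteq> 1" "(0::3) \<noteq> 2" "(1::3) \<noteq> 2" "(1::3) \<noteq> 0" "(2::3) \<noteq> 0" "(2::3) \<noteq> 1"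
proof -
  have "card {0, 1, 2::3} = 3"
    by (simp flip: UNIV_3)
  then show "(0::3) \<noteq> 1" "(0::3) \<noteq> 2" "(1::3) \<noteq> 2" "(1::3) \<noteq> 0" "(2::3) \<noteq> 0" "(2::3) \<noteq> 1"
    by (auto simp: card_insert_if split: if_splits)
qed

lemma sum_UNIV_3: "sum f (UNIV :: 3 set) = f 0 + f 1 + (f 2 :: 'a::comm_monoid_add)"
  unfolding UNIV_3 by (simp add: add.assoc)

lemma prod_UNIV_3: "prod f (UNIV :: 3 set) = f 0 * f 1 * (f 2 :: 'a::comm_monoid_mult)"
  unfolding UNIV_3 by (simp add: mult.assoc)

lemma all_3: "(\<forall>i::3. P i) \<longleftrightarrow> P 0 \<and> P 1 \<and> P 2"
proof -
  have "(\<forall>i::3. P i) \<longleftrightarrow> (\<forall>i\<in>UNIV. P i)" by simp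
  then show ?thesis by (simp only: UNIV_3) simp
qed

lemma ex_3: "(\<exists>i::3. P i) \<longleftrightarrow> P 0 \<or> P 1 \<or> P 2"
  using all_3[of "\<lambda>i. \<not> P i"] by blast

lemma cases_3: obtains "i = 0" | "i = 1" | "i = (2::3)"
  using all_3[of "\<lambda>i. i = 0 \<or> i = 1 \<or> i = 2"] by auto

abbreviation mdeg :: "(3 \<Rightarrow>\<^sub>0 nat) \<Rightarrow> nat" where
  "mdeg m \<equiv> (\<Sum>i\<in>UNIV. Poly_Mapping.lookup m i)"

abbreviation mcoeff :: "'k::comm_ring_1 mpoly3 \<Rightarrow> (3 \<Rightarrow>\<^sub>0 nat) \<Rightarrow> 'k" where
  "mcoeff \<equiv> Poly_Mapping.lookup"

definition mvar :: "3 \<Rightarrow> 'k::comm_ring_1 mpoly3" where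
  "mvar i = Poly_Mapping.single (Poly_Mapping.single i 1) 1"

definition mconst :: "'k::comm_ring_1 \<Rightarrow> 'k mpoly3" where
  "mconst c = Poly_Mapping.single 0 c"

lemma mpoly_sum_singles: "p = (\<Sum>m\<in>Poly_Mapping.keys p. Poly_Mapping.single m (mcoeff p m))"
  by (rule poly_mapping_eqI)
    (simp add: lookup_sum lookup_single when_def in_keys_iff sum.delta)

lemma mpoly_induct [case_names zero add]:
  fixes p :: "'k::comm_ring_1 mpoly3"
  assumes "P 0"
    and "\<And>m b p. P p \<Longrightarrow> P (Poly_Mapping.single m b + p)"
  shows "P p"
proof -
  have "P (\<Sum>m\<in>A. Poly_Mapping.single m (mcoeff p m))" if "finite A" for A
    using that by (induction A) (auto intro: assms)
  then show ?thesis
    using mpoly_sum_singles[of p] by (metis finite_keys)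
qed

lemma hom_part_induct [consumes 1, case_names zero add]:
  fixes p :: "'k::comm_ring_1 mpoly3"
  assumes "p \<in> hom_part n"
    and "P 0"
    and "\<And>m b p. P p \<Longrightarrow> int (mdeg m) = n \<Longrightarrow> P (Poly_Mapping.single m b + p)"
  shows "P p"
proof -
  have "P (\<Sum>m\<in>A. Poly_Mapping.single m (mcoeff p m))"
    if "finite A" "A \<subseteq> Poly_Mapping.keys p" for A
    using that
  proof (induction A)
    case (insert m A)
    then have "int (mdeg m) = n"
      using assms(1) by (auto simp: hom_part_def)
    with insert show ?case
      by (auto intro: assms(3))
  qed (simp add: assms)
  then show ?thesis
    using mpoly_sum_singles[of p] by (metis finite_keys order_refl)
qed

subsection \<open>Substitution\<close>

definition msub :: "('k::comm_ring_1 \<Rightarrow> 'a::comm_ring_1) \<Rightarrow> (3 \<Rightarrow> 'a) \<Rightarrow> 'k mpoly3 \<Rightarrow> 'a" where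
  "msub c a p = (\<Sum>m\<in>Poly_Mapping.keys p. c (mcoeff p m) * (\<Prod>i\<in>UNIV. a i ^ Poly_Mapping.lookup m i))"

lemma eval_eq_msub: "eval p v = msub (\<lambda>c. c) v p"
  by (simp add: eval_def msub_def)

context comm_ring_hom
begin

lemma msub_superset:
  assumes "finite S" "Poly_Mapping.keys p \<subseteq> S"
  shows "msub hom a p = (\<Sum>m\<in>S. hom (mcoeff p m) * (\<Prod>i\<in>UNIV. a i ^ Poly_Mapping.lookup m i))"
  unfolding msub_def using assms
  by (intro sum.mono_neutral_left) (auto simp: in_keys_iff)

lemma msub_zero [simp]: "msub hom a 0 = 0"
  by (simp add: msub_def)

lemma msub_add: "msub hom a (p + q) = msub hom a p + msub hom a q"
proof -
  let ?S = "Poly_Mapping.keys p \<union> Poly_Mapping.keys q"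
  have "Poly_Mapping.keys (p + q) \<subseteq> ?S" by (rule keys_add)
  then show ?thesis
    by (subst (1 2 3) msub_superset[of ?S])
      (auto simp: lookup_add hom_distribs distrib_right sum.distrib)
qed

lemma msub_single:
  "msub hom a (Poly_Mapping.single m b) = hom b * (\<Prod>i\<in>UNIV. a i ^ Poly_Mapping.lookup m i)"
  by (subst msub_superset[of "{m}"]) auto

lemma msub_mult: "msub hom a (p * q) = msub hom a p * msub hom a q"
proof (induction p rule: mpoly_induct)
  case (add m b p)
  have "msub hom a (Poly_Mapping.single m b * q) = msub hom a (Poly_Mapping.single m b) * msub hom a q"
    by (induction q rule: mpoly_induct)
      (simp_all add: distrib_left msub_add mult_single msub_single hom_distribs lookup_add
        power_add prod.distrib mult_ac)
  with add show ?case
    by (simp add: distrib_right msub_add)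
qed simp

lemma msub_one [simp]: "msub hom a 1 = 1"
  using msub_single[of a 0 1] by simp

lemma msub_mconst [simp]: "msub hom a (mconst c) = hom c"
  by (simp add: mconst_def msub_single)

lemma msub_mvar [simp]: "msub hom a (mvar i) = a i"
proof -
  have "(\<Prod>j\<in>UNIV. a j ^ Poly_Mapping.lookup (Poly_Mapping.single i 1) j)
      = (\<Prod>j\<in>UNIV. if j = i then a j else 1)"
    by (rule prod.cong) (auto simp: lookup_single when_def)
  then show ?thesis
    by (simp add: mvar_def msub_single prod.delta)
qed

lemma msub_hom: "comm_ring_hom (msub hom a)"
  by unfold_locales (simp_all add: msub_add msub_mult)

lemma msub_uminus: "msub hom a (- p) = - msub hom a p"
  and msub_diff: "msub hom a (p - q) = msub hom a p - msub hom a q"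
  and msub_power: "msub hom a (p ^ n) = msub hom a p ^ n"
  and msub_sum: "msub hom a (sum f A) = (\<Sum>i\<in>A. msub hom a (f i))"
  and msub_prod: "msub hom a (prod f A) = (\<Prod>i\<in>A. msub hom a (f i))"
proof -
  interpret s: comm_ring_hom "msub hom a" by (rule msub_hom)
  show "msub hom a (- p) = - msub hom a p" by (rule s.hom_uminus)
  show "msub hom a (p - q) = msub hom a p - msub hom a q" by (rule s.hom_minus)
  show "msub hom a (p ^ n) = msub hom a p ^ n" by (rule s.hom_power)
  show "msub hom a (sum f A) = (\<Sum>i\<in>A. msub hom a (f i))" by (rule s.hom_sum)
  show "msub hom a (prod f A) = (\<Prod>i\<in>A. msub hom a (f i))" by (rule s.hom_prod)
qed

lemmas msub_simps = msub_add msub_mult msub_uminus msub_diff msub_power msub_sum msub_prod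

end

lemma (in comm_ring_hom) hom_msub:
  assumes "comm_ring_hom c"
  shows "hom (msub c a p) = msub (\<lambda>x. hom (c x)) (\<lambda>i. hom (a i)) p"
proof -
  interpret c: comm_ring_hom c by fact
  show ?thesis
    by (simp add: msub_def hom_distribs)
qed

lemma id_comm_ring_hom: "comm_ring_hom (\<lambda>c. c)"
  by unfold_locales simp_all

lemmas eval_simps = comm_ring_hom.msub_simps[OF id_comm_ring_hom, folded eval_eq_msub]
  comm_ring_hom.msub_zero[OF id_comm_ring_hom, folded eval_eq_msub]
  comm_ring_hom.msub_one[OF id_comm_ring_hom, folded eval_eq_msub]
  comm_ring_hom.msub_mconst[OF id_comm_ring_hom, folded eval_eq_msub]
  comm_ring_hom.msub_mvar[OF id_comm_ring_hom, folded eval_eq_msub]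

lemmas eval_single = comm_ring_hom.msub_single[OF id_comm_ring_hom, folded eval_eq_msub]

subsection \<open>Homogeneous parts\<close>

lemma hom_part_zero [simp, intro]: "0 \<in> hom_part n"
  by (simp add: hom_part_def)

lemma hom_part_add [intro]: "p \<in> hom_part n \<Longrightarrow> q \<in> hom_part n \<Longrightarrow> p + q \<in> hom_part n"
  using keys_add[of p q] by (fastforce simp: hom_part_def)

lemma hom_part_uminus [intro]: "p \<in> hom_part n \<Longrightarrow> - p \<in> hom_part n"
  by (simp add: hom_part_def in_keys_iff)

lemma hom_part_diff [intro]: "p \<in> hom_part n \<Longrightarrow> q \<in> hom_part n \<Longrightarrow> p - q \<in> hom_part n"
  using hom_part_add[OF _ hom_part_uminus, of p n q] by simp

lemma hom_part_sum [intro]: "(\<And>i. i \<in> A \<Longrightarrow> f i \<in> hom_part n) \<Longrightarrow> sum f A \<in> hom_part n"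
  by (induction A rule: infinite_finite_induct) auto

lemma hom_part_single: "int (mdeg m) = n \<Longrightarrow> Poly_Mapping.single m b \<in> hom_part n"
  by (simp add: hom_part_def)

lemma hom_part_mult:
  assumes "p \<in> hom_part n" "q \<in> hom_part k"
  shows "p * q \<in> hom_part (n + k)"
  using assms(1)
proof (induction p rule: hom_part_induct)
  case (add m b p)
  have "Poly_Mapping.single m b * q \<in> hom_part (n + k)"
    using assms(2)
  proof (induction q rule: hom_part_induct)
    case (add m' b' q)
    have "Poly_Mapping.single (m + m') (b * b') \<in> hom_part (n + k)"
      using add.hyps \<open>int (mdeg m) = n\<close>
      by (intro hom_part_single) (simp add: lookup_add sum.distrib)
    with add show ?case
      by (auto simp: distrib_left mult_single)
  qed simp
  with add show ?case
    by (auto simp: distrib_right)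
qed simp

lemma hom_part_mult': "p \<in> hom_part n \<Longrightarrow> q \<in> hom_part k \<Longrightarrow> n + k = r \<Longrightarrow> p * q \<in> hom_part r"
  using hom_part_mult by blast

lemma hom_part_mconst [simp, intro]: "mconst c \<in> hom_part 0"
  by (simp add: mconst_def hom_part_single)

lemma hom_part_one [simp, intro]: "1 \<in> hom_part 0"
  using hom_part_mconst[of 1] by (simp add: mconst_def)

lemma hom_part_mvar [simp, intro]: "mvar i \<in> hom_part 1"
  by (simp add: mvar_def hom_part_single lookup_single when_def)

lemma hom_part_power: "p \<in> hom_part n \<Longrightarrow> p ^ k \<in> hom_part (int k * n)"
  by (induction k) (auto intro!: hom_part_mult' simp: algebra_simps)

lemma hom_part_power1: "p \<in> hom_part 1 \<Longrightarrow> p ^ k \<in> hom_part (int k)"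
  using hom_part_power[of p 1 k] by simp

lemma hom_part_prod1:
  "finite A \<Longrightarrow> (\<And>i. i \<in> A \<Longrightarrow> f i \<in> hom_part 1) \<Longrightarrow> prod f A \<in> hom_part (int (card A))"
proof (induction A rule: finite_induct)
  case (insert x A)
  then show ?case
    by (auto intro!: hom_part_mult'[of _ 1 _ "int (card A)"])
qed simp

lemma hom_part_mconst_mult [intro]: "p \<in> hom_part n \<Longrightarrow> mconst c * p \<in> hom_part n"
  by (rule hom_part_mult'[of _ 0]) auto

lemma hom_part_neg: "p \<in> hom_part n \<Longrightarrow> n < 0 \<Longrightarrow> p = 0"
proof -
  assume "p \<in> hom_part n" "n < 0"
  then have "Poly_Mapping.keys p = {}"
    by (fastforce simp: hom_part_def simp del: keys_eq_empty of_nat_sum)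
  then show "p = 0" by simp
qed

lemma (in comm_ring_hom) msub_scale:
  assumes "p \<in> hom_part (int n)"
  shows "msub hom (\<lambda>i. s * a i) p = s ^ n * msub hom a p"
  using assms
proof (induction p rule: hom_part_induct)
  case (add m b p)
  have "(\<Prod>i\<in>UNIV. (s * a i) ^ Poly_Mapping.lookup m i)
      = s ^ mdeg m * (\<Prod>i\<in>UNIV. a i ^ Poly_Mapping.lookup m i)"
    by (simp add: power_mult_distrib prod.distrib power_sum)
  with add show ?case
    by (simp add: msub_add msub_single distrib_left mult_ac del: of_nat_sum)
qed simp

lemmas eval_scale = comm_ring_hom.msub_scale[OF id_comm_ring_hom, folded eval_eq_msub]

definition hcomp :: "nat \<Rightarrow> 'k::comm_ring_1 mpoly3 \<Rightarrow> 'k mpoly3" where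
  "hcomp n p = (\<Sum>m | m \<in> Poly_Mapping.keys p \<and> mdeg m = n. Poly_Mapping.single m (mcoeff p m))"

lemma lookup_hcomp: "mcoeff (hcomp n p) m = (if mdeg m = n then mcoeff p m else 0)"
  by (auto simp: hcomp_def lookup_sum lookup_single when_def sum.delta in_keys_iff)

lemma hcomp_add: "hcomp n (p + q) = hcomp n p + hcomp n q"
  by (rule poly_mapping_eqI) (simp add: lookup_hcomp lookup_add)

lemma hcomp_zero [simp]: "hcomp n 0 = 0"
  by (rule poly_mapping_eqI) (simp add: lookup_hcomp)

lemma hcomp_sum: "hcomp n (sum f A) = (\<Sum>i\<in>A. hcomp n (f i))"
  by (induction A rule: infinite_finite_induct) (auto simp: hcomp_add)

lemma hcomp_hom_part:
  "p \<in> hom_part k \<Longrightarrow> hcomp n p = (if k = int n then p else 0)"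
  by (rule poly_mapping_eqI) (auto simp: lookup_hcomp hom_part_def in_keys_iff simp del: of_nat_sum)

lemma mdeg_eq_0_iff: "mdeg m = 0 \<longleftrightarrow> m = 0"
  by (auto intro: poly_mapping_eqI)

text \<open>Every nonconstant term of \<open>r\<close> pushes \<open>q\<close> beyond degree
  \<open>n\<close>. This turns membership in the ideal of powers, in degree at most d, into a linear
  combination over the field.\<close>

lemma hcomp_mult:
  assumes "q \<in> hom_part (int k)" "n \<le> k"
  shows "hcomp n (r * q) = (if n = k then mconst (mcoeff r 0) * q else 0)"
proof (induction r rule: mpoly_induct)
  case (add m b p)
  have "Poly_Mapping.single m b * q \<in> hom_part (int (mdeg m + k))"
    using assms(1) by (intro hom_part_mult' hom_part_single) auto
  then have "hcomp n (Poly_Mapping.single m b * q) = (if mdeg m + k = n then Poly_Mapping.single m b * q else 0)"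
    using hcomp_hom_part by (metis of_nat_eq_iff)
  moreover have "mdeg m + k = n \<longleftrightarrow> m = 0 \<and> n = k"
    using assms(2) mdeg_eq_0_iff[of m] by auto
  ultimately show ?case
    using add
    by (auto simp: distrib_right hcomp_add lookup_add lookup_single mconst_def single_add distrib_right when_def)
qed (simp add: mconst_def)

subsection \<open>Partial derivatives\<close>

lemma pdiff_superset:
  assumes "finite S" "Poly_Mapping.keys p \<subseteq> S"
  shows "pdiff i p = (\<Sum>m\<in>S. Poly_Mapping.single (m - Poly_Mapping.single i 1)
       (of_nat (Poly_Mapping.lookup m i) * mcoeff p m))"
  unfolding pdiff_def using assms
  by (intro sum.mono_neutral_left) (auto simp: in_keys_iff)

lemma pdiff_zero [simp]: "pdiff i 0 = 0"
  by (simp add: pdiff_def)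

lemma pdiff_add: "pdiff i (p + q) = pdiff i p + pdiff i q"
proof -
  let ?S = "Poly_Mapping.keys p \<union> Poly_Mapping.keys q"
  have "Poly_Mapping.keys (p + q) \<subseteq> ?S" by (rule keys_add)
  then show ?thesis
    by (subst (1 2 3) pdiff_superset[of ?S])
      (auto simp: lookup_add distrib_left single_add sum.distrib)
qed

lemma pdiff_single: "pdiff i (Poly_Mapping.single m b) =
    Poly_Mapping.single (m - Poly_Mapping.single i 1) (of_nat (Poly_Mapping.lookup m i) * b)"
  by (subst pdiff_superset[of "{m}"]) auto

lemma minus_single_add:
  fixes m n :: "3 \<Rightarrow>\<^sub>0 nat"
  assumes "Poly_Mapping.lookup m i > 0"
  shows "m - Poly_Mapping.single i 1 + n = m + n - Poly_Mapping.single i 1"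
  by (rule poly_mapping_eqI) (use assms in \<open>auto simp: lookup_add lookup_minus lookup_single when_def\<close>)

lemma pdiff_mult: "pdiff i (p * q) = pdiff i p * q + p * pdiff i q"
proof (induction p rule: mpoly_induct)
  case (add m b p)
  let ?m = "Poly_Mapping.single m b"
  have "pdiff i (?m * q) = pdiff i ?m * q + ?m * pdiff i q"
  proof (induction q rule: mpoly_induct)
    case (add n c q)
    let ?e = "Poly_Mapping.single i 1 :: 3 \<Rightarrow>\<^sub>0 nat"
    \<comment> \<open>Subtraction of exponents is truncated, so the two exponents may differ when
      \<open>i\<close> does not occur in \<open>m\<close>; the coefficient is then 0 as
      well.\<close>
    have 1: "Poly_Mapping.single (m - ?e + n) (of_nat (Poly_Mapping.lookup m i) * b * c)
        = Poly_Mapping.single (m + n - ?e) (of_nat (Poly_Mapping.lookup m i) * b * c)"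
      using minus_single_add[of m i n] by (cases "Poly_Mapping.lookup m i = 0") auto
    have 2: "Poly_Mapping.single (m + (n - ?e)) (b * (of_nat (Poly_Mapping.lookup n i) * c))
        = Poly_Mapping.single (m + n - ?e) (b * (of_nat (Poly_Mapping.lookup n i) * c))"
      using minus_single_add[of n i m] by (cases "Poly_Mapping.lookup n i = 0") (auto simp: add.commute)
    have "pdiff i (?m * Poly_Mapping.single n c)
        = pdiff i ?m * Poly_Mapping.single n c + ?m * pdiff i (Poly_Mapping.single n c)"
      unfolding mult_single pdiff_single 1 2 lookup_add of_nat_add
      by (simp add: algebra_simps flip: single_add)
    with add show ?case
      by (simp add: distrib_left pdiff_add)
  qed simp
  with add show ?case
    by (simp add: distrib_right pdiff_add)
qed simp

lemma pdiff_mconst [simp]: "pdiff i (mconst c) = 0"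
  by (simp add: mconst_def pdiff_single)

lemma pdiff_one [simp]: "pdiff i 1 = 0"
  using pdiff_mconst[of i 1] by (simp add: mconst_def)

lemma pdiff_mvar: "pdiff i (mvar j) = (if i = j then 1 else 0)"
proof -
  have "Poly_Mapping.single j (1::nat) - Poly_Mapping.single j 1 = 0"
    by (rule poly_mapping_eqI) (simp add: lookup_minus)
  then show ?thesis
    by (auto simp: mvar_def pdiff_single lookup_single when_def)
qed

lemma pdiff_sum: "pdiff i (sum f A) = (\<Sum>j\<in>A. pdiff i (f j))"
  by (induction A rule: infinite_finite_induct) (auto simp: pdiff_add)

lemma pdiff_uminus: "pdiff i (- p) = - pdiff i p"
  using pdiff_add[of i p "- p"] by (simp add: eq_neg_iff_add_eq_0 add.commute)

lemma pdiff_diff: "pdiff i (p - q) = pdiff i p - pdiff i q"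
  using pdiff_add[of i p "- q"] by (simp add: pdiff_uminus)

lemma pdiff_mconst_mult: "pdiff i (mconst c * p) = mconst c * pdiff i p"
  by (simp add: pdiff_mult)

lemma pdiff_power: "pdiff i (p ^ n) = of_nat n * p ^ (n - 1) * pdiff i p"
proof (induction n)
  case (Suc n)
  have "of_nat n * p ^ (n - 1) * pdiff i p * p = of_nat n * p ^ n * pdiff i p"
    by (cases n) (simp_all add: mult_ac)
  then show ?case
    by (simp add: pdiff_mult Suc algebra_simps)
qed simp

lemma pdiff_prod:
  "finite A \<Longrightarrow> pdiff i (prod f A) = (\<Sum>j\<in>A. (\<Prod>k\<in>A - {j}. f k) * pdiff i (f j))"
proof (induction A rule: finite_induct)
  case (insert x A)
  have "(\<Sum>j\<in>A. (\<Prod>k\<in>insert x A - {j}. f k) * pdiff i (f j))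
      = (\<Sum>j\<in>A. f x * ((\<Prod>k\<in>A - {j}. f k) * pdiff i (f j)))"
  proof (rule sum.cong)
    fix j assume "j \<in> A"
    then have "insert x A - {j} = insert x (A - {j})" "x \<notin> A - {j}" using insert by auto
    then show "(\<Prod>k\<in>insert x A - {j}. f k) * pdiff i (f j) = f x * ((\<Prod>k\<in>A - {j}. f k) * pdiff i (f j))"
      using insert by (simp add: mult.assoc)
  qed simp
  with insert show ?case
    by (simp add: pdiff_mult sum_distrib_left)
qed simp

lemma pdiff_hom_part:
  assumes "p \<in> hom_part n"
  shows "pdiff i p \<in> hom_part (n - 1)"
  using assms
proof (induction p rule: hom_part_induct)
  case (add m b p)
  let ?e = "Poly_Mapping.single i 1 :: 3 \<Rightarrow>\<^sub>0 nat"
  have "Poly_Mapping.single (m - ?e) (of_nat (Poly_Mapping.lookup m i) * b) \<in> hom_part (n - 1)"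
  proof (cases "Poly_Mapping.lookup m i = 0")
    case False
    have "m = (m - ?e) + ?e"
      by (rule poly_mapping_eqI) (use False in \<open>auto simp: lookup_add lookup_minus lookup_single when_def\<close>)
    then have "mdeg m = mdeg (m - ?e) + mdeg ?e"
      by (metis (no_types, lifting) lookup_add sum.cong sum.distrib)
    moreover have "mdeg ?e = 1"
      by (simp add: lookup_single when_def)
    ultimately show ?thesis
      using add.hyps by (intro hom_part_single) simp
  qed simp
  with add show ?case
    by (auto simp: pdiff_add pdiff_single)
qed simp

subsection \<open>Linear forms\<close>

definition lform :: "(3 \<Rightarrow> 'k::comm_ring_1) \<Rightarrow> 'k mpoly3" where
  "lform v = (\<Sum>i\<in>UNIV. mconst (v i) * mvar i)"

lemma mdeg_1_cases:
  assumes "mdeg m = 1"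
  shows "\<exists>i. m = Poly_Mapping.single i 1"
proof -
  have "\<exists>i. Poly_Mapping.lookup m i = 1 \<and> (\<forall>j. j \<noteq> i \<longrightarrow> Poly_Mapping.lookup m j = 0)"
    using assms by (simp add: sum_UNIV_3 all_3 ex_3) linarith
  then obtain i where "Poly_Mapping.lookup m i = 1" "\<forall>j. j \<noteq> i \<longrightarrow> Poly_Mapping.lookup m j = 0" by auto
  then have "m = Poly_Mapping.single i 1"
    by (intro poly_mapping_eqI) (auto simp: lookup_single when_def)
  then show ?thesis by blast
qed

lemma single_1_eq_iff: "Poly_Mapping.single i (1::nat) = Poly_Mapping.single j 1 \<longleftrightarrow> i = j"
  by (metis lookup_single_eq lookup_single_not_eq one_neq_zero)

lemma lookup_lform: "mcoeff (lform v) (Poly_Mapping.single i 1) = v i"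
  by (simp add: single_1_eq_iff[simplified] lform_def mconst_def mvar_def mult_single lookup_sum lookup_single when_def sum.delta)

lemma lform_hom_part [simp, intro]: "lform v \<in> hom_part 1"
  by (auto simp: lform_def)

lemma hom_part_1_eqI:
  assumes "p \<in> hom_part 1" "q \<in> hom_part 1" "\<And>i. mcoeff p (Poly_Mapping.single i 1) = mcoeff q (Poly_Mapping.single i 1)"
  shows "p = q"
proof (rule poly_mapping_eqI)
  fix m
  show "mcoeff p m = mcoeff q m"
  proof (cases "mdeg m = 1")
    case True
    with mdeg_1_cases assms(3) show ?thesis by blast
  next
    case False
    with assms(1,2) have "m \<notin> Poly_Mapping.keys p" "m \<notin> Poly_Mapping.keys q"
      by (auto simp: hom_part_def simp del: of_nat_sum)
    then show ?thesis by (simp add: in_keys_iff)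
  qed
qed

lemma linear_form_eq: "linear_form l \<Longrightarrow> l = lform (dual_point l)"
  unfolding linear_form_def
  by (rule hom_part_1_eqI) (auto simp: lookup_lform dual_point_def simp del: One_nat_def)

lemma dual_point_lform [simp]: "dual_point (lform v) = v"
  by (auto simp: dual_point_def lookup_lform simp del: One_nat_def)

lemma lform_eq_0_iff: "lform v = 0 \<longleftrightarrow> v = 0"
proof
  assume "lform v = 0"
  then show "v = 0"
    by (metis dual_point_lform dual_point_def lookup_zero ext zero_fun_apply)
qed (simp add: lform_def mconst_def)

lemma linear_form_lform: "linear_form (lform v) \<longleftrightarrow> v \<noteq> 0"
  by (simp add: linear_form_def lform_eq_0_iff)

lemma linear_form_dual_nz: "linear_form l \<Longrightarrow> dual_point l \<noteq> 0"
  by (metis linear_form_eq linear_form_lform)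

lemma (in comm_ring_hom) msub_lform: "msub hom a (lform v) = (\<Sum>i\<in>UNIV. hom (v i) * a i)"
  by (simp add: lform_def msub_sum msub_mult)

lemma eval_lform: "eval (lform v) p = (\<Sum>i\<in>UNIV. v i * p i)"
  using comm_ring_hom.msub_lform[OF id_comm_ring_hom] by (simp add: eval_eq_msub)

lemma pdiff_lform: "pdiff i (lform v) = mconst (v i)"
proof -
  have "pdiff i (lform v) = (\<Sum>j\<in>UNIV. if j = i then mconst (v j) else 0)"
    unfolding lform_def pdiff_sum by (rule sum.cong) (auto simp: pdiff_mult pdiff_mvar)
  then show ?thesis by (simp add: sum.delta)
qed

subsection \<open>Polynomial functions\<close>

lemma poly_poly_nonroot:
  fixes b :: "'k::{idom, ring_char_0} poly poly"
  assumes "b \<noteq> 0"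
  shows "\<exists>u v. poly (poly b [:u:]) v \<noteq> 0"
proof -
  have "finite {x. poly b x = 0}" using assms by (rule poly_roots_finite)
  moreover have "infinite (range (\<lambda>u::'k. [:u:]))"
    by (simp add: finite_image_iff inj_on_def infinite_UNIV_char_0)
  ultimately obtain u where "poly b [:u:] \<noteq> 0"
    by (metis (mono_tags, lifting) finite_subset image_subset_iff mem_Collect_eq)
  then show ?thesis
    using poly_all_0_iff_0 by blast
qed

text \<open>The identification with K[x][y][z], injective by \<open>coeff_mtri\<close>. It makes the
  finiteness of root sets of univariate polynomials available, one variable at a time.\<close>

definition mtri :: "'k::comm_ring_1 mpoly3 \<Rightarrow> 'k poly poly poly" where
  "mtri = msub (\<lambda>c. [:[:[:c:]:]:])
     (\<lambda>i. if i = 0 then [:[:[:0, 1:]:]:] else if i = 1 then [:[:0, 1:]:] else [:0, 1:])"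

lemma const3_hom: "comm_ring_hom (\<lambda>c::'k::comm_ring_1. [:[:[:c:]:]:])"
  by unfold_locales (simp_all flip: one_pCons)

lemma coeff_mtri_single:
  "mtri (Poly_Mapping.single m b) = monom (monom (monom b (Poly_Mapping.lookup m 0)) (Poly_Mapping.lookup m 1)) (Poly_Mapping.lookup m 2)"
proof -
  have a: "[:0, 1:] ^ n = monom 1 n" for n and x :: "'x::comm_ring_1"
    by (simp add: monom_altdef)
  have b: "[:c:] ^ n = [:c ^ n:]" for c :: "'x::comm_ring_1" and n
    by (induction n) (simp_all flip: one_pCons)
  show ?thesis
    unfolding mtri_def comm_ring_hom.msub_single[OF const3_hom]
    by (simp add: prod_UNIV_3 b smult_monom monom_altdef mult_ac)
qed

lemma coeff_mtri: "poly.coeff (poly.coeff (poly.coeff (mtri p) (Poly_Mapping.lookup m 2)) (Poly_Mapping.lookup m 1)) (Poly_Mapping.lookup m 0) = mcoeff p m"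
proof (induction p rule: mpoly_induct)
  case (add n b p)
  have "n = m \<longleftrightarrow> (\<forall>i. Poly_Mapping.lookup n i = Poly_Mapping.lookup m i)"
    by (simp add: poly_mapping_eq_iff fun_eq_iff)
  then have "poly.coeff (poly.coeff (poly.coeff (mtri (Poly_Mapping.single n b)) (Poly_Mapping.lookup m 2)) (Poly_Mapping.lookup m 1)) (Poly_Mapping.lookup m 0)
     = mcoeff (Poly_Mapping.single n b) m"
    by (auto simp: coeff_mtri_single lookup_single all_3 when_def)
  with add show ?case
    by (simp add: mtri_def comm_ring_hom.msub_add[OF const3_hom] lookup_add)
qed (simp add: mtri_def comm_ring_hom.msub_zero[OF const3_hom])

lemma ex_eval_nonzero:
  fixes p :: "'k::{field_char_0} mpoly3"
  assumes "p \<noteq> 0"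
  shows "\<exists>v. eval p v \<noteq> 0"
proof -
  from assms obtain m where "mcoeff p m \<noteq> 0"
    by (metis poly_mapping_eqI lookup_zero)
  then have "mtri p \<noteq> 0"
    using coeff_mtri[of p m] by force
  then have "finite {x. poly (mtri p) x = 0}" by (rule poly_roots_finite)
  moreover have "infinite (range (\<lambda>u::'k. [:[:u:]:]))"
    by (simp add: finite_image_iff inj_on_def infinite_UNIV_char_0)
  ultimately obtain c where "poly (mtri p) [:[:c:]:] \<noteq> 0"
    by (metis (mono_tags, lifting) finite_subset image_subset_iff mem_Collect_eq)
  from poly_poly_nonroot[OF this] obtain b a
    where *: "poly (poly (poly (mtri p) [:[:c:]:]) [:b:]) a \<noteq> 0" by auto
  define h where "h = (\<lambda>q. poly (poly (poly q [:[:c:]:]) [:b:]) a)"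
  interpret h: comm_ring_hom h
    by unfold_locales (simp_all add: h_def)
  have "h (mtri p) = eval p (\<lambda>i. if i = 0 then a else if i = 1 then b else c)"
    unfolding mtri_def h.hom_msub[OF const3_hom] eval_eq_msub
    by (intro arg_cong2[where f = "\<lambda>f v. msub f v p"] ext) (auto simp: h_def)
  with * show ?thesis by (auto simp: h_def)
qed

section \<open>Linear algebra\<close>

text \<open>Fraction-free form of the alternative between linear dependence and the existence
  of a left inverse.\<close>

lemma dependent_or_dual:
  fixes a :: "'j \<Rightarrow> 'i \<Rightarrow> 'r::idom"
  assumes "finite J" "finite I"
  shows "(\<exists>x. (\<exists>j\<in>J. x j \<noteq> 0) \<and> (\<forall>i\<in>I. (\<Sum>j\<in>J. x j * a j i) = 0)) \<or>
    (\<exists>b \<delta>. \<delta> \<noteq> 0 \<and> (\<forall>j\<in>J. \<forall>j'\<in>J. (\<Sum>i\<in>I. b j i * a j' i) = (if j = j' then \<delta> else 0)))"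
  using assms(1)
proof (induction J rule: finite_induct)
  case empty
  then show ?case by (auto intro!: exI[of _ 1])
next
  case (insert k J)
  show ?case
  proof (cases "\<exists>x. (\<exists>j\<in>J. x j \<noteq> 0) \<and> (\<forall>i\<in>I. (\<Sum>j\<in>J. x j * a j i) = 0)")
    case True
    then obtain x j where x: "j \<in> J" "x j \<noteq> 0" "\<forall>i\<in>I. (\<Sum>j\<in>J. x j * a j i) = 0" by auto
    have "(\<Sum>j\<in>J. (if j = k then 0 else x j) * a j i) = (\<Sum>j\<in>J. x j * a j i)" for i
      by (rule sum.cong) (use insert in auto)
    moreover have "j \<noteq> k" using x insert by auto
    ultimately show ?thesis
      using x insert by (intro disjI1 exI[of _ "\<lambda>j. if j = k then 0 else x j"]) (auto intro!: bexI[of _ j])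
  next
    case False
    with insert.IH obtain b \<delta> where "\<delta> \<noteq> 0"
      and b: "\<forall>j\<in>J. \<forall>j'\<in>J. (\<Sum>i\<in>I. b j i * a j' i) = (if j = j' then \<delta> else 0)" by blast
    define f where "f = (\<lambda>j y. \<Sum>i\<in>I. b j i * (y i :: 'r))"
    have f: "f j (a j') = (if j = j' then \<delta> else 0)" if "j \<in> J" "j' \<in> J" for j j'
      using b that by (simp add: f_def)
    \<comment> \<open>Coefficients of the residue of the new row \<open>a k\<close> modulo the old
      rows, scaled by \<open>\<delta>\<close> to avoid division. If the residue vanishes,
      \<open>x\<close> is a dependency; otherwise any nonzero entry of it serves as a pivot.\<close>
    define x where "x = (\<lambda>j. if j = k then \<delta> else - f j (a k))"
    have x: "(\<Sum>j\<in>insert k J. x j * y j) = \<delta> * y k - (\<Sum>j\<in>J. f j (a k) * y j)" for y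
    proof -
      have "(\<Sum>j\<in>J. x j * y j) = (\<Sum>j\<in>J. - (f j (a k) * y j))"
        by (rule sum.cong) (use insert in \<open>auto simp: x_def\<close>)
      then show ?thesis using insert by (simp add: x_def sum_negf)
    qed
    show ?thesis
    proof (cases "\<forall>i\<in>I. (\<Sum>j\<in>insert k J. x j * a j i) = 0")
      case True
      then show ?thesis
        using \<open>\<delta> \<noteq> 0\<close> by (intro disjI1 exI[of _ x]) (auto simp: x_def)
    next
      case nz: False
      then obtain i0 where i0: "i0 \<in> I" "(\<Sum>j\<in>insert k J. x j * a j i0) \<noteq> 0" by auto
        define \<epsilon> where "\<epsilon> = (\<Sum>j\<in>insert k J. x j * a j i0)"
        \<comment> \<open>The functional \<open>g\<close> reads off entry \<open>i0\<close> of the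
          residue of a vector. It kills the old rows and takes the pivot value
          \<open>\<epsilon>\<close> at \<open>a k\<close>, so it completes the dual system once the
          old functionals are corrected by multiples of it.\<close>
        define c where "c = (\<lambda>i. (if i = i0 then \<delta> else 0) - (\<Sum>j\<in>J. a j i0 * b j i))"
        define g where "g = (\<lambda>y. \<Sum>i\<in>I. c i * (y i :: 'r))"
        have g: "g y = \<delta> * y i0 - (\<Sum>j\<in>J. a j i0 * f j y)" for y
        proof -
          have "g y = (\<Sum>i\<in>I. (if i = i0 then \<delta> * y i else 0)) - (\<Sum>i\<in>I. \<Sum>j\<in>J. a j i0 * b j i * y i)"
            unfolding g_def c_def
            by (simp add: left_diff_distrib sum_subtractf sum_distrib_right if_distrib[of "\<lambda>u. u * _"] cong: if_cong)
          also have "(\<Sum>i\<in>I. \<Sum>j\<in>J. a j i0 * b j i * y i) = (\<Sum>j\<in>J. a j i0 * f j y)"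
            by (subst sum.swap) (simp add: f_def sum_distrib_left mult.assoc)
          finally show ?thesis using assms(2) i0 by (simp add: sum.delta)
        qed
        have g_J: "g (a j) = 0" if "j \<in> J" for j
        proof -
          have "(\<Sum>j'\<in>J. a j' i0 * f j' (a j)) = (\<Sum>j'\<in>J. if j' = j then a j' i0 * \<delta> else 0)"
            by (rule sum.cong) (use f that in auto)
          then show ?thesis using insert that by (simp add: g sum.delta)
        qed
        have g_k: "g (a k) = \<epsilon>"
          unfolding g \<epsilon>_def x by (simp add: mult.commute)
        define b' where "b' = (\<lambda>j i. if j = k then \<delta> * c i else \<epsilon> * b j i - f j (a k) * c i)"
        have b': "(\<Sum>i\<in>I. b' j i * y i) = (if j = k then \<delta> * g y else \<epsilon> * f j y - f j (a k) * g y)" for j y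
          by (simp add: b'_def f_def g_def sum_distrib_left left_diff_distrib sum_subtractf mult.assoc)
        have "(\<Sum>i\<in>I. b' j i * a j' i) = (if j = j' then \<epsilon> * \<delta> else 0)"
          if "j \<in> insert k J" "j' \<in> insert k J" for j j'
          unfolding b' using that insert(2) g_J g_k f by auto
        moreover have "\<epsilon> * \<delta> \<noteq> 0" using i0 \<open>\<delta> \<noteq> 0\<close> by (simp add: \<epsilon>_def)
        ultimately show ?thesis by (intro disjI2 exI[of _ b'] exI[of _ "\<epsilon> * \<delta>"]) auto
    qed
  qed
qed

text \<open>A square matrix and its transpose have the same determinant. Applied to the jets of the
  powers, this turns a functional that kills all powers into a linear relation between them modulo
  the square of \<open>L\<close>.\<close>

lemma left_kernel_imp_right_kernel:
  fixes a :: "nat \<Rightarrow> nat \<Rightarrow> 'k::idom"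
  assumes "\<exists>i<n. x i \<noteq> 0" "\<And>j. j < n \<Longrightarrow> (\<Sum>i<n. x i * a j i) = 0"
  shows "\<exists>y. (\<exists>j<n. y j \<noteq> 0) \<and> (\<forall>i<n. (\<Sum>j<n. y j * a j i) = 0)"
proof -
  define A where "A = mat n n (\<lambda>(j, i). a j i)"
  have A: "A \<in> carrier_mat n n" by (simp add: A_def)
  have "vec n x \<noteq> 0\<^sub>v n" using assms(1) by (auto simp: vec_eq_iff)
  moreover have "A *\<^sub>v vec n x = 0\<^sub>v n"
    using assms(2) by (auto simp: A_def vec_eq_iff scalar_prod_def mult.commute atLeast0LessThan)
  ultimately have "det A = 0"
    using det_0_iff_vec_prod_zero[OF A] by (metis vec_carrier)
  then have "det (transpose_mat A) = 0"
    using det_transpose[OF A] by simp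
  then obtain v where v: "v \<in> carrier_vec n" "v \<noteq> 0\<^sub>v n" "transpose_mat A *\<^sub>v v = 0\<^sub>v n"
    using det_0_iff_vec_prod_zero[of "transpose_mat A" n] A by auto
  have "(\<Sum>j<n. v $ j * a j i) = 0" if "i < n" for i
  proof -
    have "(transpose_mat A *\<^sub>v v) $ i = 0" using v(3) that by simp
    then show ?thesis
      using that v(1) by (simp add: A_def scalar_prod_def mult.commute atLeast0LessThan)
  qed
  moreover have "\<exists>j<n. v $ j \<noteq> 0"
    using v by (auto simp: vec_eq_iff)
  ultimately show ?thesis by blast
qed

subsection \<open>Vectors with three entries\<close>

definition dot :: "(3 \<Rightarrow> 'a) \<Rightarrow> (3 \<Rightarrow> 'a) \<Rightarrow> 'a::comm_ring_1" where
  "dot u v = (\<Sum>i\<in>UNIV. u i * v i)"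

definition cross :: "(3 \<Rightarrow> 'a) \<Rightarrow> (3 \<Rightarrow> 'a) \<Rightarrow> 3 \<Rightarrow> 'a::comm_ring_1" where
  "cross u v = (\<lambda>i. if i = 0 then u 1 * v 2 - u 2 * v 1
     else if i = 1 then u 2 * v 0 - u 0 * v 2 else u 0 * v 1 - u 1 * v 0)"

definition det3 :: "(3 \<Rightarrow> 'a) \<Rightarrow> (3 \<Rightarrow> 'a) \<Rightarrow> (3 \<Rightarrow> 'a) \<Rightarrow> 'a::comm_ring_1" where
  "det3 u v w = dot u (cross v w)"

lemmas vec3_defs = dot_def cross_def det3_def sum_UNIV_3

lemma dot_cross_self [simp]: "dot u (cross u v) = 0" "dot v (cross u v) = 0"
  "dot (cross u v) u = 0" "dot (cross u v) v = 0"
  by (simp_all add: vec3_defs algebra_simps)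

lemma dot_commute: "dot u v = dot v u"
  by (simp add: dot_def mult.commute)

lemma cross_triple: "cross u (cross v w) i = v i * dot u w - w i * dot u v"
  by (cases i rule: cases_3) (simp_all add: vec3_defs algebra_simps)

text \<open>Cramer's rule for four vectors, the expansion of a 4 x 4 determinant with a repeated
  row. It expresses \<open>v\<close> through \<open>t\<close> and \<open>w\<close> up to a multiple
  of \<open>a\<close>.\<close>

lemma det3_relation:
  "v i * det3 a t w - t i * det3 a v w + w i * det3 a v t - a i * det3 v t w = 0"
  by (cases i rule: cases_3) (simp_all add: vec3_defs algebra_simps)

lemma cross_0_right: "cross e 0 i = 0"
  by (simp add: cross_def)

text \<open>Both \<open>u\<close> and \<open>v\<close> are orthogonal to \<open>g\<close>, so
  \<open>cross u v\<close> is parallel to \<open>g\<close>; being orthogonal also to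
  \<open>e\<close>, which \<open>g\<close> is not, it vanishes.\<close>

lemma cross_eq_0_of_dot_0:
  fixes u v g e :: "3 \<Rightarrow> 'a::idom"
  assumes "dot u g = 0" "dot v g = 0" "dot e g \<noteq> 0" "det3 e u v = 0"
  shows "cross u v = 0"
proof -
  have "cross e (cross (cross u v) g) i = cross u v i * dot e g - g i * dot e (cross u v)" for i
    by (rule cross_triple)
  moreover have "cross (cross u v) g = 0"
  proof
    fix i
    have "cross (cross u v) g i = - cross g (cross u v) i"
      by (cases i rule: cases_3) (simp_all add: vec3_defs algebra_simps)
    also have "\<dots> = 0" using assms(1,2) by (simp add: cross_triple dot_commute)
    finally show "cross (cross u v) g i = 0 i" by simp
  qed
  ultimately have "cross u v i * dot e g = 0" for i
    using assms(4) by (simp add: det3_def cross_0_right)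
  then show ?thesis using assms(3) by (auto intro!: ext)
qed

lemma cross_eq_0_imp_scalar:
  fixes u v :: "3 \<Rightarrow> 'k::field"
  assumes "cross u v = 0" "v \<noteq> 0"
  shows "\<exists>c. u = (\<lambda>i. c * v i)"
proof -
  obtain j where j: "v j \<noteq> 0" using assms(2) by (auto simp: fun_eq_iff)
  have "u i * v j = u j * v i" for i
  proof -
    have "cross u v 0 = 0" "cross u v 1 = 0" "cross u v 2 = 0" using assms(1) by simp_all
    then show ?thesis
      by (cases i rule: cases_3; cases j rule: cases_3) (simp_all add: cross_def mult.commute)
  qed
  then have "u i = (u j / v j) * v i" for i
    using j by (metis nonzero_eq_divide_eq times_divide_eq_left)
  then show ?thesis by (intro exI[of _ "u j / v j"] ext)
qed

lemma det3_eq_0I: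
  fixes p a b c :: "3 \<Rightarrow> 'k::field"
  assumes "p \<noteq> 0" "dot a p = 0" "dot b p = 0" "dot c p = 0"
  shows "det3 a b c = 0"
proof -
  obtain j where j: "p j \<noteq> 0" using assms(1) by (auto simp: fun_eq_iff)
  have "p j * det3 a b c = dot a p * cross b c j + dot b p * cross c a j + dot c p * cross a b j"
    by (cases j rule: cases_3) (simp_all add: vec3_defs algebra_simps)
  with assms j show ?thesis by simp
qed

section \<open>Triples of univariate polynomials\<close>

lemma coeff_mult_top:
  assumes "Polynomial.degree p \<le> m" "Polynomial.degree q \<le> n"
  shows "poly.coeff (p * q) (m + n) = poly.coeff p m * poly.coeff q n"
proof -
  have "poly.coeff (p * q) (m + n) = (\<Sum>i\<le>m + n. poly.coeff p i * poly.coeff q (m + n - i))"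
    by (rule coeff_mult)
  also have "\<dots> = (\<Sum>i\<in>{m}. poly.coeff p i * poly.coeff q (m + n - i))"
  proof (rule sum.mono_neutral_right)
    show "\<forall>i\<in>{..m + n} - {m}. poly.coeff p i * poly.coeff q (m + n - i) = 0"
    proof
      fix i assume "i \<in> {..m + n} - {m}"
      then have "i > m \<or> m + n - i > n" by auto
      then show "poly.coeff p i * poly.coeff q (m + n - i) = 0"
        using assms by (auto simp: coeff_eq_0)
    qed
  qed auto
  finally show ?thesis by simp
qed

lemma degree_mult_le_add:
  "Polynomial.degree p \<le> m \<Longrightarrow> Polynomial.degree q \<le> n \<Longrightarrow> Polynomial.degree (p * q) \<le> m + n"
  using degree_mult_le[of p q] by linarith

lemma bezout_no_common_root:
  fixes g :: "3 \<Rightarrow> 'k::alg_closed_field poly"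
  assumes "\<And>t. \<exists>i. poly (g i) t \<noteq> 0"
  shows "\<exists>\<gamma>. dot \<gamma> g = 1"
proof -
  obtain i0 where i0: "g i0 \<noteq> 0" using assms by (metis poly_0)
  define P where "P = (\<lambda>p. p \<noteq> 0 \<and> (\<exists>\<gamma>. dot \<gamma> g = p))"
  have unit: "dot (\<lambda>j. if j = i then c else 0) g = c * g i" for i c
    unfolding dot_def by (simp add: if_distrib[of "\<lambda>u. u * _"] sum.delta cong: if_cong)
  have "P (g i0)" using unit[of i0 1] i0 unfolding P_def by force
  then obtain p where p: "P p" and min: "\<And>q. P q \<Longrightarrow> Polynomial.degree p \<le> Polynomial.degree q"
    using arg_min_nat_lemma[of P "g i0" Polynomial.degree] by metis
  then obtain \<gamma> where \<gamma>: "dot \<gamma> g = p" and "p \<noteq> 0" unfolding P_def by auto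
  have "p dvd g i" for i
  proof (rule ccontr)
    assume "\<not> p dvd g i"
    then have nz: "g i mod p \<noteq> 0" by (simp add: mod_eq_0_iff_dvd)
    have "dot (\<lambda>j. (if j = i then 1 else 0) - (g i div p) * \<gamma> j) g
        = dot (\<lambda>j. if j = i then 1 else 0) g - (g i div p) * dot \<gamma> g"
      by (simp add: dot_def left_diff_distrib sum_subtractf sum_distrib_left mult.assoc)
    also have "\<dots> = g i mod p"
      by (simp add: unit \<gamma> minus_div_mult_eq_mod)
    finally have "P (g i mod p)" unfolding P_def using nz by blast
    with min have "Polynomial.degree p \<le> Polynomial.degree (g i mod p)" by blast
    moreover have "Polynomial.degree (g i mod p) < Polynomial.degree p"
      using nz \<open>p \<noteq> 0\<close> degree_mod_less by blast
    ultimately show False by simp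
  qed
  then have "poly p t \<noteq> 0" for t
    using assms[of t] by (metis dvd_trans poly_eq_0_iff_dvd)
  then have "Polynomial.degree p = 0"
    using alg_closed_imp_poly_has_root by blast
  then obtain c where c: "p = [:c:]" by (rule degree_eq_zeroE)
  with \<open>p \<noteq> 0\<close> have "c \<noteq> 0" by simp
  have "dot (\<lambda>i. [:inverse c:] * \<gamma> i) g = [:inverse c:] * dot \<gamma> g"
    by (simp only: dot_def sum_distrib_left mult.assoc)
  also have "\<dots> = 1" using \<open>c \<noteq> 0\<close> by (simp add: \<gamma> c flip: one_pCons)
  finally show ?thesis by blast
qed

text \<open>The hypothesis on the coefficients of degree \<open>n\<close> says that the forms of degree \<open>n\<close>
  given by \<open>g\<close> do not vanish simultaneously at infinity.\<close>

lemma bezout_bounded: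
  fixes g :: "3 \<Rightarrow> 'k::alg_closed_field poly"
  assumes "\<And>t. \<exists>i. poly (g i) t \<noteq> 0"
    and deg: "\<And>i. Polynomial.degree (g i) \<le> n" and "poly.coeff (g j) n \<noteq> 0"
    and "2 * n \<le> N" "Polynomial.degree p \<le> N"
  shows "\<exists>\<gamma>. (\<forall>i. Polynomial.degree (\<gamma> i) \<le> N - n) \<and> dot \<gamma> g = p"
proof -
  obtain \<gamma> where \<gamma>: "dot \<gamma> g = 1" using bezout_no_common_root assms(1) by blast
  have dj: "Polynomial.degree (g j) = n" "g j \<noteq> 0"
    using assms(3) deg[of j] by (auto intro: antisym le_degree)
  \<comment> \<open>The coefficients other than that of \<open>g j\<close> are reduced modulo
    \<open>g j\<close>, whose degree is exactly \<open>n\<close>. The quotients are collected in the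
    coefficient \<open>q\<close> of \<open>g j\<close>, whose degree is then forced by that of
    \<open>p\<close>.\<close>
  define r where "r = (\<lambda>i. (p * \<gamma> i) mod g j)"
  define s where "s = (\<lambda>i. (p * \<gamma> i) div g j)"
  define q where "q = p * \<gamma> j + (\<Sum>i\<in>UNIV - {j}. s i * g i)"
  have degr: "Polynomial.degree (r i) \<le> n" for i
    using degree_mod_less[of "g j" "p * \<gamma> i"] dj unfolding r_def by auto
  have "p = (\<Sum>i\<in>UNIV. p * \<gamma> i * g i)"
    using \<gamma> by (simp add: dot_def mult.assoc flip: sum_distrib_left)
  also have "\<dots> = p * \<gamma> j * g j + (\<Sum>i\<in>UNIV - {j}. (s i * g j + r i) * g i)"
    unfolding r_def s_def div_mult_mod_eq by (subst sum.remove[of _ j]) auto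
  also have "\<dots> = q * g j + (\<Sum>i\<in>UNIV - {j}. r i * g i)"
    by (simp add: q_def algebra_simps sum.distrib sum_distrib_left)
  finally have eq: "p = q * g j + (\<Sum>i\<in>UNIV - {j}. r i * g i)" .
  have "Polynomial.degree (\<Sum>i\<in>UNIV - {j}. r i * g i) \<le> N"
    by (rule degree_sum_le) (auto intro!: order_trans[OF degree_mult_le_add[OF degr deg]] assms(4) simp flip: mult_2)
  then have "Polynomial.degree (q * g j) \<le> N"
    using degree_diff_le[OF assms(5)] eq by (metis add_diff_cancel_right')
  then have "Polynomial.degree q \<le> N - n"
    using dj by (cases "q = 0") (auto simp: degree_mult_eq)
  moreover have "n \<le> N - n" using assms(4) by simp
  ultimately have "Polynomial.degree ((r(j := q)) i) \<le> N - n" for i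
    using degr[of i] by auto
  moreover have "dot (r(j := q)) g = p"
  proof -
    have "dot (r(j := q)) g = q * g j + (\<Sum>i\<in>UNIV - {j}. (r(j := q)) i * g i)"
      unfolding dot_def by (subst sum.remove[of _ j]) auto
    also have "(\<Sum>i\<in>UNIV - {j}. (r(j := q)) i * g i) = (\<Sum>i\<in>UNIV - {j}. r i * g i)"
      by (rule sum.cong) auto
    finally show ?thesis using eq by metis
  qed
  ultimately show ?thesis by blast
qed

lemma degree_cross_le:
  assumes "\<And>i. Polynomial.degree (u i) \<le> m" "\<And>i. Polynomial.degree (v i) \<le> n"
  shows "Polynomial.degree (cross u v i) \<le> m + n"
  unfolding cross_def by (auto intro!: degree_diff_le degree_mult_le_add assms)

lemma coeff_cross_top:
  assumes "\<And>i. Polynomial.degree (u i) \<le> m" "\<And>i. Polynomial.degree (v i) \<le> n"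
  shows "poly.coeff (cross u v i) (m + n) = cross (\<lambda>i. poly.coeff (u i) m) (\<lambda>i. poly.coeff (v i) n) i"
  by (simp add: cross_def coeff_mult_top assms)

text \<open>Leading coefficients of \<open>\<tau>\<close> are removed by multiples of \<open>\<omega>\<close> as long as they do not
  contribute to \<open>\<tau> \<times> \<omega>\<close>.\<close>

lemma cross_divisor:
  fixes g \<omega> :: "3 \<Rightarrow> 'k::alg_closed_field poly"
  assumes nz: "\<And>t. \<exists>i. poly (\<omega> i) t \<noteq> 0"
    and deg: "\<And>i. Polynomial.degree (\<omega> i) \<le> a" and top: "poly.coeff (\<omega> j) a \<noteq> 0"
    and "dot g \<omega> = 0" and degg: "\<And>i. Polynomial.degree (g i) \<le> n" and "2 * a \<le> n"
  shows "\<exists>\<tau>. (\<forall>i. Polynomial.degree (\<tau> i) \<le> n - a) \<and> cross \<tau> \<omega> = g"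
proof -
  obtain \<gamma> where \<gamma>: "dot \<gamma> \<omega> = 1" using bezout_no_common_root nz by blast
  have descent: "\<exists>\<tau>. (\<forall>i. Polynomial.degree (\<tau> i) \<le> n - a) \<and> cross \<tau> \<omega> = g"
    if "\<forall>i. Polynomial.degree (\<tau> i) \<le> N" "cross \<tau> \<omega> = g" for N \<tau>
    using that
  proof (induction N arbitrary: \<tau>)
    case 0
    then show ?case by (auto intro!: exI[of _ \<tau>])
  next
    case (Suc N)
    show ?case
    proof (cases "Suc N \<le> n - a")
      case True
      with Suc.prems show ?thesis by (intro exI[of _ \<tau>]) (auto intro: order_trans)
    next
      case False
      let ?t = "\<lambda>i. poly.coeff (\<tau> i) (Suc N)" and ?w = "\<lambda>i. poly.coeff (\<omega> i) a"
      have "cross ?t ?w i = 0" for i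
        using coeff_cross_top[of \<tau> "Suc N" \<omega> a i] Suc.prems deg degg[of i] False
        by (simp add: coeff_eq_0)
      moreover have "?w \<noteq> 0" using top by (auto simp: fun_eq_iff)
      ultimately obtain c where c: "?t = (\<lambda>i. c * ?w i)"
        using cross_eq_0_imp_scalar[of ?t ?w] by (auto simp: fun_eq_iff)
      \<comment> \<open>Here \<open>2 * a \<le> n\<close> enters: a degree above
        \<open>n - a\<close> is also above \<open>a\<close>, so the leading coefficients
        \<open>c * ?w\<close> can be cancelled by a monomial multiple of
        \<open>\<omega>\<close>.\<close>
      have a: "a \<le> Suc N" using False assms(6) by simp
      define \<sigma> where "\<sigma> = (\<lambda>i. \<tau> i - monom c (Suc N - a) * \<omega> i)"
      have "cross \<sigma> \<omega> = cross \<tau> \<omega>"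
        unfolding \<sigma>_def cross_def by (auto simp: algebra_simps)
      moreover have "Polynomial.degree (\<sigma> i) \<le> N" for i
      proof -
        have 1: "Polynomial.degree (monom c (Suc N - a)) \<le> Suc N - a" by (rule degree_monom_le)
        have "Polynomial.degree (\<sigma> i) \<le> Suc N"
          unfolding \<sigma>_def using Suc.prems degree_mult_le_add[OF 1 deg[of i]] a
          by (intro degree_diff_le) auto
        moreover have "poly.coeff (\<sigma> i) (Suc N) = 0"
          using fun_cong[OF c, of i] a by (simp add: \<sigma>_def coeff_monom_mult)
        ultimately show ?thesis
          by (intro degree_le) (metis Suc_lessI coeff_eq_0 le_less_trans)
      qed
      ultimately show ?thesis using Suc by metis
    qed
  qed
  \<comment> \<open>Since \<open>\<gamma>\<close> is a left inverse of \<open>\<omega>\<close>, the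
    triple product identity makes \<open>cross \<gamma> g\<close> a solution, of uncontrolled
    degree, from which \<open>descent\<close> starts.\<close>
  have eq: "cross (cross \<gamma> g) \<omega> = g"
  proof
    fix i
    have "cross (cross \<gamma> g) \<omega> i = - cross \<omega> (cross \<gamma> g) i"
      by (cases i rule: cases_3) (simp_all add: vec3_defs algebra_simps)
    also have "\<dots> = g i" using \<gamma> assms(4) by (simp add: cross_triple dot_commute)
    finally show "cross (cross \<gamma> g) \<omega> i = g i" .
  qed
  have "\<forall>i. Polynomial.degree (cross \<gamma> g i) \<le> (\<Sum>k\<in>UNIV. Polynomial.degree (cross \<gamma> g k))"
    by (auto intro: member_le_sum)
  from descent[OF this eq] show ?thesis .
qed

lemma eq_0_of_many_roots:
  fixes p :: "'k::idom poly"
  assumes "\<And>i. i < m \<Longrightarrow> poly p (r i) = 0" "inj_on r {..<m}" "Polynomial.degree p < m"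
  shows "p = 0"
proof (rule ccontr)
  assume "p \<noteq> 0"
  then have "card (r ` {..<m}) \<le> card {x. poly p x = 0}"
    using assms(1) by (intro card_mono poly_roots_finite) auto
  also have "\<dots> \<le> Polynomial.degree p"
    using \<open>p \<noteq> 0\<close> by (rule card_poly_roots_bound)
  finally show False using assms(2,3) by (simp add: card_image)
qed

section \<open>Restriction to a line\<close>

text \<open>The line \<open>z = u x + (v - \<kappa> u) y\<close> is parametrised by \<open>t \<mapsto> (1 + \<kappa> t, t, u + v t)\<close>,
  so that the form \<open>x - \<kappa> y\<close> becomes \<open>1\<close>. The parameter \<open>\<kappa>\<close> serves to keep the point at
  infinity away from a given finite set of lines.\<close>

lemma const_poly_hom: "comm_ring_hom (\<lambda>c::'k::comm_ring_1. [:c:])"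
  by unfold_locales (simp_all flip: one_pCons)

definition lpt :: "'k \<Rightarrow> 'k \<Rightarrow> 'k \<Rightarrow> 3 \<Rightarrow> 'k::comm_ring_1 poly" where
  "lpt \<kappa> u v = (\<lambda>i. if i = 0 then [:1, \<kappa>:] else if i = 1 then [:0, 1:] else [:u, v:])"

definition ldual :: "'k \<Rightarrow> 'k \<Rightarrow> 'k \<Rightarrow> 3 \<Rightarrow> 'k::comm_ring_1" where
  "ldual \<kappa> u v = (\<lambda>i. if i = 0 then - u else if i = 1 then \<kappa> * u - v else 1)"

definition res :: "'k \<Rightarrow> 'k \<Rightarrow> 'k \<Rightarrow> 'k::comm_ring_1 mpoly3 \<Rightarrow> 'k poly" where
  "res \<kappa> u v = msub (\<lambda>c. [:c:]) (lpt \<kappa> u v)"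

definition xform :: "'k \<Rightarrow> 'k::comm_ring_1 mpoly3" where
  "xform \<kappa> = mvar 0 - mconst \<kappa> * mvar 1"

text \<open>Homogenisation to degree \<open>n\<close> by forms free of z: a right inverse of
  \<open>res\<close>, and its values have derivative 0 in z.\<close>

definition lift :: "'k \<Rightarrow> nat \<Rightarrow> 'k poly \<Rightarrow> 'k::comm_ring_1 mpoly3" where
  "lift \<kappa> n q = (\<Sum>k\<le>n. mconst (poly.coeff q k) * xform \<kappa> ^ (n - k) * mvar 1 ^ k)"

lemmas res_simps =
  comm_ring_hom.msub_simps[OF const_poly_hom, where a = "lpt \<kappa> u v" for \<kappa> u v, folded res_def]
  comm_ring_hom.msub_zero[OF const_poly_hom, where a = "lpt \<kappa> u v" for \<kappa> u v, folded res_def]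
  comm_ring_hom.msub_one[OF const_poly_hom, where a = "lpt \<kappa> u v" for \<kappa> u v, folded res_def]
  comm_ring_hom.msub_mconst[OF const_poly_hom, where a = "lpt \<kappa> u v" for \<kappa> u v, folded res_def]
  comm_ring_hom.msub_mvar[OF const_poly_hom, where a = "lpt \<kappa> u v" for \<kappa> u v, folded res_def]

lemma res_lform: "res \<kappa> u v (lform w) = [:w 0 + u * w 2, \<kappa> * w 0 + w 1 + v * w 2:]"
  by (simp add: lform_def sum_UNIV_3 res_simps lpt_def mult.commute)

lemma res_ldual: "res \<kappa> u v (lform (\<lambda>i. c * ldual \<kappa> u v i)) = 0"
  by (simp add: res_lform ldual_def algebra_simps)

lemma res_xform [simp]: "res \<kappa> u v (xform \<kappa>) = 1"
  by (simp add: xform_def res_simps lpt_def flip: one_pCons)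

lemma xform_hom_part [simp, intro]: "xform \<kappa> \<in> hom_part 1"
  by (auto simp: xform_def)

lemma xform_neq_0: "xform \<kappa> \<noteq> 0"
proof
  assume "xform \<kappa> = 0"
  then have "res \<kappa> 0 0 (xform \<kappa>) = 0" by (simp add: res_simps)
  then show False by simp
qed

lemma poly_res: "poly (res \<kappa> u v p) t = eval p (\<lambda>i. poly (lpt \<kappa> u v i) t)"
proof -
  have "comm_ring_hom (\<lambda>q::'a poly. poly q t)" by unfold_locales simp_all
  from comm_ring_hom.hom_msub[OF this const_poly_hom, of "lpt \<kappa> u v" p]
  show ?thesis
    unfolding res_def eval_eq_msub by simp
qed

lemma degree_lpt_le: "Polynomial.degree (lpt \<kappa> u v i) \<le> 1"
  by (simp add: lpt_def)

lemma degree_prod_le_sum: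
  "finite A \<Longrightarrow> (\<And>i. i \<in> A \<Longrightarrow> Polynomial.degree (f i) \<le> n i) \<Longrightarrow>
    Polynomial.degree (\<Prod>i\<in>A. f i) \<le> (\<Sum>i\<in>A. n i)"
  by (induction A rule: finite_induct) (auto intro!: degree_mult_le_add)

lemma coeff_prod_top:
  "finite A \<Longrightarrow> (\<And>i. i \<in> A \<Longrightarrow> Polynomial.degree (f i) \<le> n i) \<Longrightarrow>
    poly.coeff (\<Prod>i\<in>A. f i) (\<Sum>i\<in>A. n i) = (\<Prod>i\<in>A. poly.coeff (f i) (n i))"
  by (induction A rule: finite_induct) (auto simp: coeff_mult_top degree_prod_le_sum)

lemma degree_power_le_mult: "Polynomial.degree p \<le> k \<Longrightarrow> Polynomial.degree (p ^ n) \<le> k * n"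
  using degree_power_le[of p n] by (metis le_trans mult_le_mono1)

lemma coeff_power_top: "Polynomial.degree p \<le> k \<Longrightarrow> poly.coeff (p ^ n) (k * n) = poly.coeff p k ^ n"
  by (induction n) (auto simp: coeff_mult_top degree_power_le_mult)

text \<open>The point of the line at infinite parameter. The coefficient of order \<open>n\<close>
  in the restriction of a form of degree \<open>n\<close> is the value of the form there.\<close>

definition lptinf :: "'k \<Rightarrow> 'k \<Rightarrow> 3 \<Rightarrow> 'k::comm_ring_1" where
  "lptinf \<kappa> v = (\<lambda>i. if i = 0 then \<kappa> else if i = 1 then 1 else v)"

lemma res_degree_coeff:
  assumes "p \<in> hom_part (int n)"
  shows "Polynomial.degree (res \<kappa> u v p) \<le> n \<and> poly.coeff (res \<kappa> u v p) n = eval p (lptinf \<kappa> v)"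
  using assms
proof (induction p rule: hom_part_induct)
  case zero
  then show ?case by (simp add: res_simps eval_simps)
next
  case (add m b p)
  have c: "poly.coeff (lpt \<kappa> u v i) 1 = lptinf \<kappa> v i" for i
    by (simp add: lpt_def lptinf_def)
  have n: "mdeg m = n" using add.hyps by linarith
  let ?q = "\<Prod>i\<in>UNIV. lpt \<kappa> u v i ^ Poly_Mapping.lookup m i"
  have deg: "Polynomial.degree (lpt \<kappa> u v i ^ Poly_Mapping.lookup m i) \<le> Poly_Mapping.lookup m i" for i
    using degree_power_le_mult[OF degree_lpt_le, of \<kappa> u v i "Poly_Mapping.lookup m i"] by simp
  have "poly.coeff (lpt \<kappa> u v i ^ Poly_Mapping.lookup m i) (Poly_Mapping.lookup m i)
      = lptinf \<kappa> v i ^ Poly_Mapping.lookup m i" for i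
    using coeff_power_top[OF degree_lpt_le, of \<kappa> u v i "Poly_Mapping.lookup m i"] c[of i] by simp
  then have "Polynomial.degree ?q \<le> n" "poly.coeff ?q n = (\<Prod>i\<in>UNIV. lptinf \<kappa> v i ^ Poly_Mapping.lookup m i)"
    using degree_prod_le_sum[of UNIV "\<lambda>i. lpt \<kappa> u v i ^ Poly_Mapping.lookup m i"] deg
      coeff_prod_top[of UNIV "\<lambda>i. lpt \<kappa> u v i ^ Poly_Mapping.lookup m i"]
    by (simp_all flip: n)
  moreover have "res \<kappa> u v (Poly_Mapping.single m b) = [:b:] * ?q"
    unfolding res_def by (rule comm_ring_hom.msub_single[OF const_poly_hom])
  ultimately show ?case
    using add.IH
    by (auto simp: res_simps eval_simps eval_single intro!: degree_add_le order_trans[OF degree_smult_le])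
qed

lemmas degree_res = res_degree_coeff[THEN conjunct1]
  and coeff_res_top = res_degree_coeff[THEN conjunct2]

lemma lift_hom_part [simp, intro]: "lift \<kappa> n q \<in> hom_part (int n)"
proof -
  have "mconst (poly.coeff q k) * xform \<kappa> ^ (n - k) * mvar 1 ^ k \<in> hom_part (int n)" if "k \<le> n" for k
    using that
    by (intro hom_part_mult'[of _ "int (n - k)" _ "int k"] hom_part_mconst_mult hom_part_power1
      xform_hom_part hom_part_mvar) simp
  then show ?thesis unfolding lift_def by (intro hom_part_sum) auto
qed

lemma poly_as_sum_upto: "Polynomial.degree q \<le> n \<Longrightarrow> q = (\<Sum>k\<le>n. smult (poly.coeff q k) ([:0, 1:] ^ k))"
  by (simp only: poly_as_sum_of_monoms' flip: monom_altdef)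

lemma res_lift: "Polynomial.degree q \<le> n \<Longrightarrow> res \<kappa> u v (lift \<kappa> n q) = q"
  by (subst (2) poly_as_sum_upto) (simp_all add: lift_def res_simps lpt_def)

lemma mconst_add: "mconst (a + b) = mconst a + mconst b"
  and mconst_mult: "mconst (a * b) = mconst a * mconst b"
  and mconst_0 [simp]: "mconst 0 = 0"
  and mconst_1 [simp]: "mconst 1 = 1"
  and mconst_diff: "mconst (a' - b') = mconst a' - mconst b'"
  and mconst_uminus: "mconst (- a') = - mconst a'"
  for a b :: "'k::comm_ring_1" and a' b' :: "'k::comm_ring_1"
  by (simp_all add: mconst_def single_add mult_single single_diff single_uminus)

lemma mconst_of_nat: "mconst (of_nat n) = of_nat n"
  by (induction n) (simp_all add: mconst_add)

lemma lift_add: "lift \<kappa> n (p + q) = lift \<kappa> n p + lift \<kappa> n q"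
  by (simp add: lift_def mconst_add distrib_right sum.distrib)

lemma lift_smult: "lift \<kappa> n (smult c q) = mconst c * lift \<kappa> n q"
  by (simp add: lift_def mconst_mult sum_distrib_left mult.assoc)

lemma lift_Suc_pCons_0: "lift \<kappa> (Suc n) (pCons 0 q) = mvar 1 * lift \<kappa> n q"
  unfolding lift_def sum.atMost_Suc_shift by (simp add: sum_distrib_left mult_ac)

lemma lift_Suc: "Polynomial.degree q \<le> n \<Longrightarrow> lift \<kappa> (Suc n) q = xform \<kappa> * lift \<kappa> n q"
  by (auto simp: lift_def coeff_eq_0 sum_distrib_left Suc_diff_le mult_ac intro!: sum.cong)

lemma lform_ldual:
  "lform (ldual \<kappa> u v) = mvar 2 - mconst u * xform \<kappa> - mconst v * mvar 1"
  by (simp add: lform_def ldual_def sum_UNIV_3 xform_def mconst_uminus mconst_diff mconst_mult algebra_simps)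

lemma mdeg_add: "mdeg (a + b) = mdeg a + mdeg b"
  by (simp add: lookup_add sum.distrib)

text \<open>Division by the equation of the line. The forms \<open>xform \<kappa>\<close>,
  \<open>mvar 1\<close> and that equation span all linear forms, and multiplication by each of them
  preserves \<open>P\<close>; so \<open>P\<close> holds for monomials and then for their
  combinations.\<close>

lemma res_decomp:
  assumes "p \<in> hom_part (int n)"
  shows "\<exists>q\<in>hom_part (int n - 1). p = lform (ldual \<kappa> u v) * q + lift \<kappa> n (res \<kappa> u v p)"
proof -
  let ?M = "lform (ldual \<kappa> u v)"
  define P where "P = (\<lambda>n p. p \<in> hom_part (int n) \<and>
    (\<exists>q\<in>hom_part (int n - 1). p = ?M * q + lift \<kappa> n (res \<kappa> u v p)))"
  have mult: "P (Suc n) (w * p)" if "P n p" and w: "w = xform \<kappa> \<or> w = mvar 1 \<or> w = ?M" for n p w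
  proof -
    from that obtain q where p: "p \<in> hom_part (int n)" and q: "q \<in> hom_part (int n - 1)"
      and eq: "p = ?M * q + lift \<kappa> n (res \<kappa> u v p)" unfolding P_def by auto
    have w1: "w \<in> hom_part 1" using w by auto
    have 1: "w * p \<in> hom_part (int (Suc n))" by (rule hom_part_mult'[OF w1 p]) simp
    have 2: "w * p = ?M * (w * q) + w * lift \<kappa> n (res \<kappa> u v p)"
      by (subst eq) (simp add: algebra_simps)
    have 3: "w * q \<in> hom_part (int (Suc n) - 1)" by (rule hom_part_mult'[OF w1 q]) simp
    have "res \<kappa> u v ?M = 0" using res_ldual[of \<kappa> u v 1] by simp
    then have M: "lift \<kappa> (Suc n) (res \<kappa> u v (?M * p)) = 0"
      by (simp add: res_simps lift_def)
    have "lift \<kappa> (Suc n) (res \<kappa> u v (w * p)) = w * lift \<kappa> n (res \<kappa> u v p)" if "w \<noteq> ?M"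
      using w that degree_res[OF p] by (auto simp: res_simps lift_Suc lpt_def lift_Suc_pCons_0)
    then show ?thesis
      using 1 2[symmetric] 3 M p unfolding P_def
      by (cases "w = ?M") (force simp del: of_nat_Suc simp: of_nat_Suc[of n, THEN arg_cong[of _ _ "\<lambda>z. z - 1"]])+
  qed
  have add': "P n (p + q)" if "P n p" "P n q" for n p q
  proof -
    from that obtain p' q' where "p \<in> hom_part (int n)" "q \<in> hom_part (int n)"
      "p' \<in> hom_part (int n - 1)" "q' \<in> hom_part (int n - 1)"
      and eq: "p = ?M * p' + lift \<kappa> n (res \<kappa> u v p)" "q = ?M * q' + lift \<kappa> n (res \<kappa> u v q)"
      unfolding P_def by blast
    moreover have "p + q = ?M * (p' + q') + lift \<kappa> n (res \<kappa> u v (p + q))"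
      by (subst eq(1), subst eq(2)) (simp add: res_simps lift_add algebra_simps)
    ultimately show ?thesis unfolding P_def by blast
  qed
  have scale: "P n (mconst c * p)" if "P n p" for n c p
  proof -
    from that obtain p' where "p \<in> hom_part (int n)" "p' \<in> hom_part (int n - 1)"
      and eq: "p = ?M * p' + lift \<kappa> n (res \<kappa> u v p)"
      unfolding P_def by blast
    moreover have "mconst c * p = ?M * (mconst c * p') + lift \<kappa> n (res \<kappa> u v (mconst c * p))"
      by (subst eq) (simp add: res_simps lift_smult algebra_simps)
    ultimately show ?thesis unfolding P_def by blast
  qed
  have var: "P (Suc n) (mvar i * p)" if "P n p" for n p i
  proof (cases i rule: cases_3)
    case 1
    have "mvar i * p = xform \<kappa> * p + mconst \<kappa> * (mvar 1 * p)"
      by (simp add: 1 xform_def algebra_simps)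
    then show ?thesis using mult scale add' that by metis
  next
    case 3
    have "mvar i * p = ?M * p + (mconst u * (xform \<kappa> * p) + mconst v * (mvar 1 * p))"
      by (simp add: 3 lform_ldual algebra_simps)
    then show ?thesis using mult scale add' that by metis
  qed (use mult that in auto)
  have mon: "P n (Poly_Mapping.single m b)" if "mdeg m = n" for n m b
    using that
  proof (induction n arbitrary: m)
    case 0
    then have "m = 0" using mdeg_eq_0_iff by blast
    moreover have "Poly_Mapping.single 0 b = lift \<kappa> 0 (res \<kappa> u v (Poly_Mapping.single 0 b))"
      by (simp add: lift_def res_simps flip: mconst_def)
    ultimately show ?case unfolding P_def
      by (auto intro!: hom_part_single bexI[of _ 0])
  next
    case (Suc n)
    then have "mdeg m \<noteq> 0" by simp
    then obtain i where i: "Poly_Mapping.lookup m i > 0" by auto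
    let ?e = "Poly_Mapping.single i 1 :: 3 \<Rightarrow>\<^sub>0 nat"
    have m: "m = ?e + (m - ?e)"
      by (rule poly_mapping_eqI) (use i in \<open>auto simp: lookup_add lookup_minus lookup_single when_def\<close>)
    have "mdeg m = mdeg ?e + mdeg (m - ?e)"
      using m mdeg_add by metis
    moreover have "mdeg ?e = 1" by (simp add: lookup_single when_def)
    ultimately have "P n (Poly_Mapping.single (m - ?e) b)" using Suc by simp
    from var[OF this, of i] show ?case
      using m by (simp add: mvar_def mult_single flip: m)
  qed
  have "P n p" using assms
  proof (induction p rule: hom_part_induct)
    case zero
    show ?case unfolding P_def by (auto simp: res_simps lift_def intro!: bexI[of _ 0])
  next
    case (add m b p)
    then have "mdeg m = n" by linarith
    with mon add' add.IH show ?case by blast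
  qed
  then show ?thesis unfolding P_def by blast
qed

lemma lform_scale: "lform (\<lambda>i. c * w i) = mconst c * lform w"
  by (simp add: lform_def mconst_mult sum_distrib_left mult.assoc)

lemma res_eq_0_imp_dvd:
  fixes c :: "'k::field"
  assumes "p \<in> hom_part n" "res \<kappa> u v p = 0" "c \<noteq> 0"
  shows "\<exists>q\<in>hom_part (n - 1). p = lform (\<lambda>i. c * ldual \<kappa> u v i) * q"
proof (cases "n < 0")
  case True
  then have "p = 0" using assms(1) hom_part_neg by blast
  then show ?thesis by (auto intro!: bexI[of _ 0])
next
  case False
  then obtain k where n: "n = int k" by (metis nonneg_int_cases not_less)
  from res_decomp[of p k \<kappa> u v] assms(1,2) n obtain q where
    q: "q \<in> hom_part (n - 1)" "p = lform (ldual \<kappa> u v) * q" by (auto simp: lift_def)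
  have "p = lform (\<lambda>i. c * ldual \<kappa> u v i) * (mconst (inverse c) * q)"
    using assms(3) q(2) by (simp add: lform_scale mult_ac flip: mconst_mult mult.assoc[of "mconst _" "mconst _"])
  then show ?thesis using q by blast
qed

section \<open>Line arrangements\<close>

definition arr :: "nat \<Rightarrow> (nat \<Rightarrow> 3 \<Rightarrow> 'k::comm_ring_1) \<Rightarrow> 'k mpoly3" where
  "arr m l = (\<Prod>i<m. lform (l i))"

lemma arr_hom_part: "arr m l \<in> hom_part (int m)"
  using hom_part_prod1[of "{..<m}" "\<lambda>i. lform (l i)"] by (simp add: arr_def)

lemma pdiff_arr: "pdiff j (arr m l) = (\<Sum>i<m. (\<Prod>k\<in>{..<m} - {i}. lform (l k)) * mconst (l i j))"
  by (simp add: arr_def pdiff_prod pdiff_lform)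

lemma euler_arr: "(\<Sum>j\<in>UNIV. mvar j * pdiff j (arr m l)) = of_nat m * arr m l"
proof -
  have "(\<Sum>j\<in>UNIV. mvar j * pdiff j (arr m l))
      = (\<Sum>i<m. (\<Prod>k\<in>{..<m} - {i}. lform (l k)) * lform (l i))"
    unfolding pdiff_arr lform_def[of "l _"]
    by (subst sum_distrib_left, subst sum.swap) (simp add: sum_distrib_left mult_ac)
  also have "\<dots> = (\<Sum>i<m. arr m l)"
    unfolding arr_def by (rule sum.cong) (simp_all add: prod.remove[of "{..<m}"] mult.commute)
  finally show ?thesis by simp
qed

lemma pdiff_arr_hom_part: "pdiff j (arr m l) \<in> hom_part (int m - 1)"
  by (rule pdiff_hom_part[OF arr_hom_part])

text \<open>The lines of the arrangement meet the parametrised line in distinct points, none of them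
  at infinity.\<close>

locale arr_line =
  fixes d m :: nat and l :: "nat \<Rightarrow> 3 \<Rightarrow> 'k::{alg_closed_field, field_char_0}" and \<kappa> u v :: 'k
  assumes m: "m = 2 * d + 1"
    and slope: "\<And>i. i < m \<Longrightarrow> \<kappa> * l i 0 + l i 1 + v * l i 2 \<noteq> 0"
    and distinct: "\<And>i j. i < m \<Longrightarrow> j < m \<Longrightarrow> i \<noteq> j \<Longrightarrow>
      (l i 0 + u * l i 2) * (\<kappa> * l j 0 + l j 1 + v * l j 2)
        \<noteq> (l j 0 + u * l j 2) * (\<kappa> * l i 0 + l i 1 + v * l i 2)"
begin

abbreviation "\<alpha> i \<equiv> l i 0 + u * l i 2"
abbreviation "\<beta> i \<equiv> \<kappa> * l i 0 + l i 1 + v * l i 2"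
abbreviation "E \<equiv> lpt \<kappa> u v"
definition "g j = res \<kappa> u v (pdiff j (arr m l))"
definition "fL = res \<kappa> u v (arr m l)"
definition "rt i = - \<alpha> i / \<beta> i"

lemma dot_E_g: "dot E g = of_nat m * fL"
proof -
  have "dot E g = res \<kappa> u v (\<Sum>j\<in>UNIV. mvar j * pdiff j (arr m l))"
    by (simp add: dot_def res_simps g_def)
  also have "\<dots> = of_nat m * fL"
    unfolding euler_arr fL_def by (simp only: mconst_of_nat[symmetric] res_simps of_nat_poly)
  finally show ?thesis .
qed

lemma fL_eq: "fL = (\<Prod>i<m. [:\<alpha> i, \<beta> i:])"
  by (simp add: fL_def arr_def res_simps res_lform)

lemma factor_neq_0: "i < m \<Longrightarrow> [:\<alpha> i, \<beta> i:] \<noteq> 0"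
  using slope by simp

lemma fL_neq_0: "fL \<noteq> 0"
  using slope by (simp add: fL_eq)

lemma degree_fL: "Polynomial.degree fL = m"
proof -
  have "Polynomial.degree fL = (\<Sum>i<m. Polynomial.degree [:\<alpha> i, \<beta> i:])"
    unfolding fL_eq by (rule degree_prod_sum_eq) (use factor_neq_0 in auto)
  also have "\<dots> = (\<Sum>i<m. 1)" by (rule sum.cong) (use slope in auto)
  finally show ?thesis by simp
qed

lemma root_inj: "inj_on rt {..<m}"
proof (rule inj_onI)
  fix i j assume "i \<in> {..<m}" "j \<in> {..<m}" "rt i = rt j"
  then have "\<alpha> i * \<beta> j = \<alpha> j * \<beta> i"
    using slope by (simp add: rt_def field_simps)
  then show "i = j" using distinct \<open>i \<in> {..<m}\<close> \<open>j \<in> {..<m}\<close> by blast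
qed

lemma beta_rt: "i < m \<Longrightarrow> \<beta> i * rt i = - \<alpha> i"
  using slope[of i] by (simp add: rt_def)

lemma poly_factor_root: "i < m \<Longrightarrow> poly [:\<alpha> i, \<beta> i:] t = 0 \<longleftrightarrow> t = rt i"
proof -
  assume "i < m"
  then have "poly [:\<alpha> i, \<beta> i:] t = \<beta> i * (t - rt i)"
    unfolding right_diff_distrib using beta_rt by simp
  then show ?thesis using slope[of i] \<open>i < m\<close> by simp
qed

lemma g_eq: "g j = (\<Sum>i<m. (\<Prod>k\<in>{..<m} - {i}. [:\<alpha> k, \<beta> k:]) * [:l i j:])"
  by (simp only: g_def pdiff_arr res_simps res_lform)

lemma poly_g_root:
  assumes "i < m"
  shows "poly (g j) (rt i) = (\<Prod>k\<in>{..<m} - {i}. poly [:\<alpha> k, \<beta> k:] (rt i)) * l i j"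
proof -
  have "poly (g j) (rt i) = (\<Sum>n<m. (\<Prod>k\<in>{..<m} - {n}. poly [:\<alpha> k, \<beta> k:] (rt i)) * l n j)"
    by (simp only: g_eq poly_sum poly_mult poly_prod) simp
  also have "\<dots> = (\<Sum>n\<in>{i}. (\<Prod>k\<in>{..<m} - {n}. poly [:\<alpha> k, \<beta> k:] (rt i)) * l n j)"
  proof (rule sum.mono_neutral_right)
    show "\<forall>n\<in>{..<m} - {i}. (\<Prod>k\<in>{..<m} - {n}. poly [:\<alpha> k, \<beta> k:] (rt i)) * l n j = 0"
    proof
      fix n assume "n \<in> {..<m} - {i}"
      with assms have "i \<in> {..<m} - {n}" by auto
      moreover have "poly [:\<alpha> i, \<beta> i:] (rt i) = 0" using poly_factor_root assms by blast
      ultimately have "(\<Prod>k\<in>{..<m} - {n}. poly [:\<alpha> k, \<beta> k:] (rt i)) = 0"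
        by (intro prod_zero bexI[of _ i]) (simp_all del: poly_pCons)
      then show "(\<Prod>k\<in>{..<m} - {n}. poly [:\<alpha> k, \<beta> k:] (rt i)) * l n j = 0" by simp
    qed
  qed (use assms in auto)
  finally show ?thesis by simp
qed

lemma cofactor_neq_0: "i < m \<Longrightarrow> (\<Prod>k\<in>{..<m} - {i}. poly [:\<alpha> k, \<beta> k:] (rt i)) \<noteq> 0"
  using root_inj poly_factor_root
  by (subst prod_zero_iff) (auto simp: inj_on_def simp del: poly_pCons)

lemma l_neq_0:
  assumes "i < m" shows "\<exists>j. l i j \<noteq> 0"
proof (rule ccontr)
  assume "\<not> ?thesis"
  then show False using slope[OF assms] by simp
qed

lemma fL_root: "poly fL t = 0 \<longleftrightarrow> (\<exists>i<m. t = rt i)"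
  unfolding fL_eq poly_prod using poly_factor_root by (auto simp: prod_zero_iff simp del: poly_pCons)

text \<open>Euler's relation confines a common zero to the roots of \<open>fL\<close>; there, since
  the roots are distinct, the gradient is a nonzero multiple of \<open>l i\<close>.\<close>

lemma g_nowhere_zero: "\<exists>j. poly (g j) t \<noteq> 0"
proof (rule ccontr)
  assume *: "\<not> ?thesis"
  then have "poly (dot E g) t = 0" by (simp add: dot_def poly_sum)
  then have "of_nat m * poly fL t = 0"
    by (simp only: dot_E_g poly_mult of_nat_poly) simp
  moreover have "(of_nat m :: 'k) \<noteq> 0" using m by (simp only: of_nat_eq_0_iff)
  ultimately have "poly fL t = 0" by simp
  then obtain i where i: "i < m" "t = rt i" using fL_root by blast
  with * poly_g_root[of i] cofactor_neq_0[of i] l_neq_0[of i] show False by auto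
qed

lemma degree_g: "Polynomial.degree (g j) \<le> 2 * d"
proof -
  have "int m - 1 = int (2 * d)" using m by simp
  with pdiff_arr_hom_part[of j m l] have "pdiff j (arr m l) \<in> hom_part (int (2 * d))"
    by (simp only:)
  then show ?thesis unfolding g_def by (rule degree_res)
qed

text \<open>The same at infinity: by Euler's relation vanishing top coefficients would lower the
  degree of \<open>fL\<close>, which is \<open>m\<close> because no line of the arrangement passes
  through the point at infinity.\<close>

lemma g_top: "\<exists>j. poly.coeff (g j) (2 * d) \<noteq> 0"
proof (rule ccontr)
  assume *: "\<not> ?thesis"
  have 1: "Polynomial.degree (E j) \<le> 1" for j by (rule degree_lpt_le)
  have "poly.coeff (dot E g) (1 + 2 * d) = 0"
    using * unfolding dot_def coeff_sum
    by (simp only: coeff_mult_top[OF 1 degree_g]) simp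
  moreover have "poly.coeff (dot E g) (1 + 2 * d) = of_nat m * poly.coeff fL m"
    unfolding dot_E_g of_nat_poly using m by simp
  moreover have "poly.coeff fL m \<noteq> 0"
    using degree_fL fL_neq_0 by (metis leading_coeff_0_iff)
  moreover have "(of_nat m :: 'k) \<noteq> 0" using m by (simp only: of_nat_eq_0_iff)
  ultimately show False by simp
qed

section \<open>Syzygies on the line as solutions of an interpolation problem\<close>

definition syz :: "(3 \<Rightarrow> 'k poly) \<Rightarrow> bool" where
  "syz \<theta> \<longleftrightarrow> dot \<theta> g = 0"

lemma syz_root:
  assumes "syz \<theta>" "i < m"
  shows "(\<Sum>j\<in>UNIV. poly (\<theta> j) (rt i) * l i j) = 0"
proof -
  have "0 = poly (dot \<theta> g) (rt i)" using assms by (simp add: syz_def)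
  also have "\<dots> = (\<Prod>k\<in>{..<m} - {i}. poly [:\<alpha> k, \<beta> k:] (rt i)) * (\<Sum>j\<in>UNIV. poly (\<theta> j) (rt i) * l i j)"
    by (simp add: dot_def poly_sum poly_g_root[OF assms(2)] sum_distrib_left sum_distrib_right mult_ac del: poly_pCons)
  finally show ?thesis using cofactor_neq_0[OF assms(2)] by simp
qed

text \<open>A triple \<open>\<theta> = A E\<^sub>0 + B E\<^sub>1 + C e\<close>, where \<open>E = E\<^sub>0 + t E\<^sub>1\<close>, is encoded by
  \<open>w = B - t A\<close> and \<open>C\<close>.\<close>

definition wpart :: "(3 \<Rightarrow> 'k poly) \<Rightarrow> 'k poly" where
  "wpart \<theta> = \<theta> 1 - [:0, 1:] * (\<theta> 0 - [:\<kappa>:] * \<theta> 1)"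

definition cpart :: "(3 \<Rightarrow> 'k poly) \<Rightarrow> 'k poly" where
  "cpart \<theta> = \<theta> 2 - [:u:] * (\<theta> 0 - [:\<kappa>:] * \<theta> 1) - [:v:] * \<theta> 1"

text \<open>The form \<open>l i\<close> takes the values \<open>\<alpha> i\<close>,
  \<open>\<beta> i\<close> and \<open>l i 2\<close> on \<open>E\<^sub>0\<close>,
  \<open>E\<^sub>1\<close> and \<open>e\<close>, and \<open>\<alpha> i\<close> is
  \<open>- \<beta> i * rt i\<close>; so at the root only \<open>B - t A\<close> and \<open>C\<close>
  matter.\<close>

lemma wpart_cpart_root:
  assumes "i < m"
  shows "\<beta> i * poly (wpart \<theta>) (rt i) + l i 2 * poly (cpart \<theta>) (rt i)
    = (\<Sum>j\<in>UNIV. poly (\<theta> j) (rt i) * l i j)"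
proof -
  have "\<beta> i * poly (wpart \<theta>) (rt i) = \<beta> i * poly (\<theta> 1) (rt i)
      - (\<beta> i * rt i) * (poly (\<theta> 0) (rt i) - \<kappa> * poly (\<theta> 1) (rt i))"
    by (simp add: wpart_def algebra_simps)
  then have "\<beta> i * poly (wpart \<theta>) (rt i) = \<beta> i * poly (\<theta> 1) (rt i)
      + \<alpha> i * (poly (\<theta> 0) (rt i) - \<kappa> * poly (\<theta> 1) (rt i))"
    by (simp only: beta_rt[OF assms] mult_minus_left diff_minus_eq_add)
  then show ?thesis
    by (simp add: cpart_def sum_UNIV_3 algebra_simps)
qed

text \<open>A zero pair means that \<open>\<theta>\<close> is a multiple \<open>A * E\<close>. By
  Euler's relation \<open>E\<close> has a nonzero product with \<open>g\<close>, so
  \<open>A = 0\<close>.\<close>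

lemma wpart_cpart_eq_0:
  assumes "syz \<theta>" "wpart \<theta> = 0" "cpart \<theta> = 0"
  shows "\<theta> = 0"
proof -
  define A where "A = \<theta> 0 - [:\<kappa>:] * \<theta> 1"
  have 1: "\<theta> 1 = [:0, 1:] * A" using assms(2) by (simp only: wpart_def A_def eq_iff_diff_eq_0[symmetric])
  then have 0: "\<theta> 0 = A * (1 + [:\<kappa>:] * [:0, 1:])"
  proof -
    have "\<theta> 0 = A + [:\<kappa>:] * \<theta> 1" by (simp add: A_def)
    then show ?thesis unfolding 1 by (simp only: algebra_simps mult_1_right)
  qed
  have 2: "\<theta> 2 = A * ([:u:] + [:v:] * [:0, 1:])"
  proof -
    have "cpart \<theta> = \<theta> 2 - [:u:] * A - [:v:] * \<theta> 1" by (simp only: cpart_def A_def)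
    then show ?thesis unfolding 1 assms(3) by (simp add: algebra_simps)
  qed
  have \<theta>: "\<theta> j = A * E j" for j
    by (cases j rule: cases_3) (simp_all add: 0 1 2 lpt_def distrib_left)
  have "0 = A * dot E g" using assms(1) by (simp add: syz_def dot_def \<theta> sum_distrib_left mult.assoc)
  also have "\<dots> = A * (of_nat m * fL)" by (simp add: dot_E_g)
  finally have "A = 0" using fL_neq_0 m by (auto simp del: of_nat_Suc of_nat_add of_nat_mult)
  then show ?thesis using \<theta> by (auto intro!: ext)
qed

text \<open>Conversely, a pair that satisfies the interpolation conditions comes from a syzygy: correct
  by a multiple of \<open>E\<close>, using Euler's relation.\<close>

lemma syz_of_pair:
  assumes d: "d > 0" and w: "Polynomial.degree w \<le> d" and c: "Polynomial.degree c \<le> d - 1"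
    and nz: "w \<noteq> 0 \<or> c \<noteq> 0"
    and root: "\<And>i. i < m \<Longrightarrow> \<beta> i * poly w (rt i) + l i 2 * poly c (rt i) = 0"
  shows "\<exists>\<theta>. syz \<theta> \<and> \<theta> \<noteq> 0 \<and> (\<forall>j. Polynomial.degree (\<theta> j) \<le> d - 1)"
proof -
  \<comment> \<open>The pair leaves \<open>A\<close> free. This choice cancels the term of degree
    \<open>d\<close> in \<open>B = w + t A\<close>, so that all entries of \<open>\<theta>\<close>
    have degree at most \<open>d - 1\<close>.\<close>
  define A where "A = - monom (poly.coeff w d) (d - 1)"
  define B where "B = w + [:0, 1:] * A"
  have degA: "Polynomial.degree A \<le> d - 1" unfolding A_def by (simp add: degree_monom_le)
  have degB: "Polynomial.degree B \<le> d - 1"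
  proof (rule degree_le, intro allI impI)
    fix n assume n: "d - 1 < n"
    show "poly.coeff B n = 0"
      using n d w by (cases "n = d") (auto simp: B_def A_def coeff_pCons coeff_eq_0 split: nat.split)
  qed
  define \<theta> where "\<theta> = (\<lambda>j::3. if j = 0 then A + [:\<kappa>:] * B else if j = 1 then B else c + [:u:] * A + [:v:] * B)"
  have deg\<theta>: "Polynomial.degree (\<theta> j) \<le> d - 1" for j
    unfolding \<theta>_def using degA degB c
    by (auto intro!: degree_add_le order_trans[OF degree_smult_le])
  have wc: "wpart \<theta> = w" "cpart \<theta> = c"
    by (simp_all add: wpart_def cpart_def \<theta>_def B_def algebra_simps)
  define h where "h i = dot (\<lambda>j. [:l i j:]) \<theta>" for i
  have degh: "Polynomial.degree (h i) \<le> d - 1" for i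
    unfolding h_def dot_def using deg\<theta>
    by (auto intro!: degree_sum_le order_trans[OF degree_smult_le])
  have "[:\<alpha> i, \<beta> i:] dvd h i" if "i < m" for i
  proof -
    have "poly (h i) (rt i) = (\<Sum>j\<in>UNIV. poly (\<theta> j) (rt i) * l i j)"
      by (simp add: h_def dot_def poly_sum mult.commute)
    also have "\<dots> = 0" using wpart_cpart_root[OF that, of \<theta>] root[OF that] wc by simp
    finally have "[:- rt i, 1:] dvd h i" by (simp add: poly_eq_0_iff_dvd)
    moreover have "[:\<alpha> i, \<beta> i:] = smult (\<beta> i) [:- rt i, 1:]"
      using slope[OF that] by (simp add: rt_def)
    ultimately show ?thesis using slope[OF that] by (simp only: smult_dvd_iff if_False)
  qed
  then obtain H where H: "\<And>i. i < m \<Longrightarrow> h i = [:\<alpha> i, \<beta> i:] * H i"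
    unfolding dvd_def by metis
  have degH: "Polynomial.degree (H i) + 1 \<le> d - 1 \<or> H i = 0" if "i < m" for i
  proof (cases "H i = 0")
    case False
    then have "Polynomial.degree (h i) = 1 + Polynomial.degree (H i)"
      using slope[OF that] unfolding H[OF that] by (subst degree_mult_eq) auto
    with degh[of i] show ?thesis by simp
  qed simp
  \<comment> \<open>The product of \<open>\<theta>\<close> and \<open>g\<close> is \<open>fL\<close>
    times the sum of the quotients \<open>H i\<close>, and that of \<open>E\<close> and
    \<open>g\<close> is \<open>m\<close> times \<open>fL\<close>; subtracting \<open>S * E\<close>
    therefore makes the product zero.\<close>
  define S where "S = smult (inverse (of_nat m)) (\<Sum>i<m. H i)"
  have degS: "Polynomial.degree (S * E j) \<le> d - 1" for j
  proof (cases "d - 1 = 0")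
    case True
    \<comment> \<open>For \<open>d = 1\<close> the bound \<open>d - 2\<close> would be truncated;
      but then \<open>h i\<close> has degree 0 and the quotients vanish.\<close>
    then have "H i = 0" if "i < m" for i using degH[OF that] by auto
    then show ?thesis by (simp add: S_def)
  next
    case False
    have "Polynomial.degree (H i) \<le> d - 2" if "i < m" for i using degH[OF that] by auto
    then have "Polynomial.degree S \<le> d - 2"
      unfolding S_def by (intro order_trans[OF degree_smult_le] degree_sum_le) auto
    from degree_mult_le_add[OF this degree_lpt_le, of \<kappa> u v j] False show ?thesis by simp
  qed
  define \<theta>' where "\<theta>' = (\<lambda>j. \<theta> j - S * E j)"
  have "dot \<theta> g = (\<Sum>i<m. (\<Prod>k\<in>{..<m} - {i}. [:\<alpha> k, \<beta> k:]) * h i)"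
    unfolding dot_def g_eq h_def
    by (subst sum_distrib_left, subst sum.swap) (simp only: sum_distrib_left mult_ac)
  also have "\<dots> = (\<Sum>i<m. fL * H i)"
  proof (rule sum.cong)
    fix i assume "i \<in> {..<m}"
    then show "(\<Prod>k\<in>{..<m} - {i}. [:\<alpha> k, \<beta> k:]) * h i = fL * H i"
      unfolding fL_eq by (subst prod.remove[of "{..<m}" i]) (simp_all only: finite_lessThan H lessThan_iff mult_ac)
  qed simp
  finally have 1: "dot \<theta> g = fL * (\<Sum>i<m. H i)" by (simp add: sum_distrib_left)
  have "dot (\<lambda>j. S * E j) g = S * dot E g"
    by (simp add: dot_def sum_distrib_left mult.assoc)
  also have "\<dots> = smult (inverse (of_nat m) * of_nat m) (fL * (\<Sum>i<m. H i))"
    by (simp only: dot_E_g S_def of_nat_poly) (simp add: mult_ac)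
  also have "inverse (of_nat m) * of_nat m = (1 :: 'k)"
    by (rule left_inverse) (use m in \<open>simp only: of_nat_eq_0_iff\<close>)
  finally have 2: "dot (\<lambda>j. S * E j) g = fL * (\<Sum>i<m. H i)" by simp
  have "syz \<theta>'"
    using 1 2 by (simp add: syz_def \<theta>'_def dot_def left_diff_distrib sum_subtractf)
  moreover have "\<theta>' \<noteq> 0"
  proof
    assume "\<theta>' = 0"
    then have "\<theta> j = S * E j" for j by (simp add: \<theta>'_def fun_eq_iff)
    then have "wpart \<theta> = 0" "cpart \<theta> = 0"
      by (simp_all add: wpart_def cpart_def lpt_def algebra_simps)
    with wc nz show False by simp
  qed
  moreover have "Polynomial.degree (\<theta>' j) \<le> d - 1" for j
    unfolding \<theta>'_def using deg\<theta> degS by (intro degree_diff_le)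
  ultimately show ?thesis by blast
qed

end

section \<open>Powers of linear forms\<close>

definition dirdiff :: "(3 \<Rightarrow> 'k) \<Rightarrow> 'k::comm_ring_1 mpoly3 \<Rightarrow> 'k mpoly3" where
  "dirdiff w p = (\<Sum>j\<in>UNIV. mconst (w j) * pdiff j p)"

lemma dirdiff_sum: "dirdiff w (sum f A) = (\<Sum>i\<in>A. dirdiff w (f i))"
  unfolding dirdiff_def pdiff_sum sum_distrib_left by (rule sum.swap)

lemma dirdiff_mconst_mult: "dirdiff w (mconst c * p) = mconst c * dirdiff w p"
  by (simp only: dirdiff_def pdiff_mconst_mult sum_distrib_left mult.left_commute)

lemma mconst_sum: "mconst (sum f A) = (\<Sum>i\<in>A. mconst (f i))"
  by (induction A rule: infinite_finite_induct) (auto simp: mconst_add)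

lemma mconst_eq_0_iff: "mconst c = 0 \<longleftrightarrow> c = 0"
proof
  assume "mconst c = 0"
  then have "mcoeff (mconst c) 0 = 0" by simp
  then show "c = 0" by (simp add: mconst_def)
qed simp

lemma dirdiff_lform_power:
  "dirdiff w (lform a ^ Suc n) = mconst (of_nat (Suc n) * dot w a) * lform a ^ n"
proof -
  have "dirdiff w (lform a ^ Suc n) = (\<Sum>j\<in>UNIV. mconst (of_nat (Suc n)) * mconst (w j * a j) * lform a ^ n)"
    unfolding dirdiff_def pdiff_power pdiff_lform
    by (rule sum.cong) (simp_all only: mconst_mult mconst_of_nat diff_Suc_1 mult_ac)
  also have "\<dots> = mconst (of_nat (Suc n) * dot w a) * lform a ^ n"
    by (simp only: dot_def sum_distrib_left[symmetric] sum_distrib_right[symmetric] mconst_sum[symmetric] mconst_mult[symmetric])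
  finally show ?thesis .
qed

text \<open>Apolarity: n directional derivatives pair with the n-th power of a linear form as n!
  times the product of its values on the directions. A relation between powers thus becomes a
  relation between such products.\<close>

lemma dirdiff_iterate_power:
  "foldr dirdiff ws (\<Sum>i\<in>A. mconst (y i) * lform (a i) ^ length ws)
    = mconst (\<Sum>i\<in>A. y i * (fact (length ws) * (\<Prod>w\<leftarrow>ws. dot w (a i))))"
proof (induction ws arbitrary: y rule: rev_induct)
  case Nil
  show ?case by (simp add: mconst_sum)
next
  case (snoc w ws)
  have "dirdiff w (\<Sum>i\<in>A. mconst (y i) * lform (a i) ^ length (ws @ [w]))
      = (\<Sum>i\<in>A. mconst (y i * (of_nat (Suc (length ws)) * dot w (a i))) * lform (a i) ^ length ws)"
    by (simp only: dirdiff_sum dirdiff_mconst_mult length_append_singleton dirdiff_lform_power mconst_mult[of "y _"] mult.assoc)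
  then have "foldr dirdiff (ws @ [w]) (\<Sum>i\<in>A. mconst (y i) * lform (a i) ^ length (ws @ [w]))
      = mconst (\<Sum>i\<in>A. (y i * (of_nat (Suc (length ws)) * dot w (a i))) * (fact (length ws) * (\<Prod>w\<leftarrow>ws. dot w (a i))))"
    by (simp only: foldr_append foldr.simps comp_apply id_apply snoc.IH)
  also have "\<dots> = mconst (\<Sum>i\<in>A. y i * (fact (length (ws @ [w])) * (\<Prod>w\<leftarrow>ws @ [w]. dot w (a i))))"
    by (intro arg_cong[of _ _ mconst] sum.cong) (simp_all add: mult_ac)
  finally show ?case .
qed

lemma dot_cross_rotate: "dot a (cross b c) = dot c (cross a b)"
  by (simp add: vec3_defs algebra_simps)

lemma cross_self: "cross a a = 0"
  by (rule ext) (simp add: cross_def)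

lemma det3_self: "det3 a b b = 0"
  by (simp add: vec3_defs)

text \<open>If at most \<open>d + 1\<close> of the \<open>2 d + 1\<close> points are on a line, then the points other than a given
  one can be grouped into pairs spanning lines that avoid the given point. To find the pairs, sort
  the points by the line joining them to the given point and match positions \<open>i\<close> and \<open>i + d\<close>.\<close>

lemma linear_independent_powers:
  fixes l :: "nat \<Rightarrow> 3 \<Rightarrow> 'k::field_char_0"
  assumes nz: "\<And>i. i < 2 * d + 1 \<Longrightarrow> l i \<noteq> 0"
    and cross: "\<And>i j. i < 2 * d + 1 \<Longrightarrow> j < 2 * d + 1 \<Longrightarrow> i \<noteq> j \<Longrightarrow> cross (l i) (l j) \<noteq> 0"
    and aligned: "\<And>S. S \<subseteq> l ` {..<2 * d + 1} \<Longrightarrow> aligned S \<Longrightarrow> card S \<le> d + 1"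
    and sum0: "(\<Sum>i<2 * d + 1. mconst (y i) * lform (l i) ^ d) = 0"
    and i0: "i0 < 2 * d + 1"
  shows "y i0 = 0"
proof -
  define A where "A = {..<2 * d + 1} - {i0}"
  have finA: "finite A" and cardA: "card A = 2 * d" using i0 by (auto simp: A_def)
  \<comment> \<open>The points on the line through \<open>l i0\<close> and \<open>l j\<close>; the
    least index among them, \<open>key\<close>, labels that line.\<close>
  define P where "P j = {k \<in> A. det3 (l i0) (l j) (l k) = 0}" for j
  define key where "key j = Min (P j)" for j
  have finP: "finite (P j)" for j using finA by (simp add: P_def)
  have self: "j \<in> P j" if "j \<in> A" for j using that by (simp add: P_def det3_self)
  have key: "key j \<in> P j" if "j \<in> A" for j
    unfolding key_def using self[OF that] finP by (intro Min_in) auto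
  have inj: "inj_on l {..<2 * d + 1}"
  proof (rule inj_onI, rule ccontr)
    fix i j assume "i \<in> {..<2 * d + 1}" "j \<in> {..<2 * d + 1}" "l i = l j" "i \<noteq> j"
    with cross[of i j] show False by (auto simp: cross_self)
  qed
  have cross': "cross (l i0) (l k) \<noteq> 0" if "k \<in> A" for k
    using that cross i0 by (auto simp: A_def)
  \<comment> \<open>The points of one class lie with \<open>l i0\<close> on a common line, so the
    hypothesis on aligned points leaves at most d of them besides \<open>l i0\<close>.\<close>
  have cls: "card {j \<in> A. key j = k} \<le> d" for k
  proof (cases "{j \<in> A. key j = k} = {}")
    case False
    then have k: "k \<in> A" using key P_def by blast
    let ?S = "l ` insert i0 {j \<in> A. key j = k}"
    have "dot (cross (l i0) (l k)) (l j) = 0" if "j \<in> A" "key j = k" for j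
    proof -
      have "det3 (l i0) (l j) (l k) = 0" using key[OF that(1)] that by (auto simp: P_def)
      then show ?thesis
        by (simp add: det3_def) (simp add: vec3_defs algebra_simps)
    qed
    then have "aligned ?S"
      unfolding aligned_def using cross'[OF k]
      by (intro exI[of _ "cross (l i0) (l k)"]) (auto simp flip: dot_def)
    moreover have "?S \<subseteq> l ` {..<2 * d + 1}" using i0 by (auto simp: A_def)
    ultimately have "card ?S \<le> d + 1" using aligned by blast
    moreover have "card ?S = card (insert i0 {j \<in> A. key j = k})"
      by (rule card_image) (use inj i0 in \<open>auto simp: A_def inj_on_def\<close>)
    moreover have "i0 \<notin> A" by (simp add: A_def)
    ultimately show ?thesis using finA by simp
  next
    case True
    then show ?thesis by (metis card.empty zero_le)
  qed
  have same: "key j = key j'" if j: "j \<in> A" "j' \<in> A" and 0: "det3 (l i0) (l j) (l j') = 0" for j j'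
  proof -
    let ?a = "cross (l i0) (l j)" and ?b = "cross (l i0) (l j')"
    have "cross ?a ?b = (\<lambda>i. l i0 i * det3 (l i0) (l j) (l j'))"
    proof
      fix i show "cross ?a ?b i = l i0 i * det3 (l i0) (l j) (l j')"
        by (cases i rule: cases_3) (simp_all add: vec3_defs algebra_simps)
    qed
    then have "cross ?a ?b = 0" using 0 by (simp add: fun_eq_iff)
    then obtain c where c: "?a = (\<lambda>i. c * ?b i)" using cross_eq_0_imp_scalar cross'[OF j(2)] by blast
    then have "c \<noteq> 0" using cross'[OF j(1)] by (auto simp: fun_eq_iff)
    have "det3 (l i0) (l j) (l k) = c * det3 (l i0) (l j') (l k)" for k
      unfolding det3_def dot_cross_rotate[of "l i0"] c by (simp add: dot_def sum_distrib_left mult_ac)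
    then have "P j = P j'" using \<open>c \<noteq> 0\<close> by (simp add: P_def)
    then show ?thesis by (simp add: key_def)
  qed
  define xs where "xs = sort_key key (sorted_list_of_set A)"
  have xs: "set xs = A" "distinct xs" "length xs = 2 * d" "sorted (map key xs)"
    using finA cardA by (simp_all add: xs_def)
  have nth_A: "xs ! i \<in> A" if "i < 2 * d" for i using that xs nth_mem by metis
  \<comment> \<open>Normals of the lines spanned by the d pairs: differentiating along all of them
    kills the powers that belong to points other than \<open>l i0\<close>.\<close>
  define ws where "ws = map (\<lambda>i. cross (l (xs ! i)) (l (xs ! (i + d)))) [0..<d]"
  have len: "length ws = d" by (simp add: ws_def)
  have keys: "key (xs ! i) \<noteq> key (xs ! (i + d))" if "i < d" for i
  proof
    assume eq: "key (xs ! i) = key (xs ! (i + d))"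
    \<comment> \<open>Sortedness gives the same key to all d + 1 positions from \<open>i\<close> to
      \<open>i + d\<close>, one more than a class can hold.\<close>
    have eqn: "key (xs ! n) = key (xs ! i)" if n: "n \<in> {i..i + d}" for n
    proof (rule antisym)
      show "key (xs ! n) \<le> key (xs ! i)"
        unfolding eq using sorted_nth_mono[OF xs(4), of n "i + d"] n \<open>i < d\<close> xs(3) by simp
      show "key (xs ! i) \<le> key (xs ! n)"
        using sorted_nth_mono[OF xs(4), of i n] n \<open>i < d\<close> xs(3) by simp
    qed
    have "(\<lambda>n. xs ! n) ` {i..i + d} \<subseteq> {j \<in> A. key j = key (xs ! i)}"
    proof (rule image_subsetI)
      fix n assume n: "n \<in> {i..i + d}"
      from eqn[OF n] nth_A[of n] n \<open>i < d\<close>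
      show "xs ! n \<in> {j \<in> A. key j = key (xs ! i)}" by simp
    qed
    then have "card ((\<lambda>n. xs ! n) ` {i..i + d}) \<le> card {j \<in> A. key j = key (xs ! i)}"
      using finA by (intro card_mono) auto
    with cls have "card ((\<lambda>n. xs ! n) ` {i..i + d}) \<le> d" by (rule order_trans[rotated])
    moreover have "card ((\<lambda>n. xs ! n) ` {i..i + d}) = card {i..i + d}"
      by (rule card_image) (use xs \<open>i < d\<close> in \<open>auto simp: inj_on_def nth_eq_iff_index_eq\<close>)
    ultimately show False by simp
  qed
  have zero: "(\<Prod>w\<leftarrow>ws. dot w (l i)) = 0" if "i < 2 * d + 1" "i \<noteq> i0" for i
  proof -
    have "i \<in> set xs" using that xs by (simp add: A_def)
    then obtain n where n: "n < 2 * d" "xs ! n = i" using xs(3) by (auto simp: in_set_conv_nth)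
    obtain k where k: "k < d" "n = k \<or> n = k + d"
    proof (cases "n < d")
      case False
      with n that[of "n - d"] show ?thesis by simp
    qed (use that in auto)
    then have "cross (l (xs ! k)) (l (xs ! (k + d))) \<in> set ws" by (auto simp: ws_def)
    moreover have "dot (cross (l (xs ! k)) (l (xs ! (k + d)))) (l i) = 0"
      using k n by auto
    ultimately have "0 \<in> set (map (\<lambda>w. dot w (l i)) ws)" by force
    then show ?thesis by (simp add: prod_list_zero_iff)
  qed
  have nonzero: "(\<Prod>w\<leftarrow>ws. dot w (l i0)) \<noteq> 0"
  proof
    assume "(\<Prod>w\<leftarrow>ws. dot w (l i0)) = 0"
    then obtain k where k: "k < d" "dot (cross (l (xs ! k)) (l (xs ! (k + d)))) (l i0) = 0"
      by (auto simp: prod_list_zero_iff ws_def)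
    then have "det3 (l i0) (l (xs ! k)) (l (xs ! (k + d))) = 0"
      by (simp add: det3_def dot_commute)
    then show False using same keys[of k] nth_A k by simp
  qed
  have "mconst (\<Sum>i<2 * d + 1. y i * (fact d * (\<Prod>w\<leftarrow>ws. dot w (l i)))) = foldr dirdiff ws 0"
    using dirdiff_iterate_power[of ws y l "{..<2 * d + 1}"] sum0 len by simp
  also have "foldr dirdiff ws 0 = (0 :: 'k mpoly3)"
    by (induction ws) (simp_all add: dirdiff_def)
  finally have "(\<Sum>i<2 * d + 1. y i * (fact d * (\<Prod>w\<leftarrow>ws. dot w (l i)))) = 0"
    by (simp only: mconst_eq_0_iff)
  moreover have "(\<Sum>i<2 * d + 1. y i * (fact d * (\<Prod>w\<leftarrow>ws. dot w (l i))))
      = (\<Sum>i\<in>{i0}. y i * (fact d * (\<Prod>w\<leftarrow>ws. dot w (l i))))"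
    by (rule sum.mono_neutral_right) (use zero i0 in auto)
  ultimately show ?thesis using nonzero by simp
qed

section \<open>The ideal of powers\<close>

lemma ideal_module: "Modules.module ((*) :: 'a::comm_ring_1 \<Rightarrow> 'a \<Rightarrow> 'a)"
  by unfold_locales (simp_all add: algebra_simps)

lemma ideal_gen_image_elim:
  fixes f :: "nat \<Rightarrow> 'a::comm_ring_1"
  assumes "p \<in> ideal_gen (f ` {..<m})"
  shows "\<exists>r. p = (\<Sum>i<m. r i * f i)"
proof -
  let ?T = "{p. \<exists>r. p = (\<Sum>i<m. r i * f i)}"
  have "ideal_gen (f ` {..<m}) \<subseteq> ?T"
  proof (rule Modules.module.span_minimal[OF ideal_module])
    show "f ` {..<m} \<subseteq> ?T"
    proof
      fix p assume "p \<in> f ` {..<m}"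
      then obtain k where "k < m" "p = f k" by auto
      then have "p = (\<Sum>i<m. (if i = k then 1 else 0) * f i)"
        by (simp add: if_distrib[of "\<lambda>u. u * _"] cong: if_cong)
      then show "p \<in> ?T" by (intro CollectI exI)
    qed
    show "Modules.module.subspace (*) ?T"
    proof (rule Modules.module.subspaceI[OF ideal_module])
      show "0 \<in> ?T" by (intro CollectI exI[of _ "\<lambda>_. 0"]) simp
    next
      fix x y assume "x \<in> ?T" "y \<in> ?T"
      then obtain r s where "x = (\<Sum>i<m. r i * f i)" "y = (\<Sum>i<m. s i * f i)" by auto
      then have "x + y = (\<Sum>i<m. (r i + s i) * f i)" by (simp add: distrib_right sum.distrib)
      then show "x + y \<in> ?T" by (intro CollectI exI)
    next
      fix c x assume "x \<in> ?T"
      then obtain r where "x = (\<Sum>i<m. r i * f i)" by auto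
      then have "c * x = (\<Sum>i<m. (c * r i) * f i)" by (simp add: sum_distrib_left mult.assoc)
      then show "c * x \<in> ?T" by (intro CollectI exI)
    qed
  qed
  with assms show ?thesis by blast
qed

lemma quot_coset_eq_iff:
  fixes I :: "'a::comm_ring_1 set"
  assumes "is_ideal I"
  shows "p +o I = q +o I \<longleftrightarrow> p - q \<in> I"
proof -
  note sub = Modules.module.subspace_0[OF ideal_module assms] Modules.module.subspace_add[OF ideal_module assms]
    Modules.module.subspace_diff[OF ideal_module assms]
  show ?thesis
  proof
    assume "p +o I = q +o I"
    moreover have "p \<in> p +o I" using sub(1) by (force simp: elt_set_plus_def)
    ultimately show "p - q \<in> I" by (auto simp: elt_set_plus_def)
  next
    assume pq: "p - q \<in> I"
    have "p +o I \<subseteq> q +o I" if "p - q \<in> I" for p q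
    proof
      fix x assume "x \<in> p +o I"
      then obtain b where "b \<in> I" "x = p + b" by (auto simp: elt_set_plus_def)
      then have "x = q + ((p - q) + b)" "(p - q) + b \<in> I" using that sub(2) by auto
      then show "x \<in> q +o I" unfolding elt_set_plus_def by blast
    qed
    moreover have "q - p \<in> I" using sub(3)[OF sub(1) pq] by simp
    ultimately show "p +o I = q +o I" using pq by blast
  qed
qed

lemma quot_mult_coset:
  fixes I :: "'k::comm_ring_1 mpoly3 set"
  assumes "is_ideal I"
  shows "quot_mult I r (p +o I) = (r * p) +o I"
proof -
  note sub = Modules.module.subspace_0[OF ideal_module assms] Modules.module.subspace_add[OF ideal_module assms]
    Modules.module.subspace_scale[OF ideal_module assms]
  show ?thesis
  proof
    show "quot_mult I r (p +o I) \<subseteq> (r * p) +o I"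
      unfolding quot_mult_def
      by (auto simp: elt_set_plus_def elt_set_times_def set_plus_def distrib_left add.assoc intro!: sub)
    show "(r * p) +o I \<subseteq> quot_mult I r (p +o I)"
    proof
      fix x assume "x \<in> (r * p) +o I"
      then obtain b where "b \<in> I" "x = r * p + b" by (auto simp: elt_set_plus_def)
      moreover have "r * p \<in> r *o (p +o I)"
        using sub(1) by (force simp: elt_set_plus_def elt_set_times_def)
      ultimately show "x \<in> quot_mult I r (p +o I)"
        unfolding quot_mult_def by (auto simp: set_plus_def)
    qed
  qed
qed

section \<open>Multiplication by the square of the equation of the line\<close>

context arr_line
begin

definition "J = ideal_gen ((\<lambda>i. lform (l i) ^ d) ` {..<m})"

lemma ideal_J: "is_ideal J"
  unfolding J_def by (rule Modules.module.subspace_span[OF ideal_module])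

lemma power_in_J: "i < m \<Longrightarrow> lform (l i) ^ d \<in> J"
  unfolding J_def by (intro Modules.module.span_base[OF ideal_module]) auto

text \<open>The generators have degree \<open>d\<close>, so in the component of degree
  \<open>n\<close> only the constant terms of their coefficients survive, and nothing if
  \<open>n < d\<close>.\<close>

lemma J_hom_part:
  assumes "p \<in> J" "p \<in> hom_part (int n)" "n \<le> d"
  shows "\<exists>y. p = (\<Sum>i<m. mconst (y i) * lform (l i) ^ d) \<and> (n < d \<longrightarrow> p = 0)"
proof -
  obtain r where r: "p = (\<Sum>i<m. r i * lform (l i) ^ d)"
    using ideal_gen_image_elim assms(1) unfolding J_def by blast
  have pow: "lform (l i) ^ d \<in> hom_part (int d)" for i by (intro hom_part_power1) auto
  have "p = hcomp n p" using hcomp_hom_part[OF assms(2)] by simp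
  also have "\<dots> = (\<Sum>i<m. if n = d then mconst (mcoeff (r i) 0) * lform (l i) ^ d else 0)"
    by (subst r) (simp only: hcomp_sum hcomp_mult[OF pow assms(3)])
  finally have p: "p = (\<Sum>i<m. if n = d then mconst (mcoeff (r i) 0) * lform (l i) ^ d else 0)" .
  show ?thesis
  proof (cases "n = d")
    case True
    then show ?thesis using p by (intro exI[of _ "\<lambda>i. mcoeff (r i) 0"]) simp
  next
    case False
    then have "p = 0" using p by simp
    then show ?thesis by (intro exI[of _ "\<lambda>_. 0"]) simp
  qed
qed

text \<open>The coordinates of \<open>p\<close> modulo the square of the linear form that defines the line: the
  coefficients of \<open>p\<close> and of its derivative \<open>\<partial>p/\<partial>z\<close> on the line.\<close>

definition jet :: "'k mpoly3 \<Rightarrow> nat \<Rightarrow> 'k" where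
  "jet p n = (if n \<le> d then poly.coeff (res \<kappa> u v p) n
     else poly.coeff (res \<kappa> u v (pdiff 2 p)) (n - Suc d))"

lemma jet_add: "jet (p + q) n = jet p n + jet q n"
  by (simp add: jet_def res_simps pdiff_add)

lemma jet_mconst_mult: "jet (mconst c * p) n = c * jet p n"
  by (simp add: jet_def res_simps pdiff_mconst_mult)

lemma jet_zero [simp]: "jet 0 n = 0"
  by (simp add: jet_def res_simps)

lemma jet_sum: "jet (sum f A) n = (\<Sum>i\<in>A. jet (f i) n)"
  by (induction A rule: infinite_finite_induct) (auto simp: jet_add)

lemma jet_diff: "jet (p - q) n = jet p n - jet q n"
  by (simp add: jet_def res_simps pdiff_diff)

abbreviation "L c \<equiv> lform (\<lambda>i. c * ldual \<kappa> u v i)"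

lemma jet_L_square: "jet (L c ^ 2 * q) n = 0"
  by (simp add: jet_def res_simps pdiff_mult res_ldual power2_eq_square)

lemma pdiff_L: "pdiff 2 (L c) = mconst c"
  by (simp add: pdiff_lform ldual_def)

text \<open>If \<open>p = L c * q\<close>, then on the line the derivative of \<open>p\<close> in z
  is \<open>c\<close> times \<open>q\<close>; its vanishing there gives the second factor.\<close>

lemma jet_eq_0_imp:
  assumes "p \<in> hom_part (int d)" "c \<noteq> 0" "\<And>n. n < m \<Longrightarrow> jet p n = 0"
  shows "\<exists>q\<in>hom_part (int d - 2). p = L c ^ 2 * q"
proof -
  have "poly.coeff (res \<kappa> u v p) n = 0" for n
  proof (cases "n \<le> d")
    case True
    then show ?thesis using assms(3)[of n] m by (simp add: jet_def)
  next
    case False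
    then show ?thesis using degree_res[OF assms(1), of \<kappa> u v] by (simp add: coeff_eq_0)
  qed
  then have "res \<kappa> u v p = 0" by (simp add: poly_eq_iff)
  from res_eq_0_imp_dvd[OF assms(1) this assms(2)]
  obtain q where q: "q \<in> hom_part (int d - 1)" "p = L c * q" by auto
  have "res \<kappa> u v (pdiff 2 p) = [:c:] * res \<kappa> u v q"
    using q by (simp add: pdiff_mult res_simps res_ldual pdiff_L)
  moreover have "res \<kappa> u v (pdiff 2 p) = 0"
  proof (cases "d = 0")
    case True
    then have "pdiff 2 p = 0" using pdiff_hom_part[OF assms(1)] hom_part_neg by fastforce
    then show ?thesis by (simp add: res_simps)
  next
    case False
    then have "pdiff 2 p \<in> hom_part (int (d - 1))"
      using pdiff_hom_part[OF assms(1), of 2] by (simp add: of_nat_diff)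
    from degree_res[OF this, of \<kappa> u v] have deg: "Polynomial.degree (res \<kappa> u v (pdiff 2 p)) \<le> d - 1" .
    have "poly.coeff (res \<kappa> u v (pdiff 2 p)) n = 0" for n
    proof (cases "n < d")
      case True
      then show ?thesis using assms(3)[of "n + Suc d"] m by (simp add: jet_def)
    next
      case False
      then show ?thesis using deg \<open>d \<noteq> 0\<close> by (intro coeff_eq_0) linarith
    qed
    then show ?thesis by (simp add: poly_eq_iff)
  qed
  ultimately have "res \<kappa> u v q = 0" using assms(2) by simp
  from res_eq_0_imp_dvd[OF q(1) this assms(2)]
  obtain q' where "q' \<in> hom_part (int d - 2)" "q = L c * q'" by auto
  then show ?thesis using q by (intro bexI[of _ q']) (simp_all add: power2_eq_square mult.assoc)
qed

text \<open>A functional \<open>x\<close> on jets corresponds to a pair of polynomials \<open>w\<close>, \<open>c\<close> of degrees at most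
  \<open>d\<close> and \<open>d - 1\<close>, in such a way that its value at the jet of \<open>l\<^sub>i\<^sup>d\<close> is the interpolation condition
  at the \<open>i\<close>-th point.\<close>

definition wof :: "(nat \<Rightarrow> 'k) \<Rightarrow> 'k poly" where
  "wof x = (\<Sum>n\<le>d. monom (x n * of_nat (d choose n) * (- 1) ^ (d - n)) (d - n))"

definition cof :: "(nat \<Rightarrow> 'k) \<Rightarrow> 'k poly" where
  "cof x = (\<Sum>n\<le>d - 1. monom (of_nat d * x (Suc d + n) * of_nat ((d - 1) choose n) * (- 1) ^ (d - 1 - n)) (d - 1 - n))"

lemma degree_wof: "Polynomial.degree (wof x) \<le> d"
  and degree_cof: "Polynomial.degree (cof x) \<le> d - 1"
  unfolding wof_def cof_def
  by (auto intro!: degree_sum_le order_trans[OF degree_monom_le])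

lemma sum_monom_reverse: "poly.coeff (\<Sum>n\<le>k. monom (a n) (k - n)) (k - n) = a n" if "n \<le> k" for a :: "nat \<Rightarrow> 'k"
proof -
  have "poly.coeff (\<Sum>n\<le>k. monom (a n) (k - n)) (k - n) = (\<Sum>j\<le>k. if j = n then a j else 0)"
    unfolding coeff_sum by (rule sum.cong) (use that in auto)
  then show ?thesis using that by (simp add: sum.delta)
qed

lemma coeff_wof: "n \<le> d \<Longrightarrow> poly.coeff (wof x) (d - n) = x n * of_nat (d choose n) * (- 1) ^ (d - n)"
  unfolding wof_def by (rule sum_monom_reverse)

lemma coeff_cof: "n \<le> d - 1 \<Longrightarrow> poly.coeff (cof x) (d - 1 - n)
    = of_nat d * x (Suc d + n) * of_nat ((d - 1) choose n) * (- 1) ^ (d - 1 - n)"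
  unfolding cof_def by (rule sum_monom_reverse)

lemma split_sum_m: "d > 0 \<Longrightarrow> (\<Sum>n<m. f n) = (\<Sum>n\<le>d. f n) + (\<Sum>n\<le>d - 1. f (Suc d + n))"
  for f :: "nat \<Rightarrow> 'k"
proof -
  assume "d > 0"
  have split: "(\<Sum>n<a + b. f n) = (\<Sum>n<a. f n) + (\<Sum>n<b. f (a + n))" for a b
    by (induction b) (simp_all add: add.assoc)
  have "(\<Sum>n<m. f n) = (\<Sum>n<Suc d + d. f n)" by (simp add: m mult_2)
  also have "\<dots> = (\<Sum>n<Suc d. f n) + (\<Sum>n<d. f (Suc d + n))" by (rule split)
  finally show ?thesis
    using \<open>d > 0\<close> by (simp only: lessThan_Suc_atMost) (metis Suc_pred' lessThan_Suc_atMost)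
qed

text \<open>The binomial theorem, with \<open>\<alpha> i\<close> replaced by
  \<open>- \<beta> i * rt i\<close>. The signs and binomial coefficients are those built into
  \<open>wof\<close> and \<open>cof\<close>; the powers of \<open>\<beta> i\<close> combine to a
  common nonzero factor.\<close>

lemma functional_jet_power:
  assumes "d > 0" "i < m"
  shows "(\<Sum>n<m. x n * jet (lform (l i) ^ d) n)
    = \<beta> i ^ (d - 1) * (\<beta> i * poly (wof x) (rt i) + l i 2 * poly (cof x) (rt i))"
proof -
  let ?a = "- (\<beta> i * rt i)" and ?b = "\<beta> i"
  have a: "\<alpha> i = ?a" using beta_rt[OF assms(2)] by simp
  have 1: "jet (lform (l i) ^ d) n = of_nat (d choose n) * ?b ^ n * ?a ^ (d - n)" if "n \<le> d" for n
    using that by (simp only: jet_def res_simps res_lform a coeff_linear_poly_power if_True)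
  have 2: "jet (lform (l i) ^ d) (Suc d + n) = of_nat d * l i 2 * (of_nat ((d - 1) choose n) * ?b ^ n * ?a ^ (d - 1 - n))"
    if "n \<le> d - 1" for n
  proof -
    have "res \<kappa> u v (pdiff 2 (lform (l i) ^ d)) = [:of_nat d * l i 2:] * [:\<alpha> i, \<beta> i:] ^ (d - 1)"
      unfolding pdiff_power pdiff_lform mconst_of_nat[symmetric]
      by (simp only: res_simps res_lform) (simp add: mult_ac)
    then have "jet (lform (l i) ^ d) (Suc d + n) = of_nat d * l i 2 * poly.coeff ([:\<alpha> i, \<beta> i:] ^ (d - 1)) n"
      by (simp add: jet_def)
    then show ?thesis using that by (simp only: a coeff_linear_poly_power)
  qed
  have p1: "x n * (of_nat (d choose n) * ?b ^ n * ?a ^ (d - n))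
      = ?b ^ d * (x n * of_nat (d choose n) * (- 1) ^ (d - n) * rt i ^ (d - n))" if "n \<le> d" for n
  proof -
    have "?a ^ (d - n) = (- 1) ^ (d - n) * (?b ^ (d - n) * rt i ^ (d - n))"
      by (simp only: power_minus[of "\<beta> i * rt i"] power_mult_distrib)
    moreover have "?b ^ d = ?b ^ n * ?b ^ (d - n)" using that by (simp flip: power_add)
    ultimately show ?thesis by (simp only: mult_ac)
  qed
  have p2: "y * (of_nat d * l i 2 * (of_nat ((d - 1) choose n) * ?b ^ n * ?a ^ (d - 1 - n)))
      = ?b ^ (d - 1) * l i 2 * (of_nat d * y * of_nat ((d - 1) choose n) * (- 1) ^ (d - 1 - n) * rt i ^ (d - 1 - n))"
    if "n \<le> d - 1" for n y
  proof -
    have "?a ^ (d - 1 - n) = (- 1) ^ (d - 1 - n) * (?b ^ (d - 1 - n) * rt i ^ (d - 1 - n))"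
      by (simp only: power_minus[of "\<beta> i * rt i"] power_mult_distrib)
    moreover have "?b ^ (d - 1) = ?b ^ n * ?b ^ (d - 1 - n)"
      unfolding power_add[symmetric] using that by (simp only: le_add_diff_inverse)
    ultimately show ?thesis by (simp only: mult_ac)
  qed
  have "(\<Sum>n<m. x n * jet (lform (l i) ^ d) n)
      = (\<Sum>n\<le>d. ?b ^ d * (x n * of_nat (d choose n) * (- 1) ^ (d - n) * rt i ^ (d - n)))
      + (\<Sum>n\<le>d - 1. ?b ^ (d - 1) * l i 2 * (of_nat d * x (Suc d + n) * of_nat ((d - 1) choose n) * (- 1) ^ (d - 1 - n) * rt i ^ (d - 1 - n)))"
    unfolding split_sum_m[OF assms(1)]
    by (intro arg_cong2[where f = "(+)"] sum.cong refl) (simp_all only: atMost_iff 1 2 p1 p2)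
  also have "\<dots> = ?b ^ d * poly (wof x) (rt i) + ?b ^ (d - 1) * l i 2 * poly (cof x) (rt i)"
    by (simp only: wof_def cof_def poly_sum poly_monom sum_distrib_left)
  also have "?b ^ d = ?b ^ (d - 1) * ?b" using assms(1) by (metis Suc_pred' power_Suc2)
  finally show ?thesis
    by (simp only: mult.assoc distrib_left[of "?b ^ (d - 1)" "?b * poly (wof x) (rt i)"])
qed

text \<open>The two halves of a jet can be prescribed independently: a lift has no derivative in z,
  and a multiple of the equation \<open>M\<close> of the line, whose derivative in z is 1, restricts
  to 0.\<close>

lemma jet_surj:
  assumes "d > 0"
  shows "\<exists>p\<in>hom_part (int d). \<forall>n<m. jet p n = e n"
proof -
  define p0 where "p0 = (\<Sum>n\<le>d. monom (e n) n)"
  define q0 where "q0 = (\<Sum>n\<le>d - 1. monom (e (Suc d + n)) n)"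
  have deg: "Polynomial.degree p0 \<le> d" "Polynomial.degree q0 \<le> d - 1"
    unfolding p0_def q0_def by (auto intro!: degree_sum_le order_trans[OF degree_monom_le])
  define M where "M = lform (ldual \<kappa> u v)"
  have M: "res \<kappa> u v M = 0" "pdiff 2 M = 1"
    using res_ldual[of \<kappa> u v 1] by (simp_all add: M_def pdiff_lform ldual_def)
  let ?p = "lift \<kappa> d p0 + M * lift \<kappa> (d - 1) q0"
  have "pdiff 2 (lift \<kappa> d p0) = 0"
    unfolding lift_def pdiff_sum
    by (rule sum.neutral) (simp add: pdiff_mult pdiff_power pdiff_mvar xform_def pdiff_diff)
  then have "res \<kappa> u v ?p = p0" "res \<kappa> u v (pdiff 2 ?p) = q0"
    using deg by (simp_all add: res_simps res_lift pdiff_add pdiff_mult M)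
  moreover have "poly.coeff p0 n = e n" if "n \<le> d" for n
    using that by (simp add: p0_def coeff_sum sum.delta)
  moreover have "poly.coeff q0 (n - Suc d) = e n" if "\<not> n \<le> d" "n < m" for n
    using that m by (simp add: q0_def coeff_sum sum.delta)
  ultimately have "\<forall>n<m. jet ?p n = e n"
    by (auto simp: jet_def)
  moreover have "M * lift \<kappa> (d - 1) q0 \<in> hom_part (int d)"
    using assms unfolding M_def by (intro hom_part_mult'[OF lform_hom_part lift_hom_part]) simp
  ultimately show ?thesis by (intro bexI[of _ ?p]) auto
qed

text \<open>Either a functional on jets kills all powers, and it yields a syzygy, or the powers span
  the jets, and then every form of degree \<open>d\<close> is a combination of powers up to a
  multiple of \<open>L c ^ 2\<close>.\<close>

lemma not_surj_imp_syz:
  assumes c: "c \<noteq> 0"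
    and ns: "quot_mult J (L c ^ 2) ` quot_part J (int d - 2) \<noteq> quot_part J (int d)"
  shows "d > 0 \<and> (\<exists>\<theta>. syz \<theta> \<and> \<theta> \<noteq> 0 \<and> (\<forall>j. Polynomial.degree (\<theta> j) \<le> d - 1))"
proof (rule ccontr)
  assume no: "\<not> ?thesis"
  have dec: "\<exists>q\<in>hom_part (int d - 2). p - L c ^ 2 * q \<in> J" if p: "p \<in> hom_part (int d)" for p
  proof (cases "d = 0")
    case True
    \<comment> \<open>For \<open>d = 0\<close> the powers are 1 and the quotient ring is
      zero.\<close>
    then have "1 \<in> J" using power_in_J[of 0] m by simp
    then have "p * 1 \<in> J" by (rule Modules.module.subspace_scale[OF ideal_module ideal_J])
    then show ?thesis by (auto intro!: bexI[of _ 0])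
  next
    case False
    then have d: "d > 0" by simp
    from dependent_or_dual[of "{..<m}" "{..<m}" "\<lambda>n i. jet (lform (l i) ^ d) n"]
    consider x where "\<exists>n\<in>{..<m}. x n \<noteq> 0" "\<forall>i\<in>{..<m}. (\<Sum>n<m. x n * jet (lform (l i) ^ d) n) = 0"
      | b \<delta> where "\<delta> \<noteq> 0" "\<forall>n\<in>{..<m}. \<forall>n'\<in>{..<m}. (\<Sum>i<m. b n i * jet (lform (l i) ^ d) n') = (if n = n' then \<delta> else 0)"
      by blast
    then show ?thesis
    proof cases
      case 1
      have "wof x \<noteq> 0 \<or> cof x \<noteq> 0"
      proof (rule ccontr)
        assume "\<not> ?thesis"
        then have z: "wof x = 0" "cof x = 0" by auto
        obtain n where n: "n < m" "x n \<noteq> 0" using 1 by auto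
        show False
        proof (cases "n \<le> d")
          case True
          then show False using coeff_wof[OF True, of x] z n by simp
        next
          case False
          then have "n - Suc d \<le> d - 1" "Suc d + (n - Suc d) = n" using n m d by auto
          then show False using coeff_cof[of "n - Suc d" x] z n d by simp
        qed
      qed
      moreover have "\<beta> i * poly (wof x) (rt i) + l i 2 * poly (cof x) (rt i) = 0" if "i < m" for i
        using 1(2) functional_jet_power[OF d that, of x] that slope[OF that] by simp
      ultimately have "\<exists>\<theta>. syz \<theta> \<and> \<theta> \<noteq> 0 \<and> (\<forall>j. Polynomial.degree (\<theta> j) \<le> d - 1)"
        by (intro syz_of_pair[OF d degree_wof degree_cof])
      with no d show ?thesis by blast
    next
      case 2
      define y where "y i = (\<Sum>n<m. jet p n * b n i) / \<delta>" for i
      let ?r = "\<Sum>i<m. mconst (y i) * lform (l i) ^ d"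
      have "jet (p - ?r) n = 0" if n: "n < m" for n
      proof -
        have "jet ?r n = (\<Sum>i<m. (\<Sum>k<m. jet p k * b k i) / \<delta> * jet (lform (l i) ^ d) n)"
          by (simp add: jet_sum jet_mconst_mult y_def)
        also have "\<dots> = (\<Sum>k<m. jet p k * (\<Sum>i<m. b k i * jet (lform (l i) ^ d) n)) / \<delta>"
          unfolding sum_divide_distrib sum_distrib_right sum_distrib_left
          by (subst sum.swap) (simp add: mult_ac)
        also have "(\<Sum>k<m. jet p k * (\<Sum>i<m. b k i * jet (lform (l i) ^ d) n))
            = (\<Sum>k<m. if k = n then jet p k * \<delta> else 0)"
          by (rule sum.cong) (use 2(2) n in auto)
        finally show ?thesis using n 2(1) by (simp add: jet_diff sum.delta)
      qed
      moreover have "?r \<in> hom_part (int d)"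
        by (intro hom_part_sum hom_part_mconst_mult hom_part_power1) auto
      ultimately obtain q where "q \<in> hom_part (int d - 2)" "p - ?r = L c ^ 2 * q"
        using jet_eq_0_imp[of "p - ?r" c] p c by blast
      moreover have "?r \<in> J"
        by (intro Modules.module.subspace_sum[OF ideal_module ideal_J] Modules.module.subspace_scale[OF ideal_module ideal_J] power_in_J) auto
      ultimately show ?thesis by (intro bexI[of _ q]) (auto simp: algebra_simps)
    qed
  qed
  have "quot_mult J (L c ^ 2) ` quot_part J (int d - 2) = quot_part J (int d)"
  proof (intro subset_antisym subsetI)
    fix C assume "C \<in> quot_mult J (L c ^ 2) ` quot_part J (int d - 2)"
    then obtain q where q: "q \<in> hom_part (int d - 2)" "C = (L c ^ 2 * q) +o J"
      by (auto simp: quot_part_def quot_mult_coset[OF ideal_J])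
    have "L c ^ 2 * q \<in> hom_part (int d)"
      by (rule hom_part_mult'[OF hom_part_power1 q(1)]) auto
    with q show "C \<in> quot_part J (int d)" by (auto simp: quot_part_def)
  next
    fix C assume "C \<in> quot_part J (int d)"
    then obtain p where p: "p \<in> hom_part (int d)" "C = p +o J" by (auto simp: quot_part_def)
    from dec[OF p(1)] obtain q where q: "q \<in> hom_part (int d - 2)" "p - L c ^ 2 * q \<in> J" by auto
    then have "C = quot_mult J (L c ^ 2) (q +o J)"
      using p by (simp add: quot_mult_coset[OF ideal_J] quot_coset_eq_iff[OF ideal_J])
    with q show "C \<in> quot_mult J (L c ^ 2) ` quot_part J (int d - 2)" by (auto simp: quot_part_def)
  qed
  with ns show False by blast
qed

text \<open>A syzygy gives a functional \<open>x\<close> on jets that kills the powers and the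
  multiples of \<open>L c ^ 2\<close>; this excludes surjectivity. As the matrix of jets is square,
  some combination of powers has zero jet, so it is \<open>L c ^ 2 * q\<close>. It is nonzero by
  independence, and \<open>q\<close> is not in \<open>J\<close> for reasons of degree; this excludes
  injectivity.\<close>

lemma syz_imp_fails:
  assumes c: "c \<noteq> 0" and d: "d > 0"
    and indep: "\<And>y i. (\<Sum>i<m. mconst (y i) * lform (l i) ^ d) = 0 \<Longrightarrow> i < m \<Longrightarrow> y i = 0"
    and \<theta>: "syz \<theta>" "\<theta> \<noteq> 0" "\<And>j. Polynomial.degree (\<theta> j) \<le> d - 1"
  shows "\<not> inj_on (quot_mult J (L c ^ 2)) (quot_part J (int d - 2))"
    and "quot_mult J (L c ^ 2) ` quot_part J (int d - 2) \<noteq> quot_part J (int d)"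
proof -
  \<comment> \<open>Solves the formulas for the coefficients of \<open>wof x\<close> and
    \<open>cof x\<close>; the binomial coefficients are invertible in characteristic 0.\<close>
  define x where "x n = (if n \<le> d then poly.coeff (wpart \<theta>) (d - n) * (- 1) ^ (d - n) / of_nat (d choose n)
    else poly.coeff (cpart \<theta>) (d - 1 - (n - Suc d)) * (- 1) ^ (d - 1 - (n - Suc d)) / (of_nat d * of_nat ((d - 1) choose (n - Suc d))))" for n
  have degw: "Polynomial.degree (wpart \<theta>) \<le> d"
  proof -
    have "Polynomial.degree ([:0, 1:] * (\<theta> 0 - [:\<kappa>:] * \<theta> 1)) \<le> 1 + (d - 1)"
      using \<theta>(3) by (intro degree_mult_le_add degree_diff_le) (auto intro!: order_trans[OF degree_smult_le])
    moreover have "Polynomial.degree (\<theta> 1) \<le> 1 + (d - 1)" using \<theta>(3)[of 1] by simp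
    ultimately have "Polynomial.degree (wpart \<theta>) \<le> 1 + (d - 1)"
      unfolding wpart_def by (rule degree_diff_le[rotated])
    then show ?thesis using d by simp
  qed
  have degc: "Polynomial.degree (cpart \<theta>) \<le> d - 1"
    unfolding cpart_def using \<theta>(3)
    by (auto intro!: degree_diff_le order_trans[OF degree_smult_le])
  have sq: "(- 1 :: 'k) ^ k * (- 1) ^ k = 1" for k by (simp flip: power_mult_distrib)
  have wx: "wof x = wpart \<theta>"
  proof (rule poly_eqI)
    fix k
    show "poly.coeff (wof x) k = poly.coeff (wpart \<theta>) k"
    proof (cases "k \<le> d")
      case True
      then have k: "d - (d - k) = k" "d - k \<le> d" by auto
      have "poly.coeff (wof x) k = x (d - k) * of_nat (d choose (d - k)) * (- 1) ^ k"
        using coeff_wof[OF k(2), of x] k(1) by simp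
      also have "\<dots> = poly.coeff (wpart \<theta>) k * ((- 1) ^ k * (- 1) ^ k)"
        using k by (simp add: x_def)
      finally show ?thesis by (simp add: sq)
    next
      case False
      then show ?thesis using degw degree_wof[of x] by (simp add: coeff_eq_0)
    qed
  qed
  have cx: "cof x = cpart \<theta>"
  proof (rule poly_eqI)
    fix k
    show "poly.coeff (cof x) k = poly.coeff (cpart \<theta>) k"
    proof (cases "k \<le> d - 1")
      case True
      then have k: "d - 1 - (d - 1 - k) = k" "d - 1 - k \<le> d - 1" by auto
      have "poly.coeff (cof x) k = of_nat d * x (Suc d + (d - 1 - k)) * of_nat ((d - 1) choose (d - 1 - k)) * (- 1) ^ k"
        using coeff_cof[OF k(2), of x] k(1) by simp
      also have "x (Suc d + (d - 1 - k)) = poly.coeff (cpart \<theta>) k * (- 1) ^ k / (of_nat d * of_nat ((d - 1) choose (d - 1 - k)))"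
        using k(1) by (simp add: x_def)
      also have "of_nat d * \<dots> * of_nat ((d - 1) choose (d - 1 - k)) * (- 1) ^ k = poly.coeff (cpart \<theta>) k * ((- 1) ^ k * (- 1) ^ k)"
        using d k(2) by (simp add: binomial_eq_0_iff)
      finally show ?thesis by (simp add: sq)
    next
      case False
      then show ?thesis using degc degree_cof[of x] by (simp add: coeff_eq_0)
    qed
  qed
  have ann: "(\<Sum>n<m. x n * jet (lform (l i) ^ d) n) = 0" if "i < m" for i
    unfolding functional_jet_power[OF d that] wx cx
    using wpart_cpart_root[OF that, of \<theta>] syz_root[OF \<theta>(1) that] by simp
  have "\<exists>n<m. x n \<noteq> 0"
  proof (rule ccontr)
    assume "\<not> ?thesis"
    then have "\<forall>n<m. x n = 0" by blast
    then have "wof x = 0" "cof x = 0" using m d by (simp_all add: wof_def cof_def)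
    then have "\<theta> = 0" using wpart_cpart_eq_0[OF \<theta>(1)] wx cx by simp
    with \<theta>(2) show False by simp
  qed
  then obtain n0 where n0: "n0 < m" "x n0 \<noteq> 0" by auto
  have "\<exists>y. (\<exists>i<m. y i \<noteq> 0) \<and> (\<forall>n<m. (\<Sum>i<m. y i * jet (lform (l i) ^ d) n) = 0)"
    using left_kernel_imp_right_kernel[of m x "\<lambda>i. jet (lform (l i) ^ d)"] ann n0 by blast
  then obtain y i1 where y: "i1 < m" "y i1 \<noteq> 0" "\<And>n. n < m \<Longrightarrow> (\<Sum>i<m. y i * jet (lform (l i) ^ d) n) = 0" by blast
  let ?r = "\<Sum>i<m. mconst (y i) * lform (l i) ^ d"
  have r: "?r \<in> hom_part (int d)"
    by (intro hom_part_sum hom_part_mconst_mult hom_part_power1) auto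
  obtain q where q: "q \<in> hom_part (int d - 2)" "?r = L c ^ 2 * q"
    using jet_eq_0_imp[OF r c] y(3) by (auto simp: jet_sum jet_mconst_mult)
  have "?r \<noteq> 0" using indep y(1,2) by blast
  then have q0: "q \<noteq> 0" using q by auto
  have rJ: "?r \<in> J"
    by (intro Modules.module.subspace_sum[OF ideal_module ideal_J] Modules.module.subspace_scale[OF ideal_module ideal_J] power_in_J) auto
  have "int d - 2 \<ge> 0" using q q0 hom_part_neg by fastforce
  then have q': "q \<in> hom_part (int (d - 2))" "d - 2 < d" using q by (simp_all add: of_nat_diff)
  have "q \<notin> J" using J_hom_part[of q "d - 2"] q' q0 by auto
  then have "q +o J \<noteq> 0 +o J" using quot_coset_eq_iff[OF ideal_J, of q 0] by simp
  moreover have "quot_mult J (L c ^ 2) (q +o J) = quot_mult J (L c ^ 2) (0 +o J)"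
    using rJ q quot_coset_eq_iff[OF ideal_J, of "L c ^ 2 * q" "L c ^ 2 * 0"]
    unfolding quot_mult_coset[OF ideal_J] by simp
  moreover have "q +o J \<in> quot_part J (int d - 2)" "0 +o J \<in> quot_part J (int d - 2)"
    unfolding quot_part_def using q by (blast intro: hom_part_zero)+
  ultimately show "\<not> inj_on (quot_mult J (L c ^ 2)) (quot_part J (int d - 2))"
    by (auto simp: inj_on_def)
  obtain p where p: "p \<in> hom_part (int d)" "\<forall>n<m. jet p n = (if n = n0 then 1 else 0)"
    using jet_surj[OF d, of "\<lambda>n. if n = n0 then 1 else 0"] by auto
  show "quot_mult J (L c ^ 2) ` quot_part J (int d - 2) \<noteq> quot_part J (int d)"
  proof
    assume "quot_mult J (L c ^ 2) ` quot_part J (int d - 2) = quot_part J (int d)"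
    moreover have "p +o J \<in> quot_part J (int d)" using p by (auto simp: quot_part_def)
    ultimately have "p +o J \<in> quot_mult J (L c ^ 2) ` quot_part J (int d - 2)" by (simp only:)
    then obtain C where C: "C \<in> quot_part J (int d - 2)" "p +o J = quot_mult J (L c ^ 2) C"
      by (rule imageE)
    from C(1) obtain s where s0: "s \<in> hom_part (int d - 2)" "C = s +o J"
      unfolding quot_part_def by (rule imageE)
    with C(2) have s1: "s \<in> hom_part (int d - 2)" "p +o J = quot_mult J (L c ^ 2) (s +o J)"
      by (simp_all only:)
    then have s: "s \<in> hom_part (int d - 2)" "p - L c ^ 2 * s \<in> J"
      by (simp_all add: quot_mult_coset[OF ideal_J] quot_coset_eq_iff[OF ideal_J])
    have "L c ^ 2 * s \<in> hom_part (int d)"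
      by (rule hom_part_mult'[OF hom_part_power1 s(1)]) auto
    then obtain z where z: "p - L c ^ 2 * s = (\<Sum>i<m. mconst (z i) * lform (l i) ^ d)"
      using J_hom_part[of "p - L c ^ 2 * s" d] s(2) p(1) by blast
    have "x n0 = (\<Sum>n<m. x n * jet p n)"
      using p(2) n0 by (simp add: if_distrib[of "\<lambda>e. x _ * e"] sum.delta cong: if_cong)
    also have "\<dots> = (\<Sum>n<m. x n * jet (p - L c ^ 2 * s) n)"
      by (simp add: jet_diff jet_L_square)
    also have "\<dots> = (\<Sum>i<m. z i * (\<Sum>n<m. x n * jet (lform (l i) ^ d) n))"
      unfolding z jet_sum jet_mconst_mult sum_distrib_left
      by (subst sum.swap) (simp add: mult_ac)
    also have "\<dots> = 0" using ann by simp
    finally show False using n0 by simp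
  qed
qed

end

section \<open>Sections of twisted sheaves\<close>

lemma twistI:
  assumes "\<And>p. p \<in> U \<Longrightarrow> \<exists>g h t. g \<in> hom_part (t + n) \<and> h \<in> hom_part t \<and> eval h p \<noteq> 0 \<and> q = to_fract g / to_fract h"
  shows "q \<in> twist n U"
  unfolding twist_def Fract_conv_to_fract using assms by (intro CollectI ballI)

lemma twistE:
  assumes "q \<in> twist n U" "p \<in> U"
  obtains g h t where "g \<in> hom_part (t + n)" "h \<in> hom_part t" "eval h p \<noteq> 0" "h \<noteq> 0"
    "q = to_fract g / to_fract h"
proof -
  from assms obtain g h t where 1: "g \<in> hom_part (t + n)" "h \<in> hom_part t" "eval h p \<noteq> 0"
    "q = to_fract g / to_fract h"
    unfolding twist_def Fract_conv_to_fract by blast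
  then have "h \<noteq> 0" by (auto simp: eval_simps)
  with 1 that show ?thesis by blast
qed

lemma twist_mono: "V \<subseteq> U \<Longrightarrow> q \<in> twist n U \<Longrightarrow> q \<in> twist n V"
  unfolding twist_def by blast

lemma twist_zero [simp, intro]: "0 \<in> twist n U"
  by (rule twistI, intro exI[of _ 0] exI[of _ 1]) (simp add: eval_simps)

lemma twist_add [intro]:
  assumes "q \<in> twist n U" "r \<in> twist n U"
  shows "q + r \<in> twist n U"
proof (rule twistI)
  fix p assume p: "p \<in> U"
  from assms(1) p obtain g h t where 1: "g \<in> hom_part (t + n)" "h \<in> hom_part t" "eval h p \<noteq> 0" "h \<noteq> 0"
    "q = to_fract g / to_fract h" by (rule twistE)
  from assms(2) p obtain g' h' t' where 2: "g' \<in> hom_part (t' + n)" "h' \<in> hom_part t'" "eval h' p \<noteq> 0" "h' \<noteq> 0"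
    "r = to_fract g' / to_fract h'" by (rule twistE)
  have "g * h' + g' * h \<in> hom_part (t + t' + n)"
    using 1 2 by (intro hom_part_add) (auto elim!: hom_part_mult')
  moreover have "h * h' \<in> hom_part (t + t')" using 1 2 by (auto intro: hom_part_mult)
  moreover have "eval (h * h') p \<noteq> 0" using 1 2 by (simp add: eval_simps)
  moreover have "q + r = to_fract (g * h' + g' * h) / to_fract (h * h')"
    using 1 2 by (simp add: add_frac_eq)
  ultimately show "\<exists>g h t. g \<in> hom_part (t + n) \<and> h \<in> hom_part t \<and> eval h p \<noteq> 0 \<and> q + r = to_fract g / to_fract h"
    by blast
qed

lemma twist_mult:
  assumes "q \<in> twist n U" "r \<in> twist k U"
  shows "q * r \<in> twist (n + k) U"
proof (rule twistI)
  fix p assume p: "p \<in> U"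
  from assms(1) p obtain g h t where 1: "g \<in> hom_part (t + n)" "h \<in> hom_part t" "eval h p \<noteq> 0" "h \<noteq> 0"
    "q = to_fract g / to_fract h" by (rule twistE)
  from assms(2) p obtain g' h' t' where 2: "g' \<in> hom_part (t' + k)" "h' \<in> hom_part t'" "eval h' p \<noteq> 0" "h' \<noteq> 0"
    "r = to_fract g' / to_fract h'" by (rule twistE)
  have "g * g' \<in> hom_part (t + t' + (n + k))" using 1 2 by (auto elim!: hom_part_mult')
  moreover have "h * h' \<in> hom_part (t + t')" using 1 2 by (auto intro: hom_part_mult)
  moreover have "eval (h * h') p \<noteq> 0" using 1 2 by (simp add: eval_simps)
  moreover have "q * r = to_fract (g * g') / to_fract (h * h')"
    using 1 2 by simp
  ultimately show "\<exists>g h t. g \<in> hom_part (t + (n + k)) \<and> h \<in> hom_part t \<and> eval h p \<noteq> 0 \<and> q * r = to_fract g / to_fract h"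
    by blast
qed

lemma twist_mult': "q \<in> twist n U \<Longrightarrow> r \<in> twist k U \<Longrightarrow> n + k = s \<Longrightarrow> q * r \<in> twist s U"
  using twist_mult by blast

lemma twist_divide:
  assumes "g \<in> hom_part (t + n)" "h \<in> hom_part t" "\<And>p. p \<in> U \<Longrightarrow> eval h p \<noteq> 0"
  shows "to_fract g / to_fract h \<in> twist n U"
  using assms by (intro twistI) blast

lemma twist_to_fract: "g \<in> hom_part n \<Longrightarrow> to_fract g \<in> twist n U"
  using twist_divide[of g 0 n 1 U] by (simp add: eval_simps)

lemma twist_one [simp, intro]: "1 \<in> twist 0 U"
  using twist_to_fract[of 1 0 U] by simp

lemma twist_uminus [intro]: "q \<in> twist n U \<Longrightarrow> - q \<in> twist n U"
  using twist_mult[of "- 1" 0 U q n] twist_to_fract[of "- 1" 0 U] by auto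

lemma twist_diff [intro]: "q \<in> twist n U \<Longrightarrow> r \<in> twist n U \<Longrightarrow> q - r \<in> twist n U"
  using twist_add[OF _ twist_uminus, of q n U r] by simp

lemma twist_sum [intro]: "(\<And>i. i \<in> A \<Longrightarrow> f i \<in> twist n U) \<Longrightarrow> sum f A \<in> twist n U"
  by (induction A rule: infinite_finite_induct) auto

lemma hom_part_decomp:
  assumes "h \<in> hom_part n" "n > 0"
  shows "\<exists>a. (\<forall>k. a k \<in> hom_part (n - 1)) \<and> h = (\<Sum>k\<in>UNIV. a k * mvar k)"
  using assms(1)
proof (induction h rule: hom_part_induct)
  case zero
  show ?case by (intro exI[of _ "\<lambda>_. 0"]) simp
next
  case (add m b p)
  then obtain a where a: "\<forall>k. a k \<in> hom_part (n - 1)" "p = (\<Sum>k\<in>UNIV. a k * mvar k)" by auto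
  have "mdeg m \<noteq> 0" using add.hyps assms(2) by linarith
  then obtain i where i: "Poly_Mapping.lookup m i > 0" by auto
  let ?e = "Poly_Mapping.single i 1 :: 3 \<Rightarrow>\<^sub>0 nat"
  have m: "m = (m - ?e) + ?e"
    by (rule poly_mapping_eqI) (use i in \<open>auto simp: lookup_add lookup_minus lookup_single when_def\<close>)
  have "mdeg m = mdeg (m - ?e) + mdeg ?e" using m mdeg_add by metis
  moreover have "mdeg ?e = 1" by (simp add: lookup_single when_def)
  ultimately have "int (mdeg (m - ?e)) = n - 1" using add.hyps by linarith
  then have 1: "Poly_Mapping.single (m - ?e) b \<in> hom_part (n - 1)" by (rule hom_part_single)
  have 2: "Poly_Mapping.single m b = Poly_Mapping.single (m - ?e) b * mvar i"
    using m by (simp add: mvar_def mult_single)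
  let ?a = "\<lambda>k. (if k = i then Poly_Mapping.single (m - ?e) b else 0) + a k"
  have "(\<Sum>k\<in>UNIV. ?a k * mvar k) = Poly_Mapping.single m b + p"
    by (simp add: 2 a(2) distrib_right sum.distrib if_distrib[of "\<lambda>u. u * _"] sum.delta cong: if_cong)
  moreover have "\<forall>k. ?a k \<in> hom_part (n - 1)" using 1 a(1) by auto
  ultimately show ?case by (intro exI[of _ ?a]) simp
qed

text \<open>A partition of unity of degree -1, obtained by splitting one variable off each monomial
  of \<open>h\<close>. It recovers a section from its products with the variables and generates
  \<open>O(-1)\<close> over \<open>U\<close>.\<close>

lemma basic_open_unit:
  assumes "basic_open U"
  shows "\<exists>e. (\<forall>k. e k \<in> twist (- 1) U) \<and> (\<Sum>k\<in>UNIV. e k * to_fract (mvar k)) = 1"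
proof -
  from assms obtain h n where h: "n > 0" "h \<in> hom_part n" "h \<noteq> 0" "U = {p. p \<noteq> 0 \<and> eval h p \<noteq> 0}"
    unfolding basic_open_def by blast
  from hom_part_decomp[OF h(2,1)] obtain a where a: "\<And>k. a k \<in> hom_part (n - 1)" "h = (\<Sum>k\<in>UNIV. a k * mvar k)" by blast
  have "to_fract (a k) / to_fract h \<in> twist (- 1) U" for k
    using a(1)[of k] h by (intro twist_divide[of _ n]) auto
  moreover have "(\<Sum>k\<in>UNIV. to_fract (a k) / to_fract h * to_fract (mvar k)) = to_fract (\<Sum>k\<in>UNIV. a k * mvar k) / to_fract h"
    by (simp add: to_fract_sum sum_divide_distrib)
  moreover have "to_fract (\<Sum>k\<in>UNIV. a k * mvar k) / to_fract h = 1"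
    unfolding a(2)[symmetric] using h(3) by simp
  ultimately show ?thesis by (intro exI[of _ "\<lambda>k. to_fract (a k) / to_fract h"]) simp
qed

subsection \<open>Spans of sections\<close>

lemma sum_fun_apply: "(\<Sum>i\<in>A. f i) x = (\<Sum>i\<in>A. f i x)"
  by (induction A rule: infinite_finite_induct) auto

lemma vscale_zero: "(0::'a::comm_ring_1) \<cdot> t = 0"
  and vscale_add: "(a + b) \<cdot> t = a \<cdot> t + (b::'a::comm_ring_1) \<cdot> t"
  by (auto simp: vscale_def distrib_right)

lemma reg_span_zero: "0 \<in> reg_span U S"
  unfolding reg_span_def by (intro CollectI exI[of _ "{}"]) auto

lemma reg_span_base: "v \<in> S \<Longrightarrow> v \<in> reg_span U S"
  unfolding reg_span_def
  by (intro CollectI exI[of _ "{v}"] exI[of _ "\<lambda>_. 1"]) (auto simp: vscale_def)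

lemma reg_span_add:
  assumes "v \<in> reg_span U S" "w \<in> reg_span U S"
  shows "v + w \<in> reg_span U S"
proof -
  from assms obtain T c T' c' where T: "finite T" "T \<subseteq> S" "\<forall>t\<in>T. c t \<in> reg U" "v = (\<Sum>t\<in>T. c t \<cdot> t)"
    and T': "finite T'" "T' \<subseteq> S" "\<forall>t\<in>T'. c' t \<in> reg U" "w = (\<Sum>t\<in>T'. c' t \<cdot> t)"
    unfolding reg_span_def by blast
  let ?c = "\<lambda>t. (if t \<in> T then c t else 0) + (if t \<in> T' then c' t else 0)"
  have "v = (\<Sum>t\<in>T \<union> T'. (if t \<in> T then c t else 0) \<cdot> t)"
    unfolding T(4) using T T' by (intro sum.mono_neutral_cong_left) (auto simp: vscale_zero)
  moreover have "w = (\<Sum>t\<in>T \<union> T'. (if t \<in> T' then c' t else 0) \<cdot> t)"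
    unfolding T'(4) using T T' by (intro sum.mono_neutral_cong_left) (auto simp: vscale_zero)
  ultimately have "v + w = (\<Sum>t\<in>T \<union> T'. ?c t \<cdot> t)"
    by (simp only: vscale_add sum.distrib)
  moreover have "\<forall>t\<in>T \<union> T'. ?c t \<in> reg U" using T T' by auto
  ultimately show ?thesis
    unfolding reg_span_def using T T' by (intro CollectI exI[of _ "T \<union> T'"] exI[of _ ?c]) auto
qed

lemma reg_mult: "a \<in> reg U \<Longrightarrow> b \<in> twist n U \<Longrightarrow> a * b \<in> twist n U"
  using twist_mult[of a 0 U b n] by simp

lemma reg_span_scale:
  assumes "v \<in> reg_span U S" "a \<in> reg U"
  shows "a \<cdot> v \<in> reg_span U S"
proof -
  from assms obtain T c where T: "finite T" "T \<subseteq> S" "\<forall>t\<in>T. c t \<in> reg U" "v = (\<Sum>t\<in>T. c t \<cdot> t)"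
    unfolding reg_span_def by blast
  have "a \<cdot> v = (\<Sum>t\<in>T. (a * c t) \<cdot> t)"
    by (rule ext) (simp add: T(4) vscale_def sum_fun_apply sum_distrib_left mult.assoc)
  moreover have "\<forall>t\<in>T. a * c t \<in> reg U" using T(3) assms(2) reg_mult by blast
  ultimately show ?thesis
    unfolding reg_span_def using T by (intro CollectI exI[of _ T] exI[of _ "\<lambda>t. a * c t"]) auto
qed

definition submod :: "'k::field point set \<Rightarrow> ('i \<Rightarrow> 'k ratfun) set \<Rightarrow> bool" where
  "submod U N \<longleftrightarrow> 0 \<in> N \<and> (\<forall>v\<in>N. \<forall>w\<in>N. v + w \<in> N) \<and> (\<forall>a\<in>reg U. \<forall>v\<in>N. a \<cdot> v \<in> N)"

lemma submod_zero: "submod U N \<Longrightarrow> 0 \<in> N"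
  and submod_add: "submod U N \<Longrightarrow> v \<in> N \<Longrightarrow> w \<in> N \<Longrightarrow> v + w \<in> N"
  and submod_scale: "submod U N \<Longrightarrow> a \<in> reg U \<Longrightarrow> v \<in> N \<Longrightarrow> a \<cdot> v \<in> N"
  by (auto simp: submod_def)

lemma submod_uminus: "submod U N \<Longrightarrow> v \<in> N \<Longrightarrow> - v \<in> N"
proof -
  assume "submod U N" "v \<in> N"
  then have "(- 1) \<cdot> v \<in> N" by (intro submod_scale twist_uminus twist_one)
  moreover have "(- 1) \<cdot> v = - v" by (auto simp: vscale_def)
  ultimately show ?thesis by simp
qed

lemma submod_diff: "submod U N \<Longrightarrow> v \<in> N \<Longrightarrow> w \<in> N \<Longrightarrow> v - w \<in> N"
  using submod_add submod_uminus by (metis add_uminus_conv_diff)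

lemma submod_sum: "submod U N \<Longrightarrow> (\<And>i. i \<in> A \<Longrightarrow> f i \<in> N) \<Longrightarrow> sum f A \<in> N"
  by (induction A rule: infinite_finite_induct) (auto simp: submod_zero submod_add)

lemma submod_reg_span: "submod U (reg_span U S)"
  by (auto simp: submod_def reg_span_zero reg_span_add reg_span_scale)

lemma reg_span_minimal: "S \<subseteq> N \<Longrightarrow> submod U N \<Longrightarrow> reg_span U S \<subseteq> N"
proof
  fix v assume S: "S \<subseteq> N" and N: "submod U N" and "v \<in> reg_span U S"
  then obtain T c where "T \<subseteq> S" "\<forall>t\<in>T. c t \<in> reg U" "v = (\<Sum>t\<in>T. c t \<cdot> t)"
    unfolding reg_span_def by blast
  with S show "v \<in> N" by (auto intro!: submod_sum[OF N] submod_scale[OF N])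
qed

lemma reg_span_mono:
  assumes "V \<subseteq> U" "S \<subseteq> S'"
  shows "reg_span U S \<subseteq> reg_span V S'"
  using reg_span_minimal[of S "reg_span V S'" U] submod_reg_span[of V S'] assms twist_mono[OF assms(1)]
  by (auto simp: submod_def intro: reg_span_base)

subsection \<open>Sections that vanish on a line\<close>

definition lid :: "'k::field mpoly3 \<Rightarrow> int \<Rightarrow> 'k point set \<Rightarrow> 'k ratfun set" where
  "lid L n U = (\<lambda>g. to_fract L * g) ` twist (n - 1) U"

lemma line_ideal_eq: "line_ideal L U = lid L 0 U"
  by (simp add: line_ideal_def lid_def to_fract_def)

lemma lid_zero [simp, intro]: "0 \<in> lid L n U"
  unfolding lid_def by (intro image_eqI[of _ _ 0]) auto

lemma lid_add [intro]: "a \<in> lid L n U \<Longrightarrow> b \<in> lid L n U \<Longrightarrow> a + b \<in> lid L n U"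
  unfolding lid_def by (auto simp flip: distrib_left)

lemma lid_uminus [intro]: "a \<in> lid L n U \<Longrightarrow> - a \<in> lid L n U"
  unfolding lid_def by (auto simp flip: mult_minus_right)

lemma lid_diff [intro]: "a \<in> lid L n U \<Longrightarrow> b \<in> lid L n U \<Longrightarrow> a - b \<in> lid L n U"
  using lid_add[OF _ lid_uminus, of a L n U b] by simp

lemma lid_sum [intro]: "(\<And>i. i \<in> A \<Longrightarrow> f i \<in> lid L n U) \<Longrightarrow> sum f A \<in> lid L n U"
  by (induction A rule: infinite_finite_induct) auto

lemma lid_mult:
  assumes "a \<in> lid L n U" "b \<in> twist k U" "n + k = s"
  shows "a * b \<in> lid L s U" "b * a \<in> lid L s U"
proof -
  from assms(1) obtain g where g: "g \<in> twist (n - 1) U" "a = to_fract L * g" by (auto simp: lid_def)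
  have "g * b \<in> twist (s - 1) U" using g assms by (intro twist_mult') auto
  then show "a * b \<in> lid L s U" "b * a \<in> lid L s U"
    unfolding lid_def g by (auto simp: mult_ac intro!: image_eqI[of _ _ "g * b"])
qed

lemma lid_to_fract: "q \<in> hom_part (n - 1) \<Longrightarrow> p = L * q \<Longrightarrow> to_fract p \<in> lid L n U"
  unfolding lid_def by (auto intro!: twist_to_fract)

lemma lid_mono: "V \<subseteq> U \<Longrightarrow> a \<in> lid L n U \<Longrightarrow> a \<in> lid L n V"
  unfolding lid_def using twist_mono by blast

lemma lid_twist: "L \<in> hom_part 1 \<Longrightarrow> a \<in> lid L n U \<Longrightarrow> a \<in> twist n U"
  unfolding lid_def by (auto intro!: twist_mult' twist_to_fract)

definition sheaf_mod :: "('k::field, 'i) sheaf \<Rightarrow> bool" where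
  "sheaf_mod E \<longleftrightarrow> (\<forall>U. submod U (E U)) \<and> (\<forall>U V. V \<subseteq> U \<longrightarrow> E U \<subseteq> E V)"

lemma sheaf_mod_submod: "sheaf_mod E \<Longrightarrow> submod U (E U)"
  and sheaf_mod_mono: "sheaf_mod E \<Longrightarrow> V \<subseteq> U \<Longrightarrow> v \<in> E U \<Longrightarrow> v \<in> E V"
  unfolding sheaf_mod_def by blast+

lemma submod_line_sub: "submod U (line_sub L E U)"
  unfolding line_sub_def by (rule submod_reg_span)

lemma line_sub_subset:
  assumes "sheaf_mod E" "L \<in> hom_part 1"
  shows "line_sub L E U \<subseteq> E U"
  unfolding line_sub_def
proof (rule reg_span_minimal)
  show "{g \<cdot> v |g v. g \<in> line_ideal L U \<and> v \<in> E U} \<subseteq> E U"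
    using assms lid_twist[OF assms(2)] sheaf_mod_submod submod_scale
    by (fastforce simp: line_ideal_eq)
qed (rule sheaf_mod_submod[OF assms(1)])

lemma line_sub_mono:
  assumes "sheaf_mod E" "V \<subseteq> U"
  shows "line_sub L E U \<subseteq> line_sub L E V"
  unfolding line_sub_def
  using lid_mono[OF assms(2)] sheaf_mod_mono[OF assms]
  by (intro reg_span_mono assms(2)) (unfold line_ideal_eq, blast)

text \<open>The hypothesis says that \<open>w\<close> is a section of \<open>E(-1)\<close>. The
  partition of unity writes \<open>L\<close> times \<open>w\<close> as a sum of elements of
  \<open>line_ideal\<close> times sections of \<open>E\<close>.\<close>

lemma line_subI:
  assumes "basic_open U" "\<And>k. to_fract (mvar k) \<cdot> w \<in> E U" "v = to_fract L \<cdot> w"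
  shows "v \<in> line_sub L E U"
proof -
  from basic_open_unit[OF assms(1)] obtain e where e: "\<And>k. e k \<in> twist (- 1) U"
    "(\<Sum>k\<in>UNIV. e k * to_fract (mvar k)) = 1" by blast
  have "v = (\<Sum>k\<in>UNIV. (to_fract L * e k) \<cdot> (to_fract (mvar k) \<cdot> w))"
  proof
    fix i
    have "v i = to_fract L * (\<Sum>k\<in>UNIV. e k * to_fract (mvar k)) * w i"
      by (simp add: assms(3) e(2) vscale_def)
    also have "\<dots> = (\<Sum>k\<in>UNIV. (to_fract L * e k) \<cdot> (to_fract (mvar k) \<cdot> w)) i"
      by (simp add: vscale_def sum_fun_apply sum_distrib_left sum_distrib_right mult_ac)
    finally show "v i = (\<Sum>k\<in>UNIV. (to_fract L * e k) \<cdot> (to_fract (mvar k) \<cdot> w)) i" .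
  qed
  moreover have "(to_fract L * e k) \<cdot> (to_fract (mvar k) \<cdot> w) \<in> line_sub L E U" for k
  proof -
    have "to_fract L * e k \<in> line_ideal L U"
      unfolding line_ideal_eq lid_def using e(1)[of k] by (auto intro: imageI)
    then show ?thesis
      unfolding line_sub_def using assms(2) by (blast intro: reg_span_base)
  qed
  ultimately show ?thesis by (auto intro!: submod_sum[OF submod_line_sub])
qed

lemma line_sub_lid:
  assumes "v \<in> line_sub L E U" "\<And>v. v \<in> E U \<Longrightarrow> v i \<in> twist n U"
  shows "v i \<in> lid L n U"
proof -
  have "line_sub L E U \<subseteq> {v. v i \<in> lid L n U}"
    unfolding line_sub_def
  proof (rule reg_span_minimal)
    show "{g \<cdot> v |g v. g \<in> line_ideal L U \<and> v \<in> E U} \<subseteq> {v. v i \<in> lid L n U}"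
      using assms(2) by (auto simp: vscale_def line_ideal_eq intro!: lid_mult(1)[where n = 0])
    show "submod U {v. v i \<in> lid L n U}"
      by (auto simp: submod_def vscale_def intro!: lid_mult(2)[where k = 0])
  qed
  with assms(1) show ?thesis by auto
qed

subsection \<open>Isomorphisms on a line from relations\<close>

lemma coset_add: "submod U N \<Longrightarrow> (v +o N) + (w +o N) = (v + w) +o N"
proof (intro subset_antisym subsetI)
  fix x assume N: "submod U N" and "x \<in> (v +o N) + (w +o N)"
  then obtain a b where "a \<in> N" "b \<in> N" "x = (v + a) + (w + b)" by (auto simp: elt_set_plus_def set_plus_def)
  then have "x = (v + w) + (a + b)" "a + b \<in> N" using submod_add[OF N] by (auto simp: add_ac)
  then show "x \<in> (v + w) +o N" unfolding elt_set_plus_def by blast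
next
  fix x assume N: "submod U N" and "x \<in> (v + w) +o N"
  then obtain a where "a \<in> N" "x = (v + a) + (w + 0)" by (auto simp: elt_set_plus_def add_ac)
  then show "x \<in> (v +o N) + (w +o N)"
    unfolding elt_set_plus_def set_plus_def using submod_zero[OF N] by blast
qed

lemma coset_eq_iff:
  assumes N: "submod U N"
  shows "v +o N = w +o N \<longleftrightarrow> v - w \<in> N"
proof
  assume "v +o N = w +o N"
  moreover have "v \<in> v +o N" using submod_zero[OF N] by (force simp: elt_set_plus_def)
  ultimately show "v - w \<in> N" by (auto simp: elt_set_plus_def)
next
  assume vw: "v - w \<in> N"
  have "v +o N \<subseteq> w +o N" if "v - w \<in> N" for v w
  proof
    fix x assume "x \<in> v +o N"
    then obtain b where "b \<in> N" "x = v + b" by (auto simp: elt_set_plus_def)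
    then have "x = w + ((v - w) + b)" "(v - w) + b \<in> N" using that submod_add[OF N] by auto
    then show "x \<in> w +o N" unfolding elt_set_plus_def by blast
  qed
  moreover have "w - v \<in> N" using submod_uminus[OF N vw] by simp
  ultimately show "v +o N = w +o N" using vw by blast
qed

lemma coset_extend:
  assumes N: "submod U N" and N': "submod V N'" and "N \<subseteq> N'"
  shows "(v +o N) + N' = v +o N'"
proof (intro subset_antisym subsetI)
  fix x assume "x \<in> (v +o N) + N'"
  then obtain a b where "a \<in> N" "b \<in> N'" "x = (v + a) + b" by (auto simp: elt_set_plus_def set_plus_def)
  then have "x = v + (a + b)" "a + b \<in> N'" using submod_add[OF N'] assms(3) by (auto simp: add_ac)
  then show "x \<in> v +o N'" unfolding elt_set_plus_def by blast
next
  fix x assume "x \<in> v +o N'"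
  then obtain a where "a \<in> N'" "x = (v + 0) + a" by (auto simp: elt_set_plus_def)
  then show "x \<in> (v +o N) + N'"
    unfolding elt_set_plus_def set_plus_def using submod_zero[OF N] by blast
qed

lemma coset_scale:
  assumes N: "submod U N" and a: "a \<in> reg U"
  shows "(\<cdot>) a ` (v +o N) + N = (a \<cdot> v) +o N"
proof (intro subset_antisym subsetI)
  fix x assume "x \<in> (\<cdot>) a ` (v +o N) + N"
  then obtain n b where "n \<in> N" "b \<in> N" "x = a \<cdot> (v + n) + b" by (auto simp: elt_set_plus_def set_plus_def)
  then have "x = a \<cdot> v + (a \<cdot> n + b)" "a \<cdot> n + b \<in> N"
    using submod_add[OF N] submod_scale[OF N a] by (auto simp: vscale_def algebra_simps)
  then show "x \<in> (a \<cdot> v) +o N" unfolding elt_set_plus_def by blast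
next
  fix x assume "x \<in> (a \<cdot> v) +o N"
  then obtain b where "b \<in> N" "x = a \<cdot> v + b" by (auto simp: elt_set_plus_def)
  moreover have "v \<in> v +o N" using submod_zero[OF N] by (force simp: elt_set_plus_def)
  ultimately show "x \<in> (\<cdot>) a ` (v +o N) + N" by (auto simp: set_plus_def)
qed

text \<open>Only a relation is asked for, because lifting a section from the line to
  \<open>U\<close> involves choices that need not agree on smaller open sets. By linearity,
  \<open>left\<close> and \<open>right\<close>, the sections related to the members of one coset
  form exactly one coset.\<close>

lemma line_isoI:
  fixes E :: "('k::field, 'i) sheaf" and G :: "('k, 'j) sheaf"
  assumes L: "L \<in> hom_part 1" and E: "sheaf_mod E" and G: "sheaf_mod G"
    and add: "\<And>U v g v' g'. R U v g \<Longrightarrow> R U v' g' \<Longrightarrow> R U (v + v') (g + g')"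
    and scale: "\<And>U v g a. R U v g \<Longrightarrow> a \<in> reg U \<Longrightarrow> R U (a \<cdot> v) (a \<cdot> g)"
    and mono: "\<And>U V v g. V \<subseteq> U \<Longrightarrow> R U v g \<Longrightarrow> R V v g"
    and total: "\<And>U v. basic_open U \<Longrightarrow> v \<in> E U \<Longrightarrow> \<exists>g\<in>G U. R U v g"
    and onto: "\<And>U g. basic_open U \<Longrightarrow> g \<in> G U \<Longrightarrow> \<exists>v\<in>E U. R U v g"
    and left: "\<And>U v. basic_open U \<Longrightarrow> v \<in> E U \<Longrightarrow> R U v 0 \<longleftrightarrow> v \<in> line_sub L E U"
    and right: "\<And>U g. basic_open U \<Longrightarrow> g \<in> G U \<Longrightarrow> R U 0 g \<longleftrightarrow> g \<in> line_sub L G U"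
  shows "line_iso L E G"
proof -
  let ?N = "\<lambda>U. line_sub L E U" and ?M = "\<lambda>U. line_sub L G U"
  note sE = sheaf_mod_submod[OF E] and sG = sheaf_mod_submod[OF G]
  note sN = submod_line_sub[of _ L E] and sM = submod_line_sub[of _ L G]
  note NE = line_sub_subset[OF E L] and MG = line_sub_subset[OF G L]
  define \<phi> where "\<phi> U C = {g \<in> G U. \<exists>v\<in>C. R U v g}" for U C
  have diff: "R U (v - v') (g - g')" if "R U v g" "R U v' g'" for U :: "'k point set" and v g v' g'
  proof -
    have "R U (v + (- 1) \<cdot> v') (g + (- 1) \<cdot> g')"
      using that by (intro add scale twist_uminus twist_one)
    moreover have "v + (- 1) \<cdot> v' = v - v'" "g + (- 1) \<cdot> g' = g - g'" by (auto simp: vscale_def)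
    ultimately show ?thesis by simp
  qed
  have key: "\<phi> U (v +o ?N U) = g +o ?M U" if U: "basic_open U" and v: "v \<in> E U" and g: "g \<in> G U" and R: "R U v g" for U :: "'k point set" and v g
  proof (intro subset_antisym subsetI)
    fix x assume "x \<in> \<phi> U (v +o ?N U)"
    then obtain n where n: "x \<in> G U" "n \<in> ?N U" "R U (v + n) x" by (auto simp: \<phi>_def elt_set_plus_def)
    have "R U n 0" using left[OF U, of n] n NE by blast
    from diff[OF diff[OF n(3) R] this] have "R U 0 (x - g)" by simp
    then have "x - g \<in> ?M U" using right[OF U, of "x - g"] submod_diff[OF sG n(1) g] by blast
    moreover have "x = g + (x - g)" by simp
    ultimately show "x \<in> g +o ?M U" unfolding elt_set_plus_def by blast
  next
    fix x assume "x \<in> g +o ?M U"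
    then obtain n where n: "n \<in> ?M U" "x = g + n" by (auto simp: elt_set_plus_def)
    have "R U 0 n" using right[OF U, of n] n MG by blast
    from add[OF R this] have "R U v x" using n by simp
    moreover have "x \<in> G U" using n g MG submod_add[OF sG] by blast
    moreover have "v \<in> v +o ?N U" using submod_zero[OF sN] by (force simp: elt_set_plus_def)
    ultimately show "x \<in> \<phi> U (v +o ?N U)" unfolding \<phi>_def by blast
  qed
  have elim: "\<exists>v g. v \<in> E U \<and> g \<in> G U \<and> R U v g \<and> C = v +o ?N U \<and> \<phi> U C = g +o ?M U"
    if "basic_open U" "C \<in> line_restr L E U" for U :: "'k point set" and C
    using that key total unfolding line_restr_def by blast
  show ?thesis
    unfolding line_iso_def
  proof (intro exI[of _ \<phi>] allI impI conjI ballI)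
    fix U :: "'k point set" assume U: "basic_open U"
    show "bij_betw (\<phi> U) (line_restr L E U) (line_restr L G U)"
      unfolding bij_betw_def
    proof (intro conjI inj_onI)
      fix C C' assume "C \<in> line_restr L E U" "C' \<in> line_restr L E U" and eq: "\<phi> U C = \<phi> U C'"
      then obtain v g v' g' where 1: "v \<in> E U" "g \<in> G U" "R U v g" "C = v +o ?N U" "\<phi> U C = g +o ?M U"
        "v' \<in> E U" "g' \<in> G U" "R U v' g'" "C' = v' +o ?N U" "\<phi> U C' = g' +o ?M U"
        using elim[OF U] by metis
      then have "g - g' \<in> ?M U" using eq coset_eq_iff[OF sM] by metis
      then have "R U 0 (g - g')" using right[OF U, of "g - g'"] MG by blast
      from diff[OF diff[OF 1(3,8)] this] have "R U (v - v') 0" by simp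
      then have "v - v' \<in> ?N U" using left[OF U, of "v - v'"] submod_diff[OF sE 1(1,6)] by blast
      then show "C = C'" using 1 coset_eq_iff[OF sN] by metis
    next
      show "\<phi> U ` line_restr L E U = line_restr L G U"
      proof (intro subset_antisym subsetI)
      fix D assume "D \<in> \<phi> U ` line_restr L E U"
      then obtain C where "C \<in> line_restr L E U" "D = \<phi> U C" by blast
      with elim[OF U] obtain g where "g \<in> G U" "D = g +o ?M U" by metis
      then show "D \<in> line_restr L G U" unfolding line_restr_def by blast
    next
      fix D assume "D \<in> line_restr L G U"
      then obtain g where g: "g \<in> G U" "D = g +o ?M U" by (auto simp: line_restr_def)
      from onto[OF U g(1)] obtain v where "v \<in> E U" "R U v g" by blast
      then have "\<phi> U (v +o ?N U) = D" using key[OF U] g by blast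
      then show "D \<in> \<phi> U ` line_restr L E U" using \<open>v \<in> E U\<close> by (auto simp: line_restr_def)
      qed
    qed
  next
    fix U :: "'k point set" and C C' assume U: "basic_open U" and "C \<in> line_restr L E U" "C' \<in> line_restr L E U"
    then obtain v g v' g' where 1: "v \<in> E U" "g \<in> G U" "R U v g" "C = v +o ?N U" "\<phi> U C = g +o ?M U"
      "v' \<in> E U" "g' \<in> G U" "R U v' g'" "C' = v' +o ?N U" "\<phi> U C' = g' +o ?M U"
      using elim[OF U] by metis
    have "\<phi> U ((v + v') +o ?N U) = (g + g') +o ?M U"
      using 1 by (intro key[OF U] submod_add[OF sE] submod_add[OF sG] add)
    then show "\<phi> U (C + C') = \<phi> U C + \<phi> U C'"
      using 1 coset_add[OF sN] coset_add[OF sM] by metis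
  next
    fix U :: "'k point set" and a C assume U: "basic_open U" and a: "a \<in> reg U" and "C \<in> line_restr L E U"
    then obtain v g where 1: "v \<in> E U" "g \<in> G U" "R U v g" "C = v +o ?N U" "\<phi> U C = g +o ?M U"
      using elim[OF U] by metis
    have "\<phi> U ((a \<cdot> v) +o ?N U) = (a \<cdot> g) +o ?M U"
      using 1 a by (intro key[OF U] submod_scale[OF sE] submod_scale[OF sG] scale)
    then show "\<phi> U ((\<cdot>) a ` C + ?N U) = (\<cdot>) a ` \<phi> U C + ?M U"
      using 1 coset_scale[OF sN a] coset_scale[OF sM a] by metis
  next
    fix U V :: "'k point set" and C assume U: "basic_open U" and V: "basic_open V \<and> V \<subseteq> U" and "C \<in> line_restr L E U"
    then obtain v g where 1: "v \<in> E U" "g \<in> G U" "R U v g" "C = v +o ?N U" "\<phi> U C = g +o ?M U"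
      using elim[OF U] by metis
    have "\<phi> V (v +o ?N V) = g +o ?M V"
      using 1 V by (intro key sheaf_mod_mono[OF E, of V U] sheaf_mod_mono[OF G, of V U] mono[of V U]) auto
    moreover have "C + ?N V = v +o ?N V"
      using 1 V line_sub_mono[OF E, of V U L] by (simp add: coset_extend[OF sN sN])
    moreover have "\<phi> U C + ?M V = g +o ?M V"
      using 1 V line_sub_mono[OF G, of V U L] by (simp add: coset_extend[OF sM sM])
    ultimately show "\<phi> V (C + ?N V) = \<phi> U C + ?M V" by simp
  qed
qed


section \<open>The derivation bundle on a line\<close>

definition gradf :: "'k::field mpoly3 \<Rightarrow> 3 \<Rightarrow> 'k ratfun" where
  "gradf f = (\<lambda>k. to_fract (pdiff k f))"

lemma derivation_bundle_iff:
  "s \<in> derivation_bundle f U \<longleftrightarrow> (\<forall>i. s i \<in> twist 0 U) \<and> dot s (gradf f) = 0"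
  by (simp add: derivation_bundle_def twist_sum_def dot_def gradf_def to_fract_def)

lemma dot_vscale: "dot (c \<cdot> v) w = c * dot v w"
  by (simp add: dot_def vscale_def sum_distrib_left mult.assoc)

lemma dot_add: "dot (v + w) u = dot v u + dot w u"
  by (simp add: dot_def distrib_right sum.distrib)

lemma sheaf_mod_derivation_bundle: "sheaf_mod (derivation_bundle f)"
  unfolding sheaf_mod_def submod_def
proof (intro conjI allI ballI impI subsetI)
  fix U V :: "'a point set" and v assume "V \<subseteq> U" "v \<in> derivation_bundle f U"
  then show "v \<in> derivation_bundle f V"
    using twist_mono unfolding derivation_bundle_iff by blast
qed (auto simp: derivation_bundle_iff dot_add dot_vscale, auto simp: dot_def vscale_def intro!: reg_mult)

lemma sheaf_mod_twist_sum: "sheaf_mod (twist_sum a :: ('k::field, 'i) sheaf)"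
  unfolding sheaf_mod_def submod_def
proof (intro conjI allI ballI impI subsetI)
  fix U V :: "'k point set" and v assume "V \<subseteq> U" "v \<in> twist_sum a U"
  then show "v \<in> twist_sum a V"
    using twist_mono unfolding twist_sum_def by blast
qed (auto simp: twist_sum_def vscale_def intro!: reg_mult)

lemma dot_twist:
  "(\<And>i. v i \<in> twist n U) \<Longrightarrow> (\<And>i. w i \<in> twist k U) \<Longrightarrow> n + k = s \<Longrightarrow> dot v w \<in> twist s U"
  unfolding dot_def by (intro twist_sum twist_mult')

lemma cross_twist:
  "(\<And>i. v i \<in> twist n U) \<Longrightarrow> (\<And>i. w i \<in> twist k U) \<Longrightarrow> n + k = s \<Longrightarrow> cross v w i \<in> twist s U"
  unfolding cross_def by (auto intro!: twist_diff twist_mult')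

lemma det3_twist:
  "(\<And>i. u i \<in> twist n U) \<Longrightarrow> (\<And>i. v i \<in> twist k U) \<Longrightarrow> (\<And>i. w i \<in> twist r U) \<Longrightarrow>
    n + k + r = s \<Longrightarrow> det3 u v w \<in> twist s U"
  unfolding det3_def by (intro dot_twist[where k = "k + r"] cross_twist) auto

lemma dot_lid:
  "(\<And>i. v i \<in> twist n U) \<Longrightarrow> (\<And>i. w i \<in> lid L k U) \<Longrightarrow> n + k = s \<Longrightarrow> dot v w \<in> lid L s U"
  unfolding dot_def by (intro lid_sum lid_mult(2)[where n = k and k = n]) auto

lemma cross_lid:
  "(\<And>i. v i \<in> lid L n U) \<Longrightarrow> (\<And>i. w i \<in> twist k U) \<Longrightarrow> n + k = s \<Longrightarrow> cross v w i \<in> lid L s U"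
  unfolding cross_def by (auto intro!: lid_diff lid_mult(1)[where n = n and k = k])

text \<open>The quotient of \<open>v\<close> by \<open>L\<close> satisfies the same linear equation,
  so it is a section of the bundle twisted by -1.\<close>

lemma derivation_line_subI:
  assumes U: "basic_open U" and "L \<noteq> 0" and v: "v \<in> derivation_bundle f U"
    and lid: "\<And>i. v i \<in> lid L 0 U"
  shows "v \<in> line_sub L (derivation_bundle f) U"
proof -
  from lid have "\<forall>i. \<exists>q\<in>twist (- 1) U. v i = to_fract L * q" by (auto simp: lid_def)
  then obtain q where q: "\<And>i. q i \<in> twist (- 1) U" "\<And>i. v i = to_fract L * q i" by metis
  have "to_fract L * dot q (gradf f) = dot v (gradf f)" by (simp add: dot_def q(2) sum_distrib_left mult.assoc)
  then have "dot q (gradf f) = 0" using v \<open>L \<noteq> 0\<close> by (simp add: derivation_bundle_iff)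
  then have "dot (to_fract (mvar k) \<cdot> q) (gradf f) = 0" for k by (simp add: dot_vscale)
  moreover have "(to_fract (mvar k) \<cdot> q) i \<in> twist 0 U" for k i
    unfolding vscale_def using q(1)[of i] by (intro twist_mult'[OF twist_to_fract[OF hom_part_mvar]]) auto
  ultimately have "to_fract (mvar k) \<cdot> q \<in> derivation_bundle f U" for k
    by (simp add: derivation_bundle_iff)
  moreover have "v = to_fract L \<cdot> q" using q(2) by (auto simp: vscale_def)
  ultimately show ?thesis by (rule line_subI[OF U])
qed

text \<open>On the line \<open>\<omega>\<close> and \<open>\<tau>\<close> are syzygies whose cross
  product is the gradient, and by \<open>unit\<close> the gradient has no zero there; so they form a
  basis of the kernel. The relation \<open>R\<close> says that \<open>v\<close> is their combination
  with coefficients \<open>g\<close> modulo \<open>L\<close>.\<close>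

lemma derivation_line_iso:
  fixes f L :: "'k::field mpoly3"
  assumes L: "L \<in> hom_part 1" "L \<noteq> 0"
    and F: "\<And>k. pdiff k f \<in> hom_part N"
    and \<omega>: "\<And>k. \<omega> k \<in> hom_part a" and \<tau>: "\<And>k. \<tau> k \<in> hom_part b" and ab: "a + b = N"
    and \<omega>F: "\<exists>q\<in>hom_part (a + N - 1). dot \<omega> (\<lambda>k. pdiff k f) = L * q"
    and \<tau>F: "\<exists>q\<in>hom_part (b + N - 1). dot \<tau> (\<lambda>k. pdiff k f) = L * q"
    and \<tau>\<omega>: "\<And>k. \<exists>q\<in>hom_part (N - 1). cross \<tau> \<omega> k - pdiff k f = L * q"
    and unit: "\<And>U. basic_open U \<Longrightarrow> \<exists>A. (\<forall>k. A k \<in> twist (- N) U) \<and> dot A (gradf f) - 1 \<in> lid L 0 U"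
  shows "line_iso L (derivation_bundle f) (twist_sum (\<lambda>i::bool. if i then - b else - a))"
proof -
  define w where "w = (\<lambda>k. to_fract (\<omega> k))"
  define t where "t = (\<lambda>k. to_fract (\<tau> k))"
  let ?F = "gradf f" and ?E = "derivation_bundle f" and ?G = "twist_sum (\<lambda>i::bool. if i then - b else - a) :: ('k, bool) sheaf"
  have F': "?F k \<in> twist N U" for k U by (simp add: gradf_def twist_to_fract F)
  have w: "w k \<in> twist a U" for k U by (simp add: w_def twist_to_fract \<omega>)
  have t: "t k \<in> twist b U" for k U by (simp add: t_def twist_to_fract \<tau>)
  have tf_dot: "dot (\<lambda>k. to_fract (p k)) ?F = to_fract (dot p (\<lambda>k. pdiff k f))" for p
    by (simp add: dot_def gradf_def to_fract_sum)
  have tf_cross: "cross t w k = to_fract (cross \<tau> \<omega> k)" for k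
    by (simp add: cross_def t_def w_def)
  have wF: "dot w ?F \<in> lid L (a + N) U" for U
    unfolding w_def tf_dot using \<omega>F by (blast intro: lid_to_fract)
  have tF: "dot t ?F \<in> lid L (b + N) U" for U
    unfolding t_def tf_dot using \<tau>F by (blast intro: lid_to_fract)
  have tw: "(cross t w - ?F) k \<in> lid L N U" for k U
  proof -
    have "to_fract (cross \<tau> \<omega> k - pdiff k f) \<in> lid L N U"
      using \<tau>\<omega>[of k] lid_to_fract by blast
    then show ?thesis by (simp add: tf_cross gradf_def)
  qed
  define R where "R U v g \<longleftrightarrow> (\<forall>i. v i - (g False * w i + g True * t i) \<in> lid L 0 U)" for U v and g :: "bool \<Rightarrow> 'k ratfun"
  have E_twist: "v i \<in> twist 0 U" if "v \<in> ?E U" for v i U using that by (simp add: derivation_bundle_iff)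
  have G_twist: "g False \<in> twist (- a) U" "g True \<in> twist (- b) U" if "g \<in> ?G U" for g U
    using that by (auto simp: twist_sum_def dest: spec[of _ True] spec[of _ False])
  have G_lid: "g i \<in> lid L (if i then - b else - a) U" if "g \<in> line_sub L ?G U" for g i U
    using that by (rule line_sub_lid) (auto simp: twist_sum_def)
  have E_lid: "v i \<in> lid L 0 U" if "v \<in> line_sub L ?E U" for v i U
    using that by (rule line_sub_lid) (auto simp: derivation_bundle_iff)
  have unit': "\<exists>A. (\<forall>k. A k \<in> twist (- N) U) \<and> dot A ?F - 1 \<in> lid L 0 U \<and> det3 A t w - 1 \<in> lid L 0 U"
    if U: "basic_open U" for U
  proof -
    from unit[OF U] obtain A where A: "\<And>k. A k \<in> twist (- N) U" "dot A ?F - 1 \<in> lid L 0 U" by blast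
    have "det3 A t w - 1 = dot A (cross t w - ?F) + (dot A ?F - 1)"
      by (simp add: det3_def dot_def algebra_simps sum_subtractf)
    moreover have "dot A (cross t w - ?F) \<in> lid L 0 U"
      using A(1) tw by (intro dot_lid[where n = "- N" and k = N]) auto
    ultimately have "det3 A t w - 1 \<in> lid L 0 U" using A(2) by (simp only: lid_add)
    with A show ?thesis by blast
  qed
  show ?thesis
  proof (rule line_isoI[where R = R, OF L(1) sheaf_mod_derivation_bundle sheaf_mod_twist_sum])
    fix U v g v' g' assume "R U v g" "R U v' g'"
    then have "(v i - (g False * w i + g True * t i)) + (v' i - (g' False * w i + g' True * t i)) \<in> lid L 0 U" for i
      unfolding R_def by (intro lid_add) auto
    then show "R U (v + v') (g + g')" unfolding R_def by (simp add: algebra_simps)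
  next
    fix U v g and c :: "'k ratfun" assume "R U v g" "c \<in> reg U"
    then have "c * (v i - (g False * w i + g True * t i)) \<in> lid L 0 U" for i
      unfolding R_def by (intro lid_mult(2)[where n = 0 and k = 0]) auto
    then show "R U (c \<cdot> v) (c \<cdot> g)" unfolding R_def by (simp add: vscale_def algebra_simps)
  next
    fix U V :: "'k point set" and v g assume "V \<subseteq> U" "R U v g"
    then show "R V v g" unfolding R_def using lid_mono by blast
  next
    fix U v assume U: "basic_open U" and v: "v \<in> ?E U"
    from unit'[OF U] obtain A where A: "\<And>k. A k \<in> twist (- N) U" "det3 A t w - 1 \<in> lid L 0 U" by blast
    \<comment> \<open>Cramer's rule modulo \<open>L\<close>: \<open>det3 A t w\<close> is 1 and
      \<open>det3 v t w\<close> is the product of \<open>v\<close> with the gradient, hence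
      0.\<close>
    define g where "g = (\<lambda>i. if i then det3 A v w else - det3 A v t)"
    have "det3 A v w \<in> twist (- b) U"
      using ab by (intro det3_twist[OF A(1) E_twist[OF v] w]) simp
    moreover have "det3 A v t \<in> twist (- a) U"
      using ab by (intro det3_twist[OF A(1) E_twist[OF v] t]) simp
    ultimately have "g \<in> ?G U" by (auto simp: twist_sum_def g_def)
    moreover have "R U v g"
      unfolding R_def
    proof
      fix i
      have "det3 v t w = dot v (cross t w - ?F)"
        using v by (simp add: det3_def derivation_bundle_iff dot_def algebra_simps sum_subtractf)
      also have "\<dots> \<in> lid L N U" using E_twist[OF v] tw by (intro dot_lid[where n = 0 and k = N]) auto
      finally have "A i * det3 v t w \<in> lid L 0 U" using A(1) by (intro lid_mult(2)[where k = "- N"]) auto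
      moreover have "v i * (det3 A t w - 1) \<in> lid L 0 U"
        using A(2) E_twist[OF v] by (intro lid_mult(2)[where n = 0 and k = 0]) auto
      moreover have "v i - (g False * w i + g True * t i) = A i * det3 v t w - v i * (det3 A t w - 1)"
        using det3_relation[of v i A t w] by (simp add: g_def algebra_simps)
      ultimately show "v i - (g False * w i + g True * t i) \<in> lid L 0 U" by (simp add: lid_diff)
    qed
    ultimately show "\<exists>g\<in>?G U. R U v g" by blast
  next
    fix U g assume U: "basic_open U" and g: "g \<in> ?G U"
    from unit'[OF U] obtain A where A: "\<And>k. A k \<in> twist (- N) U" "dot A ?F - 1 \<in> lid L 0 U" by blast
    define s where "s = (\<lambda>i. g False * w i + g True * t i)"
    have s: "s i \<in> twist 0 U" for i
      unfolding s_def using G_twist[OF g] w t by (intro twist_add twist_mult'[of _ "- a"] twist_mult'[of _ "- b"]) auto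
    have AF: "dot A ?F \<in> twist 0 U" by (rule dot_twist[OF A(1) F']) simp
    have "dot s ?F = g False * dot w ?F + g True * dot t ?F"
      by (simp add: s_def dot_def algebra_simps sum.distrib sum_distrib_left)
    also have "\<dots> \<in> lid L N U"
      using G_twist[OF g] wF tF by (intro lid_add lid_mult(2)[where n = "a + N" and k = "- a"] lid_mult(2)[where n = "b + N" and k = "- b"]) auto
    finally have sF: "dot s ?F \<in> lid L N U" .
    \<comment> \<open>A combination of \<open>w\<close> and \<open>t\<close> is a syzygy only on the
      line. Scaling by \<open>dot A ?F\<close>, which is 1 modulo \<open>L\<close>, and subtracting
      a multiple of \<open>A\<close> that is 0 modulo \<open>L\<close> make it an exact one.\<close>
    define v where "v = (\<lambda>i. dot A ?F * s i - dot s ?F * A i)"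
    have "dot s ?F * A i \<in> lid L 0 U" for i
      using sF A(1) by (intro lid_mult(1)[where k = "- N"]) auto
    then have "v i \<in> twist 0 U" for i
      unfolding v_def using lid_twist[OF L(1)] by (intro twist_diff reg_mult[OF AF s]) blast
    moreover have "dot v ?F = 0"
      by (simp add: v_def dot_def sum_subtractf left_diff_distrib mult.assoc flip: sum_distrib_left)
    ultimately have "v \<in> ?E U" by (simp add: derivation_bundle_iff)
    moreover have "R U v g"
      unfolding R_def
    proof
      fix i
      have "v i - s i = (dot A ?F - 1) * s i - dot s ?F * A i" by (simp add: v_def algebra_simps)
      also have "\<dots> \<in> lid L 0 U"
        by (rule lid_diff[OF lid_mult(1)[OF A(2) s] lid_mult(1)[OF sF A(1)]]) auto
      finally show "v i - (g False * w i + g True * t i) \<in> lid L 0 U" by (simp add: s_def)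
    qed
    ultimately show "\<exists>v\<in>?E U. R U v g" by blast
  next
    fix U v assume U: "basic_open U" and v: "v \<in> ?E U"
    show "R U v 0 \<longleftrightarrow> v \<in> line_sub L ?E U"
    proof
      assume "R U v 0"
      then show "v \<in> line_sub L ?E U"
        unfolding R_def using U v L by (intro derivation_line_subI) auto
    next
      assume "v \<in> line_sub L ?E U"
      then show "R U v 0" unfolding R_def using E_lid by simp
    qed
  next
    fix U g assume U: "basic_open U" and g: "g \<in> ?G U"
    show "R U 0 g \<longleftrightarrow> g \<in> line_sub L ?G U"
    proof
      assume "R U 0 g"
      define s where "s = (\<lambda>i. g False * w i + g True * t i)"
      have s: "s i \<in> lid L 0 U" for i
        using \<open>R U 0 g\<close> lid_uminus[of "0 - s i" L 0 U] unfolding R_def s_def by (simp add: add.commute)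
      from unit'[OF U] obtain A where A: "\<And>k. A k \<in> twist (- N) U" "det3 A t w - 1 \<in> lid L 0 U" by blast
      have "det3 A s w = g True * det3 A t w" "det3 A s t = - (g False * det3 A t w)"
        by (simp_all add: s_def vec3_defs algebra_simps)
      then have 1: "g True = det3 A s w - g True * (det3 A t w - 1)"
        and 2: "g False = - det3 A s t - g False * (det3 A t w - 1)"
        by (simp_all add: algebra_simps)
      have "det3 A s w \<in> lid L (- b) U"
        unfolding det3_def using ab by (intro dot_lid[OF A(1) cross_lid[OF s w refl]]) simp
      have "det3 A s t \<in> lid L (- a) U"
        unfolding det3_def using ab by (intro dot_lid[OF A(1) cross_lid[OF s t refl]]) simp
      have "g True \<in> lid L (- b) U"
        by (subst 1, rule lid_diff[OF \<open>det3 A s w \<in> lid L (- b) U\<close> lid_mult(2)[OF A(2) G_twist(2)[OF g]]]) simp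
      moreover have "g False \<in> lid L (- a) U"
        by (subst 2, rule lid_diff[OF lid_uminus[OF \<open>det3 A s t \<in> lid L (- a) U\<close>] lid_mult(2)[OF A(2) G_twist(1)[OF g]]]) simp
      ultimately have "g i \<in> lid L (if i then - b else - a) U" for i by simp
      then have "\<forall>i. \<exists>q\<in>twist ((if i then - b else - a) - 1) U. g i = to_fract L * q"
        unfolding lid_def by blast
      then obtain q where q: "\<And>i. q i \<in> twist ((if i then - b else - a) - 1) U" "\<And>i. g i = to_fract L * q i" by metis
      have "to_fract (mvar k) * q i \<in> twist (if i then - b else - a) U" for k i
        using q(1)[of i] by (intro twist_mult'[OF twist_to_fract[OF hom_part_mvar]]) auto
      then have "to_fract (mvar k) \<cdot> q \<in> ?G U" for k
        by (simp add: twist_sum_def vscale_def)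
      moreover have "g = to_fract L \<cdot> q" using q(2) by (auto simp: vscale_def)
      ultimately show "g \<in> line_sub L ?G U" by (rule line_subI[OF U])
    next
      assume *: "g \<in> line_sub L ?G U"
      have "g False * w i + g True * t i \<in> lid L 0 U" for i
        using G_lid[OF *, of False] G_lid[OF *, of True] w t
        by (intro lid_add lid_mult(1)[where n = "- a" and k = a] lid_mult(1)[where n = "- b" and k = b]) auto
      from lid_uminus[OF this] show "R U 0 g" unfolding R_def by simp
    qed
  qed
qed

section \<open>Splitting on a line of a given arrangement\<close>

context arr_line
begin

lemma gradf_arr_hom: "pdiff k (arr m l) \<in> hom_part (int (2 * d))"
proof -
  have "int m - 1 = int (2 * d)" using m by simp
  with pdiff_arr_hom_part[of k m l] show ?thesis by (simp only:)
qed

lemma res_dot: "res \<kappa> u v (dot p q) = dot (\<lambda>i. res \<kappa> u v (p i)) (\<lambda>i. res \<kappa> u v (q i))"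
  by (simp add: dot_def res_simps)

lemma res_cross: "res \<kappa> u v (cross p q k) = cross (\<lambda>i. res \<kappa> u v (p i)) (\<lambda>i. res \<kappa> u v (q i)) k"
  by (simp add: cross_def res_simps)

lemma dot_hom_part:
  "(\<And>i. p i \<in> hom_part n) \<Longrightarrow> (\<And>i. q i \<in> hom_part k) \<Longrightarrow> dot p q \<in> hom_part (n + k)"
  unfolding dot_def by (intro hom_part_sum hom_part_mult)

lemma cross_hom_part:
  "(\<And>i. p i \<in> hom_part n) \<Longrightarrow> (\<And>i. q i \<in> hom_part k) \<Longrightarrow> cross p q j \<in> hom_part (n + k)"
  unfolding cross_def by (auto intro!: hom_part_diff hom_part_mult)

lemma L_hom: "L c \<in> hom_part 1"
  by (rule lform_hom_part)

lemma L_neq_0: "c \<noteq> 0 \<Longrightarrow> L c \<noteq> 0"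
  unfolding lform_eq_0_iff by (auto simp: ldual_def fun_eq_iff intro!: exI[of _ 2])

text \<open>The gradient has no zero on the line, so Bezout coefficients of bounded degree represent
  a power of \<open>h\<close> there. Homogenising them and dividing by this power gives sections of
  degree -2 d.\<close>

lemma ex_unit:
  assumes c: "c \<noteq> 0" and U: "basic_open U"
  shows "\<exists>A. (\<forall>k. A k \<in> twist (- int (2 * d)) U) \<and> dot A (gradf (arr m l)) - 1 \<in> lid (L c) 0 U"
proof -
  from U obtain h n where h: "n > 0" "h \<in> hom_part n" "h \<noteq> 0" "U = {p. p \<noteq> 0 \<and> eval h p \<noteq> 0}"
    unfolding basic_open_def by blast
  \<comment> \<open>The power of \<open>h\<close> is taken high enough for
    \<open>bezout_bounded\<close>, which asks for at least twice the degree 2 d of the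
    gradient.\<close>
  define N where "N = (4 * d + 1) * nat n"
  define H where "H = h ^ (4 * d + 1)"
  have N: "int N = int (4 * d + 1) * n" using h(1) by (simp add: N_def algebra_simps)
  have H: "H \<in> hom_part (int N)" unfolding H_def N by (rule hom_part_power[OF h(2)])
  have "nat n \<ge> 1" using h(1) by simp
  then have N2: "2 * (2 * d) \<le> N" unfolding N_def by (cases "nat n") auto
  obtain j where j: "poly.coeff (g j) (2 * d) \<noteq> 0" using g_top by blast
  obtain \<gamma> where \<gamma>: "\<And>i. Polynomial.degree (\<gamma> i) \<le> N - 2 * d" "dot \<gamma> g = res \<kappa> u v H"
    using bezout_bounded[OF g_nowhere_zero degree_g j N2 degree_res[OF H]] by blast
  define \<alpha>' where "\<alpha>' = (\<lambda>i. lift \<kappa> (N - 2 * d) (\<gamma> i))"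
  let ?F = "\<lambda>k. pdiff k (arr m l)"
  have \<alpha>': "\<alpha>' i \<in> hom_part (int N + - int (2 * d))" for i
  proof -
    have "int N + - int (2 * d) = int (N - 2 * d)" using N2 by simp
    then show ?thesis unfolding \<alpha>'_def by (simp only: lift_hom_part)
  qed
  have "dot \<alpha>' ?F \<in> hom_part (int N + - int (2 * d) + int (2 * d))"
    by (intro dot_hom_part \<alpha>' gradf_arr_hom)
  then have hom: "dot \<alpha>' ?F - H \<in> hom_part (int N)" using H by (auto intro: hom_part_diff)
  have "res \<kappa> u v (dot \<alpha>' ?F - H) = dot \<gamma> g - res \<kappa> u v H"
    using \<gamma>(1) by (simp add: res_simps res_dot \<alpha>'_def res_lift flip: g_def)
  then have "res \<kappa> u v (dot \<alpha>' ?F - H) = 0" using \<gamma>(2) by simp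
  from res_eq_0_imp_dvd[OF hom this c] obtain q where q: "q \<in> hom_part (int N - 1)" "dot \<alpha>' ?F - H = L c * q" by blast
  have evH: "eval H p \<noteq> 0" if "p \<in> U" for p using that h(4) by (simp add: H_def eval_simps)
  have H0: "H \<noteq> 0" using h(3) by (simp add: H_def)
  have "to_fract (\<alpha>' k) / to_fract H \<in> twist (- int (2 * d)) U" for k
    by (rule twist_divide[OF \<alpha>' H evH])
  moreover have "dot (\<lambda>k. to_fract (\<alpha>' k) / to_fract H) (gradf (arr m l)) - 1 \<in> lid (L c) 0 U"
    unfolding lid_def
  proof (rule image_eqI)
    have "dot (\<lambda>k. to_fract (\<alpha>' k) / to_fract H) (gradf (arr m l)) - 1 = to_fract (dot \<alpha>' ?F - H) / to_fract H"
      using H0 by (simp add: dot_def gradf_def to_fract_sum sum_divide_distrib diff_divide_distrib)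
    also have "\<dots> = to_fract (L c) * (to_fract q / to_fract H)"
      by (simp only: q(2) to_fract_mult times_divide_eq_right)
    finally show "dot (\<lambda>k. to_fract (\<alpha>' k) / to_fract H) (gradf (arr m l)) - 1 = to_fract (L c) * (to_fract q / to_fract H)" .
    show "to_fract q / to_fract H \<in> twist (0 - 1) U"
      using q(1) H evH by (intro twist_divide[of _ "int N"]) auto
  qed
  ultimately show ?thesis
    by (intro exI[of _ "\<lambda>k. to_fract (\<alpha>' k) / to_fract H"] conjI allI)
qed

text \<open>Since \<open>\<omega>\<close> has no zero, even at infinity,
  \<open>cross_divisor\<close> supplies a second syzygy of complementary degree whose cross product
  with \<open>\<omega>\<close> is \<open>g\<close>. Lifted to the plane, these identities hold
  modulo \<open>L c\<close>.\<close>

lemma line_iso_of_primitive_syz: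
  assumes c: "c \<noteq> 0" and a: "a \<le> d" and "syz \<omega>" and deg: "\<And>j. Polynomial.degree (\<omega> j) \<le> a"
    and nz: "\<And>t. \<exists>j. poly (\<omega> j) t \<noteq> 0" and top: "\<exists>j. poly.coeff (\<omega> j) a \<noteq> 0"
  shows "line_iso (L c) (derivation_bundle (arr m l))
    (twist_sum (\<lambda>i::bool. if i then - int (2 * d - a) else - int a))"
proof -
  obtain j where j: "poly.coeff (\<omega> j) a \<noteq> 0" using top by blast
  have "dot g \<omega> = 0" using assms(3) by (simp add: syz_def dot_commute)
  from cross_divisor[OF nz deg j this degree_g] a
  obtain \<tau> where \<tau>: "\<And>i. Polynomial.degree (\<tau> i) \<le> 2 * d - a" "cross \<tau> \<omega> = g" by auto
  define \<Omega> where "\<Omega> = (\<lambda>i. lift \<kappa> a (\<omega> i))"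
  define T where "T = (\<lambda>i. lift \<kappa> (2 * d - a) (\<tau> i))"
  let ?F = "\<lambda>k. pdiff k (arr m l)"
  have \<Omega>: "\<Omega> i \<in> hom_part (int a)" "res \<kappa> u v (\<Omega> i) = \<omega> i" for i
    using deg by (simp_all add: \<Omega>_def res_lift)
  have T: "T i \<in> hom_part (int (2 * d - a))" "res \<kappa> u v (T i) = \<tau> i" for i
    using \<tau>(1) by (simp_all add: T_def res_lift)
  have ab: "int a + int (2 * d - a) = int (2 * d)" using a by simp
  show ?thesis
  proof (rule derivation_line_iso[OF L_hom L_neq_0[OF c] gradf_arr_hom \<Omega>(1) T(1) ab])
    have "dot \<Omega> ?F \<in> hom_part (int a + int (2 * d))" by (intro dot_hom_part \<Omega> gradf_arr_hom)
    moreover have "res \<kappa> u v (dot \<Omega> ?F) = 0"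
      using assms(3) by (simp add: res_dot \<Omega> syz_def flip: g_def)
    ultimately show "\<exists>q\<in>hom_part (int a + int (2 * d) - 1). dot \<Omega> ?F = L c * q"
      using res_eq_0_imp_dvd c by blast
  next
    have "dot T ?F \<in> hom_part (int (2 * d - a) + int (2 * d))" by (intro dot_hom_part T gradf_arr_hom)
    moreover have "res \<kappa> u v (dot T ?F) = dot \<tau> (cross \<tau> \<omega>)"
      unfolding \<tau>(2) by (simp add: res_dot T flip: g_def)
    ultimately show "\<exists>q\<in>hom_part (int (2 * d - a) + int (2 * d) - 1). dot T ?F = L c * q"
      using res_eq_0_imp_dvd c by simp
  next
    fix k
    have "cross T \<Omega> k \<in> hom_part (int (2 * d))"
      using cross_hom_part[OF T(1) \<Omega>(1), where j = k] ab by (simp only: add.commute[of "int (2 * d - a)"])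
    then have "cross T \<Omega> k - pdiff k (arr m l) \<in> hom_part (int (2 * d))"
      using gradf_arr_hom by (intro hom_part_diff)
    moreover have "res \<kappa> u v (cross T \<Omega> k - pdiff k (arr m l)) = 0"
      using \<tau>(2) by (simp add: res_simps res_cross T \<Omega> flip: g_def)
    ultimately show "\<exists>q\<in>hom_part (int (2 * d) - 1). cross T \<Omega> k - pdiff k (arr m l) = L c * q"
      using res_eq_0_imp_dvd c by blast
  next
    fix U :: "'k point set" assume "basic_open U"
    then show "\<exists>A. (\<forall>k. A k \<in> twist (- int (2 * d)) U) \<and> dot A (gradf (arr m l)) - 1 \<in> lid (L c) 0 U"
      by (rule ex_unit[OF c])
  qed
qed

text \<open>A common zero at a finite parameter could be divided out, and a common zero at infinity
  means that the degree bound is not attained; either contradicts minimality.\<close>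

lemma minimal_syz_primitive:
  assumes syz: "syz \<omega>" "\<omega> \<noteq> 0" and deg: "\<And>j. Polynomial.degree (\<omega> j) \<le> a"
    and min: "\<And>\<theta>. syz \<theta> \<Longrightarrow> \<theta> \<noteq> 0 \<Longrightarrow> \<not> (\<forall>j. Polynomial.degree (\<theta> j) < a)"
  shows "\<exists>j. poly (\<omega> j) t \<noteq> 0" "\<exists>j. poly.coeff (\<omega> j) a \<noteq> 0"
proof -
  show "\<exists>j. poly.coeff (\<omega> j) a \<noteq> 0"
  proof (rule ccontr)
    assume *: "\<not> ?thesis"
    show False
    proof (cases "a = 0")
      case True
      then have "\<omega> j = 0" for j
        using * deg[of j] by (metis degree_eq_zeroE coeff_pCons_0 le_zero_eq pCons_0_0)
      with syz(2) show False by (auto simp: fun_eq_iff)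
    next
      case False
      have "Polynomial.degree (\<omega> j) < a" for j
        using * deg[of j] False by (metis degree_0 le_neq_implies_less leading_coeff_0_iff not_gr_zero)
      with min[OF syz] show False by blast
    qed
  qed
  show "\<exists>j. poly (\<omega> j) t \<noteq> 0"
  proof (rule ccontr)
    assume "\<not> ?thesis"
    then have "\<forall>j. \<exists>q. \<omega> j = [:- t, 1:] * q" by (simp add: poly_eq_0_iff_dvd dvd_def)
    then obtain q where q: "\<And>j. \<omega> j = [:- t, 1:] * q j" by metis
    have "[:- t, 1:] * dot q g = dot \<omega> g" unfolding dot_def q sum_distrib_left by (simp only: mult.assoc)
    then have "[:- t, 1:] * dot q g = 0" using syz(1) by (simp only: syz_def)
    then have "syz q" unfolding syz_def by (simp only: mult_eq_0_iff) simp
    moreover have "q \<noteq> 0"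
    proof
      assume "q = 0"
      then have "\<omega> = 0" using q by (auto simp: fun_eq_iff)
      with syz(2) show False by simp
    qed
    moreover have "Polynomial.degree (q j) < a" for j
    proof (cases "q j = 0")
      case True
      obtain i where "q i \<noteq> 0" using \<open>q \<noteq> 0\<close> by (auto simp: fun_eq_iff)
      then have "Polynomial.degree (\<omega> i) \<ge> 1" unfolding q by (subst degree_mult_eq) auto
      with deg[of i] True show ?thesis by simp
    next
      case False
      then have "Polynomial.degree (\<omega> j) = 1 + Polynomial.degree (q j)" unfolding q by (subst degree_mult_eq) auto
      with deg[of j] show ?thesis by simp
    qed
    ultimately show False using min by blast
  qed
qed

subsection \<open>Syzygies from a splitting\<close>

text \<open>A rational function without poles is a polynomial: the roots of \<open>q\<close> are
  removed one by one, each being a root of \<open>p\<close> as well.\<close>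

lemma dvd_of_local_quotients:
  fixes p q :: "'k poly"
  assumes "q \<noteq> 0" "\<And>t. \<exists>p' q'. poly q' t \<noteq> 0 \<and> p * q' = p' * q"
  shows "q dvd p"
  using assms
proof (induction "Polynomial.degree q" arbitrary: p q)
  case 0
  then have "is_unit q" by (simp add: is_unit_iff_degree)
  then show ?case by (rule unit_imp_dvd)
next
  case (Suc n)
  then obtain t where "poly q t = 0" using alg_closed_imp_poly_has_root[of q] by auto
  then obtain q1 where q1: "q = [:- t, 1:] * q1" by (auto simp: poly_eq_0_iff_dvd dvd_def)
  from Suc.prems(2)[of t] obtain p' q' where "poly q' t \<noteq> 0" "p * q' = p' * q" by blast
  then have "poly p t * poly q' t = 0" using \<open>poly q t = 0\<close> by (metis mult_zero_right poly_mult)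
  then have "poly p t = 0" using \<open>poly q' t \<noteq> 0\<close> by simp
  then obtain p1 where p1: "p = [:- t, 1:] * p1" by (auto simp: poly_eq_0_iff_dvd dvd_def)
  have "q1 \<noteq> 0" using q1 Suc.prems by auto
  have "Polynomial.degree q = Suc (Polynomial.degree q1)"
    unfolding q1 using \<open>q1 \<noteq> 0\<close> by (subst degree_mult_eq) auto
  then have "n = Polynomial.degree q1" using Suc.hyps by simp
  moreover have "\<exists>p' q'. poly q' s \<noteq> 0 \<and> p1 * q' = p' * q1" for s
  proof -
    from Suc.prems(2)[of s] obtain p' q' where *: "poly q' s \<noteq> 0" "p * q' = p' * q" by blast
    then have "[:- t, 1:] * (p1 * q') = [:- t, 1:] * (p' * q1)"
      unfolding p1 q1 by (simp only: mult_ac)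
    then have "p1 * q' = p' * q1" by (simp only: mult_cancel_left) simp
    with * show ?thesis by blast
  qed
  ultimately have "q1 dvd p1" using Suc.hyps(1) \<open>q1 \<noteq> 0\<close> by blast
  then show ?case unfolding p1 q1 by (rule mult_dvd_mono[OF dvd_refl])
qed

abbreviation "pt t \<equiv> (\<lambda>i. poly (E i) t)"

lemma pt_neq_0: "pt t \<noteq> 0"
proof
  assume "pt t = 0"
  from fun_cong[OF this, of 1] fun_cong[OF this, of 0] show False by (simp add: lpt_def)
qed

text \<open>All finite points of the line lie in \<open>U\<close>, so the restriction of
  \<open>q\<close> is a rational function of the parameter without poles, hence a polynomial. It is
  the same for all representations whose denominator does not vanish identically on the
  line.\<close>

lemma local_polynomial:
  assumes "q \<in> twist n U" "\<And>t. pt t \<in> U"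
  shows "\<exists>\<rho>. \<forall>g h. q = to_fract g / to_fract h \<and> res \<kappa> u v h \<noteq> 0 \<longrightarrow> res \<kappa> u v g = \<rho> * res \<kappa> u v h"
proof -
  have cross_mult: "res \<kappa> u v g * res \<kappa> u v h' = res \<kappa> u v g' * res \<kappa> u v h"
    if "q = to_fract g / to_fract h" "q = to_fract g' / to_fract h'" "res \<kappa> u v h \<noteq> 0" "res \<kappa> u v h' \<noteq> 0" for g h g' h'
  proof -
    have "h \<noteq> 0" "h' \<noteq> 0" using that by (auto simp: res_simps)
    then have "to_fract (g * h') = to_fract (g' * h)"
      using that(1,2) by (simp add: frac_eq_eq)
    then have "g * h' = g' * h" by (simp only: to_fract_eq_iff)
    then show ?thesis by (metis res_simps(2))
  qed
  have loc: "\<exists>g h. q = to_fract g / to_fract h \<and> poly (res \<kappa> u v h) t \<noteq> 0" for t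
    using twistE[OF assms(1) assms(2)[of t]] poly_res[of \<kappa> u v _ t] by metis
  then obtain g0 h0 where 0: "q = to_fract g0 / to_fract h0" "res \<kappa> u v h0 \<noteq> 0"
    by (metis poly_0)
  have "res \<kappa> u v h0 dvd res \<kappa> u v g0"
  proof (rule dvd_of_local_quotients[OF 0(2)])
    fix t
    from loc[of t] obtain g' h' where "q = to_fract g' / to_fract h'" "poly (res \<kappa> u v h') t \<noteq> 0" by blast
    moreover from this have "res \<kappa> u v h' \<noteq> 0" by auto
    ultimately show "\<exists>p' q'. poly q' t \<noteq> 0 \<and> res \<kappa> u v g0 * q' = p' * res \<kappa> u v h0"
      using cross_mult[OF 0(1) _ 0(2)] by blast
  qed
  then obtain \<rho> where \<rho>: "res \<kappa> u v g0 = \<rho> * res \<kappa> u v h0" by (metis dvd_def mult.commute)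
  have "res \<kappa> u v g' = \<rho> * res \<kappa> u v h'" if "q = to_fract g' / to_fract h'" "res \<kappa> u v h' \<noteq> 0" for g' h'
  proof -
    have "\<rho> * res \<kappa> u v h0 * res \<kappa> u v h' = res \<kappa> u v g' * res \<kappa> u v h0"
      using cross_mult[OF 0(1) that(1) 0(2) that(2)] \<rho> by simp
    then have "res \<kappa> u v h0 * (\<rho> * res \<kappa> u v h') = res \<kappa> u v h0 * res \<kappa> u v g'" by (simp only: mult_ac)
    then show ?thesis using 0(2) by (simp only: mult_cancel_left) simp
  qed
  then show ?thesis by blast
qed

lemma lid_of_res_eq_0:
  assumes c: "c \<noteq> 0" and q: "q \<in> twist n U"
    and 0: "\<And>g h. q = to_fract g / to_fract h \<Longrightarrow> res \<kappa> u v h \<noteq> 0 \<Longrightarrow> res \<kappa> u v g = 0"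
  shows "q \<in> lid (L c) n U"
proof -
  have L0: "to_fract (L c) \<noteq> 0" using L_neq_0[OF c] by simp
  have "q / to_fract (L c) \<in> twist (n - 1) U"
  proof (rule twistI)
    fix p assume "p \<in> U"
    from q this obtain g h t where gh: "g \<in> hom_part (t + n)" "h \<in> hom_part t" "eval h p \<noteq> 0" "h \<noteq> 0"
      "q = to_fract g / to_fract h" by (rule twistE)
    show "\<exists>g h t. g \<in> hom_part (t + (n - 1)) \<and> h \<in> hom_part t \<and> eval h p \<noteq> 0 \<and> q / to_fract (L c) = to_fract g / to_fract h"
    proof (cases "res \<kappa> u v h = 0")
      case True
      \<comment> \<open>The denominator contains the equation of the line and is nonzero at
        \<open>p\<close>; so \<open>p\<close> is off the line and another factor \<open>L c\<close>
        in the denominator does no harm.\<close>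
      from res_eq_0_imp_dvd[OF gh(2) True c] obtain h' where "h = L c * h'" by blast
      then have "eval (h * L c) p \<noteq> 0" using gh(3) by (auto simp: eval_simps)
      moreover have "h * L c \<in> hom_part (t + 1)" using gh(2) L_hom by (rule hom_part_mult)
      moreover have "g \<in> hom_part (t + 1 + (n - 1))" using gh(1) by simp
      moreover have "q / to_fract (L c) = to_fract g / to_fract (h * L c)" using gh(5) by simp
      ultimately show ?thesis by blast
    next
      case False
      from res_eq_0_imp_dvd[OF gh(1) 0[OF gh(5) False] c] obtain g' where
        g': "g' \<in> hom_part (t + n - 1)" "g = L c * g'" by blast
      have "g' \<in> hom_part (t + (n - 1))" using g'(1) by (simp add: algebra_simps)
      moreover have "q / to_fract (L c) = to_fract g' / to_fract h" using gh(5) g'(2) L0 by simp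
      ultimately show ?thesis using gh(2,3) by blast
    qed
  qed
  moreover have "q = to_fract (L c) * (q / to_fract (L c))" using L0 by simp
  ultimately show ?thesis unfolding lid_def by blast
qed

lemma power_int_twist:
  assumes "h \<in> hom_part 1" "\<And>p. p \<in> U \<Longrightarrow> eval h p \<noteq> 0"
  shows "to_fract h powi k \<in> twist k U"
proof (cases "k \<ge> 0")
  case True
  then obtain n where "k = int n" by (metis nonneg_int_cases)
  then show ?thesis
    using twist_to_fract[OF hom_part_power1[OF assms(1), of n], of U] by (simp add: to_fract_hom.hom_power)
next
  case False
  define n where "n = nat (- k)"
  have k: "k = - int n" using False by (simp add: n_def)
  have "to_fract 1 / to_fract (h ^ n) \<in> twist k U"
    using assms by (intro twist_divide[OF _ hom_part_power1[OF assms(1)]]) (auto simp: k eval_simps)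
  moreover have "to_fract h powi k = inverse (to_fract h ^ n)"
    unfolding k by (simp add: power_int_minus)
  ultimately show ?thesis by (simp add: to_fract_hom.hom_power divide_inverse)
qed


lemma poly_res_pt: "poly (res \<kappa> u v h) t = eval h (pt t)"
  by (rule poly_res)

lemma res_eq_0_of_to_fract:
  assumes "to_fract p = 0" shows "res \<kappa> u v p = 0"
  using assms by (simp add: res_simps)

text \<open>The images of the generators of \<open>O(-a)\<close> over \<open>x \<noteq> \<kappa> y\<close> and over \<open>y \<noteq> 0\<close> glue to a syzygy
  of degree \<open>a\<close> on the line.\<close>

lemma syz_of_line_iso:
  fixes a b :: int
  assumes c: "c \<noteq> 0"
    and iso: "line_iso (L c) (derivation_bundle (arr m l)) (twist_sum (\<lambda>i::bool. if i then - b else - a))"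
  shows "\<exists>\<theta>. syz \<theta> \<and> \<theta> \<noteq> 0 \<and> (\<forall>j. \<theta> j \<noteq> 0 \<longrightarrow> int (Polynomial.degree (\<theta> j)) \<le> a)"
proof -
  let ?E = "derivation_bundle (arr m l)"
  let ?G = "twist_sum (\<lambda>i::bool. if i then - b else - a) :: ('k, bool) sheaf"
  let ?N = "\<lambda>U. line_sub (L c) ?E U" and ?M = "\<lambda>U. line_sub (L c) ?G U"
  note sE = sheaf_mod_derivation_bundle[of "arr m l"] and sG = sheaf_mod_twist_sum[of "\<lambda>i::bool. if i then - b else - a", where ?'k = 'k]
  note sN = submod_line_sub[of _ "L c" ?E] and sM = submod_line_sub[of _ "L c" ?G]
  let ?X = "xform \<kappa> :: 'k mpoly3" and ?Y = "mvar 1 :: 'k mpoly3"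
  have Y0: "?Y \<noteq> 0"
  proof
    assume "?Y = 0"
    then have "res \<kappa> u v ?Y = 0" by (simp add: res_simps)
    then show False by (simp add: res_simps lpt_def)
  qed
  have X0: "?X \<noteq> 0" by (rule xform_neq_0)
  define U1 where "U1 = {p. p \<noteq> 0 \<and> eval ?X p \<noteq> 0}"
  define U2 where "U2 = {p. p \<noteq> 0 \<and> eval ?Y p \<noteq> 0}"
  define U3 where "U3 = {p. p \<noteq> 0 \<and> eval (?X * ?Y) p \<noteq> 0}"
  have XY: "?X * ?Y \<in> hom_part 2" by (rule hom_part_mult'[of _ 1 _ 1]) auto
  have open1: "basic_open U1" unfolding basic_open_def U1_def
    by (intro exI[of _ ?X] exI[of _ 1]) (use X0 in auto)
  have open2: "basic_open U2" unfolding basic_open_def U2_def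
    by (intro exI[of _ ?Y] exI[of _ 1]) (use Y0 in auto)
  have open3: "basic_open U3" unfolding basic_open_def U3_def
    by (intro exI[of _ "?X * ?Y"] exI[of _ 2]) (use X0 Y0 XY in auto)
  have sub: "U3 \<subseteq> U1" "U3 \<subseteq> U2" by (auto simp: U1_def U2_def U3_def eval_simps)
  define q1 where "q1 = to_fract ?X powi (- a)"
  define q2 where "q2 = to_fract ?Y powi (- a)"
  \<comment> \<open>The transition function between the generators \<open>q1\<close> and
    \<open>q2\<close> of \<open>O(-a)\<close>; on the line it is the power \<open>a\<close> of the
    parameter.\<close>
  define r where "r = to_fract ?Y powi a * to_fract ?X powi (- a)"
  define e1 where "e1 = (\<lambda>i. if i then 0 else q1)"
  define e2 where "e2 = (\<lambda>i. if i then 0 else q2)"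
  have e1: "e1 \<in> ?G U1"
    using power_int_twist[of ?X U1 "- a"] by (auto simp: twist_sum_def e1_def q1_def U1_def)
  have e2: "e2 \<in> ?G U2"
    using power_int_twist[of ?Y U2 "- a"] by (auto simp: twist_sum_def e2_def q2_def U2_def)
  have r: "r \<in> reg U3"
    unfolding r_def by (rule twist_mult'[OF power_int_twist power_int_twist]) (auto simp: U3_def eval_simps)
  have "r * q2 = q1"
  proof -
    have "to_fract ?Y powi a * to_fract ?Y powi (- a) = 1" using Y0 by (simp flip: power_int_add)
    then show ?thesis by (simp add: r_def q1_def q2_def mult_ac)
  qed
  then have re: "r \<cdot> e2 = e1" by (auto simp: e1_def e2_def vscale_def)
  obtain \<phi> where \<phi>': "\<forall>U. basic_open U \<longrightarrow>
      bij_betw (\<phi> U) (line_restr (L c) ?E U) (line_restr (L c) ?G U) \<and>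
      (\<forall>C\<in>line_restr (L c) ?E U. \<forall>C'\<in>line_restr (L c) ?E U. \<phi> U (C + C') = \<phi> U C + \<phi> U C') \<and>
      (\<forall>g\<in>reg U. \<forall>C\<in>line_restr (L c) ?E U. \<phi> U ((\<cdot>) g ` C + ?N U) = (\<cdot>) g ` \<phi> U C + ?M U) \<and>
      (\<forall>V. basic_open V \<and> V \<subseteq> U \<longrightarrow> (\<forall>C\<in>line_restr (L c) ?E U. \<phi> V (C + ?N V) = \<phi> U C + ?M V))"
    using iso unfolding line_iso_def by (rule exE)
  note \<phi> = \<phi>'[THEN spec, THEN mp]
  have bij: "bij_betw (\<phi> U) (line_restr (L c) ?E U) (line_restr (L c) ?G U)" if "basic_open U" for U
    using \<phi>[OF that] by blast
  have pre: "\<exists>w\<in>?E U. \<phi> U (w +o ?N U) = e +o ?M U" if "basic_open U" "e \<in> ?G U" for U e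
  proof -
    have "e +o ?M U \<in> \<phi> U ` line_restr (L c) ?E U"
      using bij[OF that(1)] that(2) by (simp add: bij_betw_def line_restr_def)
    then show ?thesis unfolding line_restr_def by auto
  qed
  from pre[OF open1 e1] obtain v1 where v1: "v1 \<in> ?E U1" "\<phi> U1 (v1 +o ?N U1) = e1 +o ?M U1" by blast
  from pre[OF open2 e2] obtain v2 where v2: "v2 \<in> ?E U2" "\<phi> U2 (v2 +o ?N U2) = e2 +o ?M U2" by blast
  have C1: "v1 +o ?N U1 \<in> line_restr (L c) ?E U1" using v1 by (simp add: line_restr_def)
  have C2: "v2 +o ?N U2 \<in> line_restr (L c) ?E U2" using v2 by (simp add: line_restr_def)
  have v1': "v1 \<in> ?E U3" by (rule sheaf_mod_mono[OF sE sub(1) v1(1)])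
  have v2': "v2 \<in> ?E U3" by (rule sheaf_mod_mono[OF sE sub(2) v2(1)])
  have restr: "\<phi> U3 (w +o ?N U3) = e +o ?M U3"
    if "basic_open U" "U3 \<subseteq> U" "w +o ?N U \<in> line_restr (L c) ?E U" "\<phi> U (w +o ?N U) = e +o ?M U" for U w e
  proof -
    have "\<phi> U3 ((w +o ?N U) + ?N U3) = \<phi> U (w +o ?N U) + ?M U3"
      using \<phi>[OF that(1)] open3 that(2,3) by blast
    then show ?thesis
      unfolding that(4) using line_sub_mono[OF sE that(2)] line_sub_mono[OF sG that(2)]
      by (simp add: coset_extend[OF sN sN] coset_extend[OF sM sM])
  qed
  have 1: "\<phi> U3 (v1 +o ?N U3) = e1 +o ?M U3" by (rule restr[OF open1 sub(1) C1 v1(2)])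
  have 2: "\<phi> U3 (v2 +o ?N U3) = e2 +o ?M U3" by (rule restr[OF open2 sub(2) C2 v2(2)])
  have "\<phi> U3 ((\<cdot>) r ` (v2 +o ?N U3) + ?N U3) = (\<cdot>) r ` \<phi> U3 (v2 +o ?N U3) + ?M U3"
    using \<phi>[OF open3] r v2' by (auto simp: line_restr_def)
  then have "\<phi> U3 ((r \<cdot> v2) +o ?N U3) = \<phi> U3 (v1 +o ?N U3)"
    unfolding 1 2 coset_scale[OF sN r] coset_scale[OF sM r] re .
  moreover have "r \<cdot> v2 \<in> ?E U3" by (rule submod_scale[OF sheaf_mod_submod[OF sE] r v2'])
  ultimately have "(r \<cdot> v2) +o ?N U3 = v1 +o ?N U3"
    using bij[OF open3] v1' by (auto simp: bij_betw_def line_restr_def dest: inj_onD)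
  then have "v1 +o ?N U3 = (r \<cdot> v2) +o ?N U3" ..
  then have "v1 - r \<cdot> v2 \<in> ?N U3" by (simp only: coset_eq_iff[OF sN])
  then have "(v1 - r \<cdot> v2) i \<in> lid (L c) 0 U3" for i
    by (rule line_sub_lid) (simp add: derivation_bundle_iff)
  then have glue: "\<exists>q\<in>twist (- 1) U3. v1 i - r * v2 i = to_fract (L c) * q" for i
    by (auto simp: lid_def vscale_def)
  have tw1: "v1 i \<in> twist 0 U1" for i using v1 by (simp add: derivation_bundle_iff)
  have tw2: "v2 i \<in> twist 0 U2" for i using v2 by (simp add: derivation_bundle_iff)
  have pt1: "pt t \<in> U1" for t
    using pt_neq_0 poly_res_pt[of ?X t] by (simp add: U1_def)
  have "\<forall>i. \<exists>\<rho>. \<forall>g h. v1 i = to_fract g / to_fract h \<and> res \<kappa> u v h \<noteq> 0 \<longrightarrow> res \<kappa> u v g = \<rho> * res \<kappa> u v h"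
    using local_polynomial[OF tw1 pt1] by blast
  then obtain \<rho> where \<rho>: "\<And>i g h. v1 i = to_fract g / to_fract h \<Longrightarrow> res \<kappa> u v h \<noteq> 0 \<Longrightarrow> res \<kappa> u v g = \<rho> i * res \<kappa> u v h"
    by metis
  have rep1: "\<exists>g h. v1 i = to_fract g / to_fract h \<and> res \<kappa> u v h \<noteq> 0 \<and> h \<noteq> 0" for i
  proof -
    obtain g h t where "h \<noteq> 0" "v1 i = to_fract g / to_fract h" "eval h (pt 0) \<noteq> 0"
      by (rule twistE[OF tw1[of i] pt1[of 0]])
    moreover from this(3) have "res \<kappa> u v h \<noteq> 0" using poly_res_pt[of h 0] by auto
    ultimately show ?thesis by blast
  qed
  then obtain g1 h1 where gh1: "\<And>i. v1 i = to_fract (g1 i) / to_fract (h1 i)" "\<And>i. res \<kappa> u v (h1 i) \<noteq> 0" "\<And>i. h1 i \<noteq> 0"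
    by metis
  have res_g1: "res \<kappa> u v (g1 i) = \<rho> i * res \<kappa> u v (h1 i)" for i by (rule \<rho>[OF gh1(1,2)])
  have "syz \<rho>"
  proof -
    have "0 = dot v1 (gradf (arr m l)) * (to_fract (h1 0) * to_fract (h1 1) * to_fract (h1 2))"
      using v1 by (simp add: derivation_bundle_iff)
    also have "\<dots> = to_fract (g1 0 * h1 1 * h1 2 * pdiff 0 (arr m l) + h1 0 * g1 1 * h1 2 * pdiff 1 (arr m l) + h1 0 * h1 1 * g1 2 * pdiff 2 (arr m l))"
      using gh1(3) by (simp add: dot_def sum_UNIV_3 gh1(1) gradf_def field_simps)
    finally have "res \<kappa> u v (g1 0 * h1 1 * h1 2 * pdiff 0 (arr m l) + h1 0 * g1 1 * h1 2 * pdiff 1 (arr m l) + h1 0 * h1 1 * g1 2 * pdiff 2 (arr m l)) = 0"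
      by (intro res_eq_0_of_to_fract) simp
    then have "(res \<kappa> u v (h1 0) * res \<kappa> u v (h1 1) * res \<kappa> u v (h1 2)) * dot \<rho> g = 0"
      by (simp add: res_simps res_g1 dot_def sum_UNIV_3 algebra_simps flip: g_def)
    then show ?thesis using gh1(2) by (simp add: syz_def)
  qed
  moreover have "\<rho> \<noteq> 0"
  proof
    assume "\<rho> = 0"
    then have "v1 i \<in> lid (L c) 0 U1" for i
      using \<rho> by (intro lid_of_res_eq_0[OF c tw1]) simp
    then have "v1 \<in> ?N U1" by (intro derivation_line_subI[OF open1 L_neq_0[OF c] v1(1)])
    then have z: "v1 +o ?N U1 = 0 +o ?N U1" by (simp only: coset_eq_iff[OF sN] diff_zero)
    \<comment> \<open>Additivity at the zero coset: \<open>e1\<close> and \<open>e1 + e1\<close>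
      belong to the same class, so \<open>e1\<close> would vanish on the line.\<close>
    have "\<phi> U1 ((v1 +o ?N U1) + (v1 +o ?N U1)) = \<phi> U1 (v1 +o ?N U1) + \<phi> U1 (v1 +o ?N U1)"
      using \<phi>[OF open1] C1 by blast
    moreover have "(v1 +o ?N U1) + (v1 +o ?N U1) = v1 +o ?N U1"
      unfolding z coset_add[OF sN] by simp
    ultimately have "e1 +o ?M U1 = (e1 + e1) +o ?M U1"
      by (simp only: v1(2) coset_add[OF sM])
    then have "e1 - (e1 + e1) \<in> ?M U1" by (simp only: coset_eq_iff[OF sM])
    then have "- (e1 - (e1 + e1)) \<in> ?M U1" by (rule submod_uminus[OF sM])
    then have "e1 \<in> ?M U1" by simp
    then have "e1 False \<in> lid (L c) (- a) U1"
      by (rule line_sub_lid) (auto simp: twist_sum_def dest: spec[of _ False])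
    then obtain q where q: "q \<in> twist (- a - 1) U1" "q1 = to_fract (L c) * q" by (auto simp: lid_def e1_def)
    obtain g' h' t where gh: "h' \<noteq> 0" "q = to_fract g' / to_fract h'" "eval h' (pt 0) \<noteq> 0"
      by (rule twistE[OF q(1) pt1[of 0]])
    have h': "res \<kappa> u v h' \<noteq> 0" using gh(3) poly_res_pt[of h' 0] by auto
    \<comment> \<open>The generator \<open>q1\<close> is a quotient of forms that restrict to 1, so
      it cannot vanish on the line. The sign of \<open>a\<close> decides which of the two forms is a
      power of \<open>?X\<close>.\<close>
    have "\<exists>A B. q1 * to_fract A = to_fract B \<and> res \<kappa> u v A = 1 \<and> res \<kappa> u v B = 1"
    proof (cases "a \<ge> 0")
      case True
      then have "q1 * to_fract (?X ^ nat a) = to_fract 1"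
        unfolding q1_def using X0
          by (simp add: power_int_minus power_int_def to_fract_hom.hom_power flip: power_mult_distrib)
      then show ?thesis by (intro exI[of _ "?X ^ nat a"] exI[of _ 1]) (simp add: res_simps)
    next
      case False
      then have "q1 * to_fract 1 = to_fract (?X ^ nat (- a))"
        unfolding q1_def by (simp add: power_int_def to_fract_hom.hom_power)
      then show ?thesis by (intro exI[of _ 1] exI[of _ "?X ^ nat (- a)"]) (simp add: res_simps)
    qed
    then obtain A B where AB: "q1 * to_fract A = to_fract B" "res \<kappa> u v A = 1" "res \<kappa> u v B = 1" by blast
    have "to_fract (L c * g' * A) = to_fract (B * h')"
      using AB(1) gh(1) unfolding q(2) gh(2) by (simp add: field_simps)
    then have "L c * g' * A = B * h'" by (simp only: to_fract_eq_iff)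
    then have "res \<kappa> u v (L c * g' * A) = res \<kappa> u v (B * h')" by simp
    then show False using h' AB by (simp add: res_simps res_ldual)
  qed
  moreover have "int (Polynomial.degree (\<rho> i)) \<le> a" if \<rho>0: "\<rho> i \<noteq> 0" for i
  proof -
    have inf: "lptinf \<kappa> v \<in> U2"
    proof -
      have "lptinf \<kappa> v 1 = 1" by (simp add: lptinf_def)
      then have "lptinf \<kappa> v \<noteq> 0" by auto
      then show ?thesis by (simp add: U2_def eval_simps lptinf_def)
    qed
    \<comment> \<open>The section \<open>v2\<close> is regular at infinity: there is a denominator
      whose restriction has full degree, and the restricted numerator has at most the same
      degree.\<close>
    obtain g2 h2 t2 where gh2: "g2 \<in> hom_part (t2 + 0)" "h2 \<in> hom_part t2" "eval h2 (lptinf \<kappa> v) \<noteq> 0" "h2 \<noteq> 0"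
      "v2 i = to_fract g2 / to_fract h2"
      by (rule twistE[OF tw2[of i] inf])
    have "t2 \<ge> 0" using gh2(2,4) hom_part_neg by fastforce
    then obtain k2 where k2: "t2 = int k2" by (metis nonneg_int_cases)
    have deg_g2: "Polynomial.degree (res \<kappa> u v g2) \<le> k2" using degree_res[of g2 k2] gh2(1) k2 by simp
    have "poly.coeff (res \<kappa> u v h2) k2 \<noteq> 0" using coeff_res_top[of h2 k2] gh2 k2 by simp
    then have deg_h2: "Polynomial.degree (res \<kappa> u v h2) \<ge> k2" and h2: "res \<kappa> u v h2 \<noteq> 0"
      by (auto intro: le_degree)
    have pt3: "pt 1 \<in> U3"
      using pt_neq_0 poly_res_pt[of "?X * ?Y" 1] by (simp add: U3_def res_simps lpt_def)
    from glue[of i] obtain q where q: "q \<in> twist (- 1) U3" "v1 i - r * v2 i = to_fract (L c) * q" by blast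
    obtain g3 h3 t3 where gh3: "eval h3 (pt 1) \<noteq> 0" "h3 \<noteq> 0" "q = to_fract g3 / to_fract h3"
      by (rule twistE[OF q(1) pt3])
    have h3: "res \<kappa> u v h3 \<noteq> 0" using gh3(1) poly_res_pt[of h3 1] by auto
    \<comment> \<open>On the line \<open>v1\<close> agrees with \<open>r\<close> times
      \<open>v2\<close>. So \<open>\<rho> i\<close> is the power \<open>a\<close> of the parameter
      times the quotient of the restrictions of \<open>g2\<close> and \<open>h2\<close>, which
      bounds its degree by \<open>a\<close>.\<close>
    have key: "\<rho> i * res \<kappa> u v A * res \<kappa> u v h2 = res \<kappa> u v B * res \<kappa> u v g2"
      if AB: "r = to_fract B / to_fract A" "A \<noteq> 0" for A B
    proof -
      have "to_fract (g1 i * A * h2 * h3 - B * g2 * h1 i * h3) = to_fract (L c * g3 * h1 i * A * h2)"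
        using q(2) gh1(3)[of i] gh2(4) gh3(2) AB(2)
        unfolding gh1(1)[of i] gh2(5) gh3(3) AB(1) by (simp add: field_simps)
      then have "res \<kappa> u v (g1 i * A * h2 * h3 - B * g2 * h1 i * h3) = res \<kappa> u v (L c * g3 * h1 i * A * h2)"
        by (simp only: to_fract_eq_iff)
      then have "res \<kappa> u v (h1 i) * res \<kappa> u v h3 * (\<rho> i * res \<kappa> u v A * res \<kappa> u v h2)
          = res \<kappa> u v (h1 i) * res \<kappa> u v h3 * (res \<kappa> u v B * res \<kappa> u v g2)"
        by (simp add: res_simps res_ldual res_g1 algebra_simps)
      then show ?thesis using h3 gh1(2)[of i] by simp
    qed
    show ?thesis
    proof (cases "a \<ge> 0")
      case True
      have "r = to_fract (?Y ^ nat a) / to_fract (?X ^ nat a)"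
        unfolding r_def using True X0 by (simp add: power_int_minus power_int_def to_fract_hom.hom_power divide_inverse power_inverse)
      from key[OF this] X0 have eq: "\<rho> i * res \<kappa> u v h2 = [:0, 1:] ^ nat a * res \<kappa> u v g2"
        by (simp add: res_simps lpt_def)
      have "Polynomial.degree (\<rho> i) + k2 \<le> Polynomial.degree (\<rho> i * res \<kappa> u v h2)"
        using deg_h2 h2 \<rho>0 by (simp add: degree_mult_eq)
      also have "\<dots> \<le> nat a + k2"
        unfolding eq by (rule degree_mult_le_add[OF _ deg_g2]) (simp add: degree_power_eq)
      finally show ?thesis using True by simp
    next
      case False
      have "r = to_fract (?X ^ nat (- a)) / to_fract (?Y ^ nat (- a))"
        unfolding r_def using False Y0 by (simp add: power_int_minus power_int_def to_fract_hom.hom_power divide_inverse power_inverse)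
      from key[OF this] Y0 have eq: "\<rho> i * [:0, 1:] ^ nat (- a) * res \<kappa> u v h2 = res \<kappa> u v g2"
        by (simp add: res_simps lpt_def)
      have "Polynomial.degree (\<rho> i) + nat (- a) + k2 \<le> Polynomial.degree (\<rho> i * [:0, 1:] ^ nat (- a) * res \<kappa> u v h2)"
        using deg_h2 h2 \<rho>0 by (simp add: degree_mult_eq degree_power_eq)
      also have "\<dots> \<le> k2" unfolding eq by (rule deg_g2)
      finally show ?thesis using False by simp
    qed
  qed
  ultimately show ?thesis by blast
qed

end

section \<open>The generic line\<close>

text \<open>Convention for the iterated polynomial rings: \<open>u\<close> is the outer and
  \<open>v\<close> the inner variable of \<open>'k poly poly\<close>; a third, outermost level
  carries the parameter t of the line.\<close>

definition ev2 :: "'k \<Rightarrow> 'k \<Rightarrow> 'k::comm_ring_1 poly poly \<Rightarrow> 'k" where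
  "ev2 u v b = poly (poly b [:u:]) v"

definition spec :: "'k \<Rightarrow> 'k \<Rightarrow> 'k::comm_ring_1 poly poly poly \<Rightarrow> 'k poly" where
  "spec u v = map_poly (ev2 u v)"

lemma ev2_hom: "comm_ring_hom (ev2 u v)"
  by unfold_locales (simp_all add: ev2_def)

lemma spec_hom: "comm_ring_hom (spec u v)"
proof -
  interpret map_poly_comm_ring_hom "ev2 u v"
    unfolding map_poly_comm_ring_hom_def by (rule ev2_hom)
  show ?thesis unfolding spec_def by unfold_locales
qed

lemma ev2_simps [simp]:
  "ev2 u v 0 = 0" "ev2 u v 1 = 1" "ev2 u v (a + b) = ev2 u v a + ev2 u v b"
  "ev2 u v (a - b) = ev2 u v a - ev2 u v b" "ev2 u v (- a) = - ev2 u v a"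
  "ev2 u v (a * b) = ev2 u v a * ev2 u v b"
  by (simp_all add: ev2_def)

lemma ev2_sum: "ev2 u v (sum f A) = (\<Sum>i\<in>A. ev2 u v (f i))"
  by (induction A rule: infinite_finite_induct) auto

lemma ev2_prod: "ev2 u v (prod f A) = (\<Prod>i\<in>A. ev2 u v (f i))"
  by (induction A rule: infinite_finite_induct) auto

lemma coeff_spec: "poly.coeff (spec u v p) n = ev2 u v (poly.coeff p n)"
  by (simp add: spec_def coeff_map_poly)

lemma degree_spec: "Polynomial.degree (spec u v p) \<le> Polynomial.degree p"
  unfolding spec_def by (rule degree_map_poly_le)

lemma spec_simps [simp]:
  "spec u v 0 = 0" "spec u v (a + b) = spec u v a + spec u v b"
  "spec u v (a - b) = spec u v a - spec u v b" "spec u v (a * b) = spec u v a * spec u v b"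
proof -
  interpret comm_ring_hom "spec u v" by (rule spec_hom)
  show "spec u v 0 = 0" "spec u v (a + b) = spec u v a + spec u v b"
    "spec u v (a - b) = spec u v a - spec u v b" "spec u v (a * b) = spec u v a * spec u v b"
    by (simp_all add: hom_add hom_minus hom_mult)
qed

lemma spec_sum: "spec u v (sum f A) = (\<Sum>i\<in>A. spec u v (f i))"
  by (induction A rule: infinite_finite_induct) auto

lemma spec_dot: "spec u v (dot p q) = dot (\<lambda>i. spec u v (p i)) (\<lambda>i. spec u v (q i))"
  by (simp add: dot_def spec_sum)

lemma spec_cross: "spec u v (cross p q i) = cross (\<lambda>i. spec u v (p i)) (\<lambda>i. spec u v (q i)) i"
  by (simp add: cross_def)

lemma ev2_nonzero:
  fixes b :: "'k::{idom, ring_char_0} poly poly"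
  shows "b \<noteq> 0 \<Longrightarrow> \<exists>u v. ev2 u v b \<noteq> 0"
  unfolding ev2_def by (rule poly_poly_nonroot)

text \<open>Density of the open set where \<open>b\<close> is nonzero: the product
  \<open>a * b\<close> vanishes at all points.\<close>

lemma ev2_identity:
  fixes a b :: "'k::{idom, ring_char_0} poly poly"
  assumes "b \<noteq> 0" "\<And>u v. ev2 u v b \<noteq> 0 \<Longrightarrow> ev2 u v a = 0"
  shows "a = 0"
proof (rule ccontr)
  assume "a \<noteq> 0"
  with assms(1) have "a * b \<noteq> 0" by simp
  then obtain u v where "ev2 u v (a * b) \<noteq> 0" using ev2_nonzero by blast
  with assms(2)[of u v] show False by simp
qed

definition gpt :: "'k \<Rightarrow> 3 \<Rightarrow> 'k::comm_ring_1 poly poly poly" where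
  "gpt \<kappa> = (\<lambda>i. if i = 0 then [:1, [:[:\<kappa>:]:]:] else if i = 1 then [:0, 1:] else [:[:0, 1:], [:[:0, 1:]:]:])"

definition gres :: "'k \<Rightarrow> 'k::comm_ring_1 mpoly3 \<Rightarrow> 'k poly poly poly" where
  "gres \<kappa> = msub (\<lambda>c. [:[:[:c:]:]:]) (gpt \<kappa>)"

lemmas gres_simps =
  comm_ring_hom.msub_simps[OF const3_hom, where a = "gpt \<kappa>" for \<kappa>, folded gres_def]
  comm_ring_hom.msub_zero[OF const3_hom, where a = "gpt \<kappa>" for \<kappa>, folded gres_def]
  comm_ring_hom.msub_one[OF const3_hom, where a = "gpt \<kappa>" for \<kappa>, folded gres_def]
  comm_ring_hom.msub_mconst[OF const3_hom, where a = "gpt \<kappa>" for \<kappa>, folded gres_def]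
  comm_ring_hom.msub_mvar[OF const3_hom, where a = "gpt \<kappa>" for \<kappa>, folded gres_def]

lemma spec_gpt: "spec u v (gpt \<kappa> i) = lpt \<kappa> u v i"
  by (rule poly_eqI) (auto simp: coeff_spec gpt_def lpt_def coeff_pCons ev2_def split: nat.split)

lemma spec_gres: "spec u v (gres \<kappa> p) = res \<kappa> u v p"
proof -
  have "spec u v [:[:[:c:]:]:] = [:c:]" for c :: 'a
    by (rule poly_eqI) (auto simp: coeff_spec coeff_pCons ev2_def split: nat.split)
  then show ?thesis
    unfolding gres_def res_def comm_ring_hom.hom_msub[OF spec_hom const3_hom] by (simp add: spec_gpt)
qed

text \<open>Each point with x different from \<open>\<kappa>\<close> times y lies, up to scaling, on
  one of the lines with \<open>v = 0\<close>, and a nonzero form is nonzero at some such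
  point.\<close>

lemma res_all_eq_0:
  fixes p :: "'k::field_char_0 mpoly3"
  assumes "p \<in> hom_part n" "\<And>u v. res \<kappa> u v p = 0"
  shows "p = 0"
proof (rule ccontr)
  assume "p \<noteq> 0"
  then have "n \<ge> 0" using assms(1) hom_part_neg by fastforce
  then obtain k where k: "n = int k" by (metis nonneg_int_cases)
  have "xform \<kappa> * p \<noteq> 0" using \<open>p \<noteq> 0\<close> xform_neq_0 by simp
  then obtain q where q: "eval (xform \<kappa> * p) q \<noteq> 0" using ex_eval_nonzero by blast
  define s where "s = q 0 - \<kappa> * q 1"
  have s: "s \<noteq> 0" and p: "eval p q \<noteq> 0" using q by (simp_all add: eval_simps xform_def s_def)
  define t where "t = q 1 / s"
  have "eval p q = eval p (\<lambda>i. s * poly (lpt \<kappa> (q 2 / s) 0 i) t)"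
  proof (rule arg_cong[of _ _ "eval p"], rule ext)
    fix i show "q i = s * poly (lpt \<kappa> (q 2 / s) 0 i) t"
      using s by (cases i rule: cases_3) (simp_all add: lpt_def t_def s_def field_simps)
  qed
  also have "\<dots> = s ^ k * poly (res \<kappa> (q 2 / s) 0 p) t"
    using assms(1) k by (simp add: eval_scale poly_res)
  also have "\<dots> = 0" using assms(2) by simp
  finally show False using p by simp
qed

subsection \<open>General linear forms\<close>

lemma mvar_neq_0: "mvar i \<noteq> (0 :: 'k::comm_ring_1 mpoly3)"
proof
  assume "mvar i = (0 :: 'k mpoly3)"
  then have "eval (mvar i) (\<lambda>_. 1 :: 'k) = eval 0 (\<lambda>_. 1)" by simp
  then show False by (simp add: eval_simps)
qed

text \<open>The arguments of \<open>ev2\<close> are the parameters of the line with coefficient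
  vector \<open>p\<close>, and a power of \<open>p 2\<close> clears their denominators. Closure
  under sums and products reduces the claim to constants and the two variables.\<close>

lemma dehomogenize:
  fixes b :: "'k::field poly poly"
  shows "\<exists>n G. G \<in> hom_part (int n) \<and>
    (\<forall>p. p 2 \<noteq> 0 \<longrightarrow> eval G p = p 2 ^ n * ev2 (- p 0 / p 2) (- (\<kappa> * p 0 + p 1) / p 2) b)"
proof -
  define H where "H b \<longleftrightarrow> (\<exists>n G. G \<in> hom_part (int n) \<and>
    (\<forall>p. p 2 \<noteq> 0 \<longrightarrow> eval G p = p 2 ^ n * ev2 (- p 0 / p 2) (- (\<kappa> * p 0 + p 1) / p 2) b))" for b :: "'k poly poly"
  have const: "H [:[:c:]:]" for c
    unfolding H_def by (intro exI[of _ 0] exI[of _ "mconst c"]) (auto simp: eval_simps ev2_def)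
  have u: "H [:0, 1:]"
    unfolding H_def by (intro exI[of _ 1] exI[of _ "- mvar 0"]) (auto simp: eval_simps ev2_def)
  have v: "H [:[:0, 1:]:]"
    unfolding H_def by (intro exI[of _ 1] exI[of _ "- (mconst \<kappa> * mvar 0 + mvar 1)"])
      (auto simp: eval_simps ev2_def)
  have mult: "H (a * b)" if "H a" "H b" for a b
  proof -
    from that obtain n G n' G' where 1: "G \<in> hom_part (int n)" "G' \<in> hom_part (int n')"
      "\<forall>p. p 2 \<noteq> 0 \<longrightarrow> eval G p = p 2 ^ n * ev2 (- p 0 / p 2) (- (\<kappa> * p 0 + p 1) / p 2) a"
      "\<forall>p. p 2 \<noteq> 0 \<longrightarrow> eval G' p = p 2 ^ n' * ev2 (- p 0 / p 2) (- (\<kappa> * p 0 + p 1) / p 2) b"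
      unfolding H_def by blast
    have "G * G' \<in> hom_part (int (n + n'))" using 1 by (auto intro: hom_part_mult)
    moreover have "\<forall>p. p 2 \<noteq> 0 \<longrightarrow> eval (G * G') p = p 2 ^ (n + n') * ev2 (- p 0 / p 2) (- (\<kappa> * p 0 + p 1) / p 2) (a * b)"
      using 1(3,4) by (simp add: eval_simps power_add mult_ac)
    ultimately show ?thesis unfolding H_def by blast
  qed
  have add: "H (a + b)" if "H a" "H b" for a b
  proof -
    from that obtain n G n' G' where 1: "G \<in> hom_part (int n)" "G' \<in> hom_part (int n')"
      "\<forall>p. p 2 \<noteq> 0 \<longrightarrow> eval G p = p 2 ^ n * ev2 (- p 0 / p 2) (- (\<kappa> * p 0 + p 1) / p 2) a"
      "\<forall>p. p 2 \<noteq> 0 \<longrightarrow> eval G' p = p 2 ^ n' * ev2 (- p 0 / p 2) (- (\<kappa> * p 0 + p 1) / p 2) b"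
      unfolding H_def by blast
    have "G * mvar 2 ^ n' + G' * mvar 2 ^ n \<in> hom_part (int (n + n'))"
      by (intro hom_part_add hom_part_mult'[OF 1(1) hom_part_power1] hom_part_mult'[OF 1(2) hom_part_power1]) auto
    moreover have "\<forall>p. p 2 \<noteq> 0 \<longrightarrow> eval (G * mvar 2 ^ n' + G' * mvar 2 ^ n) p = p 2 ^ (n + n') * ev2 (- p 0 / p 2) (- (\<kappa> * p 0 + p 1) / p 2) (a + b)"
      using 1(3,4) by (simp add: eval_simps power_add algebra_simps)
    ultimately show ?thesis unfolding H_def by blast
  qed
  have inner: "H [:q:]" for q
  proof (induction q)
    case 0
    show ?case using const[of 0] by simp
  next
    case (pCons c q)
    have "[:pCons c q:] = [:[:c:]:] + [:[:0, 1:]:] * [:q:]" by simp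
    then show ?case using add[OF const mult[OF v pCons.IH]] by simp
  qed
  have "H b"
  proof (induction b)
    case 0
    show ?case using inner[of 0] by simp
  next
    case (pCons q b)
    have "pCons q b = [:q:] + [:0, 1:] * b" by simp
    then show ?case using add[OF inner mult[OF u pCons.IH]] by simp
  qed
  then show ?thesis unfolding H_def .
qed

lemma lform_param:
  fixes p :: "3 \<Rightarrow> 'k::field"
  assumes "p 2 \<noteq> 0"
  shows "p = (\<lambda>i. p 2 * ldual \<kappa> (- p 0 / p 2) (- (\<kappa> * p 0 + p 1) / p 2) i)"
proof
  fix i show "p i = p 2 * ldual \<kappa> (- p 0 / p 2) (- (\<kappa> * p 0 + p 1) / p 2) i"
    using assms by (cases i rule: cases_3) (simp_all add: ldual_def field_simps)
qed

text \<open>The lines with \<open>p 2 \<noteq> 0\<close> form an open set of the dual plane,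
  parametrised by \<open>u\<close> and \<open>v\<close> up to a scalar \<open>c\<close>. The factor
  \<open>mvar 2\<close> excludes the remaining lines.\<close>

lemma for_general_linear_form_iff:
  fixes P :: "'k::field_char_0 mpoly3 \<Rightarrow> bool"
  shows "for_general_linear_form P \<longleftrightarrow>
    (\<exists>b. b \<noteq> 0 \<and> (\<forall>c u v. c \<noteq> 0 \<and> ev2 u v b \<noteq> 0 \<longrightarrow> P (lform (\<lambda>i. c * ldual \<kappa> u v i))))"
proof
  assume "for_general_linear_form P"
  then obtain G t where G: "G \<in> hom_part t" "G \<noteq> 0"
    "\<And>L. linear_form L \<Longrightarrow> eval G (dual_point L) \<noteq> 0 \<Longrightarrow> P L"
    unfolding for_general_linear_form_def by blast
  then have "t \<ge> 0" using hom_part_neg by fastforce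
  then obtain n where n: "t = int n" by (metis nonneg_int_cases)
  define a where "a = (\<lambda>i::3. if i = 0 then - [:0, 1:] else if i = 1 then [:[:\<kappa>:]:] * [:0, 1:] - [:[:0, 1:]:] else (1 :: 'k poly poly))"
  have hom: "comm_ring_hom (\<lambda>c::'k. [:[:c:]:])"
    by unfold_locales (simp_all flip: one_pCons)
  define b where "b = msub (\<lambda>c. [:[:c:]:]) a G"
  have ev: "ev2 u v b = eval G (ldual \<kappa> u v)" for u v
  proof -
    have "ev2 u v [:[:c:]:] = c" for c :: 'k by (simp add: ev2_def)
    moreover have "ev2 u v (a i) = ldual \<kappa> u v i" for i
      by (simp add: a_def ldual_def) (simp add: ev2_def)
    ultimately show ?thesis
      unfolding b_def eval_eq_msub comm_ring_hom.hom_msub[OF ev2_hom hom] by simp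
  qed
  have "G * mvar 2 \<noteq> 0" using G(2) by (simp add: mvar_neq_0)
  then obtain p where "eval (G * mvar 2) p \<noteq> 0" using ex_eval_nonzero by blast
  then have p: "eval G p \<noteq> 0" "p 2 \<noteq> 0" by (simp_all add: eval_simps)
  have scale: "eval G (\<lambda>i. c * ldual \<kappa> u v i) = c ^ n * ev2 u v b" for c u v
    using G(1) n eval_scale[of G n c] by (simp add: ev)
  have "eval G p = p 2 ^ n * ev2 (- p 0 / p 2) (- (\<kappa> * p 0 + p 1) / p 2) b"
    using lform_param[of p \<kappa>, OF p(2)] scale by metis
  then have "b \<noteq> 0" using p by auto
  moreover have "P (lform (\<lambda>i. c * ldual \<kappa> u v i))" if "c \<noteq> 0" "ev2 u v b \<noteq> 0" for c u v
  proof (rule G(3))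
    show "linear_form (lform (\<lambda>i. c * ldual \<kappa> u v i))"
      unfolding linear_form_lform using that(1) by (auto simp: ldual_def fun_eq_iff intro!: exI[of _ 2])
    show "eval G (dual_point (lform (\<lambda>i. c * ldual \<kappa> u v i))) \<noteq> 0"
      using that by (simp add: scale)
  qed
  ultimately show "\<exists>b. b \<noteq> 0 \<and> (\<forall>c u v. c \<noteq> 0 \<and> ev2 u v b \<noteq> 0 \<longrightarrow> P (lform (\<lambda>i. c * ldual \<kappa> u v i)))"
    by blast
next
  assume "\<exists>b. b \<noteq> 0 \<and> (\<forall>c u v. c \<noteq> 0 \<and> ev2 u v b \<noteq> 0 \<longrightarrow> P (lform (\<lambda>i. c * ldual \<kappa> u v i)))"
  then obtain b where b: "b \<noteq> 0" "\<And>c u v. c \<noteq> 0 \<Longrightarrow> ev2 u v b \<noteq> 0 \<Longrightarrow> P (lform (\<lambda>i. c * ldual \<kappa> u v i))" by blast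
  from dehomogenize[of \<kappa> b] obtain n G where G: "G \<in> hom_part (int n)"
    "\<And>p. p 2 \<noteq> 0 \<Longrightarrow> eval G p = p 2 ^ n * ev2 (- p 0 / p 2) (- (\<kappa> * p 0 + p 1) / p 2) b" by blast
  have hom: "G * mvar 2 \<in> hom_part (int n + 1)" using G(1) by (intro hom_part_mult) auto
  have "G * mvar 2 \<noteq> 0"
  proof
    assume 0: "G * mvar 2 = 0"
    from ev2_nonzero[OF b(1)] obtain u v where uv: "ev2 u v b \<noteq> 0" by blast
    have "eval (G * mvar 2) (ldual \<kappa> u v) = ev2 u v b"
      using G(2)[of "ldual \<kappa> u v"] by (simp add: eval_simps ldual_def)
    moreover have "eval (G * mvar 2) (ldual \<kappa> u v) = 0" unfolding 0 by (simp add: eval_simps)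
    ultimately show False using uv by simp
  qed
  moreover have "P L" if L: "linear_form L" "eval (G * mvar 2) (dual_point L) \<noteq> 0" for L
  proof -
    let ?p = "dual_point L"
    have p: "?p 2 \<noteq> 0" "eval G ?p \<noteq> 0" using L(2) by (auto simp: eval_simps)
    then have "ev2 (- ?p 0 / ?p 2) (- (\<kappa> * ?p 0 + ?p 1) / ?p 2) b \<noteq> 0" using G(2) by auto
    from b(2)[OF p(1) this] have "P (lform ?p)" using lform_param[of ?p \<kappa>, OF p(1)] by metis
    then show ?thesis using linear_form_eq[OF L(1)] by simp
  qed
  ultimately show "for_general_linear_form P"
    unfolding for_general_linear_form_def using hom by blast
qed

subsection \<open>Derivations\<close>

definition derivation :: "('a::comm_ring_1 \<Rightarrow> 'a) \<Rightarrow> bool" where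
  "derivation \<delta> \<longleftrightarrow> (\<forall>a b. \<delta> (a + b) = \<delta> a + \<delta> b \<and> \<delta> (a * b) = \<delta> a * b + a * \<delta> b)"

lemma derivationD:
  assumes "derivation \<delta>"
  shows "\<delta> (a + b) = \<delta> a + \<delta> b" "\<delta> (a * b) = \<delta> a * b + a * \<delta> b" "\<delta> 0 = 0" "\<delta> 1 = 0"
    "\<delta> (sum f A) = (\<Sum>i\<in>A. \<delta> (f i))" "\<delta> (a - b) = \<delta> a - \<delta> b"
proof -
  show add: "\<delta> (a + b) = \<delta> a + \<delta> b" for a b using assms by (simp add: derivation_def)
  show mult: "\<delta> (a * b) = \<delta> a * b + a * \<delta> b" for a b using assms by (simp add: derivation_def)
  show 0: "\<delta> 0 = 0" using add[of 0 0] by simp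
  show "\<delta> 1 = 0" using mult[of 1 1] by simp
  show "\<delta> (a - b) = \<delta> a - \<delta> b" using add[of "a - b" b] by (simp add: algebra_simps)
  show "\<delta> (sum f A) = (\<Sum>i\<in>A. \<delta> (f i))"
    by (induction A rule: infinite_finite_induct) (auto simp: add 0)
qed

lemma derivation_pderiv: "derivation (pderiv :: 'a::idom poly \<Rightarrow> 'a poly)"
  by (simp add: derivation_def pderiv_add pderiv_mult algebra_simps)

lemma derivation_map_poly:
  assumes "derivation \<delta>"
  shows "derivation (map_poly \<delta>)"
proof -
  note d = derivationD[OF assms]
  have "map_poly \<delta> (p + q) = map_poly \<delta> p + map_poly \<delta> q" for p q
    by (rule poly_eqI) (simp add: coeff_map_poly d)
  moreover have "map_poly \<delta> (p * q) = map_poly \<delta> p * q + p * map_poly \<delta> q" for p q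
    by (rule poly_eqI) (simp add: coeff_map_poly d coeff_mult sum.distrib)
  ultimately show ?thesis by (simp add: derivation_def)
qed

text \<open>The vector field \<open>y \<partial>/\<partial>u - x \<partial>/\<partial>v\<close> moves the line while it fixes the point.\<close>

definition flow :: "'k::field poly poly poly \<Rightarrow> 'k poly poly poly" where
  "flow p = [:0, 1:] * map_poly pderiv p - map_poly (map_poly pderiv) p"

lemma derivation_flow: "derivation flow"
proof -
  have 1: "derivation (map_poly pderiv :: 'a poly poly poly \<Rightarrow> _)"
    by (rule derivation_map_poly[OF derivation_pderiv])
  have 2: "derivation (map_poly (map_poly pderiv) :: 'a poly poly poly \<Rightarrow> _)"
    by (rule derivation_map_poly[OF derivation_map_poly[OF derivation_pderiv]])
  show ?thesis
    unfolding derivation_def flow_def derivationD(1,2)[OF 1] derivationD(1,2)[OF 2]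
    by (simp add: algebra_simps)
qed

lemma coeff_flow: "poly.coeff (flow p) n = (case n of 0 \<Rightarrow> 0 | Suc k \<Rightarrow> pderiv (poly.coeff p k))
    - map_poly pderiv (poly.coeff p n)"
  by (simp add: flow_def coeff_map_poly coeff_pCons split: nat.split)

lemma degree_flow: "Polynomial.degree p \<le> n \<Longrightarrow> Polynomial.degree (flow p) \<le> Suc n"
  by (intro degree_le allI impI) (auto simp: coeff_flow coeff_eq_0 split: nat.split)

lemma map_poly_pderiv_const:
  "map_poly pderiv [:q:] = [:pderiv q:]" "map_poly pderiv 1 = (0 :: 'a::idom poly poly)"
  by (rule poly_eqI, auto simp: coeff_map_poly coeff_pCons split: nat.split)+

lemma flow_gpt: "flow (gpt \<kappa> i) = 0"
proof (rule poly_eqI)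
  fix n show "poly.coeff (flow (gpt \<kappa> i)) n = poly.coeff 0 n"
    by (cases i rule: cases_3)
      (auto simp: coeff_flow gpt_def coeff_pCons map_poly_pderiv_const pderiv_pCons split: nat.split)
qed

lemma flow_const: "flow [:[:[:c:]:]:] = 0"
  by (rule poly_eqI) (auto simp: coeff_flow coeff_pCons map_poly_pderiv_const pderiv_pCons split: nat.split)

lemma flow_gres: "flow (gres \<kappa> p) = 0"
proof (induction p rule: mpoly_induct)
  case zero
  show ?case by (simp add: gres_simps derivationD[OF derivation_flow])
next
  case (add m b p)
  note d = derivationD[OF derivation_flow]
  have pow: "flow (gpt \<kappa> i ^ n) = 0" for i n
    by (induction n) (simp_all add: d flow_gpt)
  have "gres \<kappa> (Poly_Mapping.single m b) = [:[:[:b:]:]:] * (\<Prod>i\<in>UNIV. gpt \<kappa> i ^ Poly_Mapping.lookup m i)"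
    unfolding gres_def by (rule comm_ring_hom.msub_single[OF const3_hom])
  then have "flow (gres \<kappa> (Poly_Mapping.single m b)) = 0"
    by (simp only: prod_UNIV_3 d flow_const pow) simp
  with add show ?case by (simp add: gres_simps d)
qed

text \<open>Darboux polynomials of the flow are invariant. The cofactor \<open>r\<close> has degree
  at most 1 in t. Top coefficients in t exclude degree 1, because a derivative in \<open>u\<close>
  is not a nonzero multiple of the polynomial; lowest coefficients in t exclude a nonzero
  \<open>r\<close> of degree 0 in the same way, by the derivative in \<open>v\<close>.\<close>

lemma flow_eq_multiple_imp_0:
  fixes q :: "'k::field_char_0 poly poly poly"
  assumes "q dvd flow q"
  shows "flow q = 0"
proof (rule ccontr)
  assume nz: "flow q \<noteq> 0"
  from assms obtain r where r: "flow q = r * q" by (metis dvd_def mult.commute)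
  have q0: "q \<noteq> 0" and r0: "r \<noteq> 0" using nz r by auto
  let ?n = "Polynomial.degree q"
  have "Polynomial.degree (r * q) \<le> Suc ?n" using degree_flow[of q ?n] r by simp
  then have "Polynomial.degree r \<le> 1" using q0 r0 by (simp add: degree_mult_eq)
  have d1: "b = 0" if "pderiv c = b * c" "c \<noteq> 0" for b c :: "'k poly poly"
  proof (rule ccontr)
    assume "b \<noteq> 0"
    with that have "pderiv c \<noteq> 0" by auto
    then have "Polynomial.degree c \<noteq> 0" using pderiv_eq_0_iff[of c] by auto
    moreover have "Polynomial.degree (pderiv c) = Polynomial.degree b + Polynomial.degree c"
      unfolding that(1) using \<open>b \<noteq> 0\<close> that(2) by (rule degree_mult_eq)
    ultimately show False by (simp add: degree_pderiv)
  qed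
  have "poly.coeff (r * q) (1 + ?n) = poly.coeff r 1 * poly.coeff q ?n"
    by (rule coeff_mult_top) (use \<open>Polynomial.degree r \<le> 1\<close> in auto)
  moreover have "poly.coeff (flow q) (1 + ?n) = pderiv (poly.coeff q ?n)"
    by (simp add: coeff_flow coeff_eq_0)
  ultimately have "pderiv (poly.coeff q ?n) = poly.coeff r 1 * poly.coeff q ?n" using r by simp
  from d1[OF this] q0 have "poly.coeff r 1 = 0" by simp
  then have "Polynomial.degree r = 0" using \<open>Polynomial.degree r \<le> 1\<close> r0
    by (metis le_antisym leading_coeff_0_iff le_SucE One_nat_def le_zero_eq)
  then obtain b where b: "r = [:b:]" by (rule degree_eq_zeroE)
  define n where "n = (LEAST n. poly.coeff q n \<noteq> 0)"
  have "\<exists>n. poly.coeff q n \<noteq> 0" using q0 by (metis leading_coeff_0_iff)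
  then have n: "poly.coeff q n \<noteq> 0" unfolding n_def by (rule LeastI_ex)
  have low: "poly.coeff q k = 0" if "k < n" for k using that not_less_Least unfolding n_def by blast
  let ?c = "poly.coeff q n"
  have "poly.coeff (flow q) n = - map_poly pderiv ?c"
    using low by (simp add: coeff_flow split: nat.split)
  then have eq: "- map_poly pderiv ?c = b * ?c" using r b by simp
  have b0: "b \<noteq> 0" using b r0 by auto
  have "Polynomial.degree b + Polynomial.degree ?c = Polynomial.degree (- map_poly pderiv ?c)"
    unfolding eq using b0 n by (simp add: degree_mult_eq)
  also have "\<dots> \<le> Polynomial.degree ?c" by (simp add: degree_map_poly_le)
  finally have "Polynomial.degree b = 0" by simp
  then obtain s where s: "b = [:s:]" by (rule degree_eq_zeroE)
  let ?e = "Polynomial.degree ?c"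
  have "poly.coeff (- map_poly pderiv ?c) ?e = s * poly.coeff ?c ?e" unfolding eq s by simp
  then have "- pderiv (poly.coeff ?c ?e) = s * poly.coeff ?c ?e" by (simp add: coeff_map_poly)
  then have eq2: "pderiv (poly.coeff ?c ?e) = - (s * poly.coeff ?c ?e)" by (metis minus_minus)
  have s0: "s \<noteq> 0" using s b0 by auto
  let ?l = "poly.coeff ?c ?e"
  have l0: "?l \<noteq> 0" using n by simp
  have "pderiv ?l \<noteq> 0" unfolding eq2 using s0 l0 by simp
  then have "Polynomial.degree ?l \<noteq> 0" using pderiv_eq_0_iff[of ?l] by auto
  moreover have "Polynomial.degree (pderiv ?l) = Polynomial.degree s + Polynomial.degree ?l"
    unfolding eq2 using s0 l0 by (simp add: degree_mult_eq)
  ultimately show False by (simp add: degree_pderiv)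
qed


text \<open>The exchange of a factor \<open>v\<close> together with a factor t for a factor
  \<open>u\<close>, as between neighbouring terms in a power of u + v t.\<close>

lemma flow_0_recursion:
  assumes "flow q = 0"
  shows "of_nat (Suc r) * poly.coeff (poly.coeff (poly.coeff q i) s) (Suc r)
    = (case i of 0 \<Rightarrow> 0 | Suc k \<Rightarrow> of_nat (Suc s) * poly.coeff (poly.coeff (poly.coeff q k) (Suc s)) r)"
proof -
  have "poly.coeff (poly.coeff (poly.coeff (flow q) i) s) r = 0" using assms by simp
  then show ?thesis
    by (cases i) (simp_all add: coeff_flow coeff_map_poly coeff_pderiv of_nat_poly del: of_nat_Suc)
qed

lemma flow_0_unique:
  fixes q :: "'k::field_char_0 poly poly poly"
  assumes "flow q = 0" "\<And>i s. poly.coeff (poly.coeff (poly.coeff q i) s) 0 = 0"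
  shows "q = 0"
proof -
  have "poly.coeff (poly.coeff (poly.coeff q i) s) r = 0" for i s r
  proof (induction r arbitrary: i s)
    case (Suc r)
    then show ?case using flow_0_recursion[OF assms(1), of r i s] by (cases i) (auto simp del: of_nat_Suc)
  qed (rule assms(2))
  then show ?thesis by (simp add: poly_eq_iff)
qed

text \<open>Each factor \<open>u\<close> can be exchanged for \<open>v\<close> times t, so powers of
  \<open>u\<close> count towards the degree in t. This bounds the degree of the form recovered
  below.\<close>

lemma flow_0_shift:
  fixes q :: "'k::field_char_0 poly poly poly"
  assumes "flow q = 0" "poly.coeff (poly.coeff (poly.coeff q i) s) r \<noteq> 0"
  shows "poly.coeff q (i + s) \<noteq> 0"
  using assms(2)
proof (induction s arbitrary: i r)
  case 0
  then show ?case by auto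
next
  case (Suc s)
  have "poly.coeff (poly.coeff (poly.coeff q (Suc i)) s) (Suc r) \<noteq> 0"
    using flow_0_recursion[OF assms(1), of r "Suc i" s] Suc.prems by (auto simp del: of_nat_Suc)
  from Suc.IH[OF this] show ?case by simp
qed

text \<open>The polynomials in \<open>u\<close>, \<open>v\<close>, \<open>t\<close> that are invariant under the flow are the polynomials in \<open>t\<close>
  and \<open>z = u + v t\<close>; they are determined by their restriction to \<open>v = 0\<close>.\<close>

lemma flow_invariant_lift:
  fixes q :: "'k::field_char_0 poly poly poly"
  assumes "flow q = 0" and deg: "Polynomial.degree q \<le> k"
  shows "\<exists>p\<in>hom_part (int k). gres \<kappa> p = q"
proof -
  define c where "c i n = poly.coeff (poly.coeff (poly.coeff q i) n) 0" for i n
  \<comment> \<open>The invariant that equals \<open>t ^ i * u ^ n\<close> at \<open>v = 0\<close>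
    is \<open>t ^ i * (u + v * t) ^ n\<close>, the restriction of the product of y to the
    \<open>i\<close> and z to the \<open>n\<close>. Powers of \<open>xform \<kappa>\<close>, which
    restrict to 1, fill up the degree.\<close>
  define p where "p = (\<Sum>i\<le>k. \<Sum>n\<le>k - i. mconst (c i n) * (xform \<kappa> ^ (k - i - n) * mvar 1 ^ i * mvar 2 ^ n))"
  have "xform \<kappa> ^ (k - i - n) * mvar 1 ^ i * mvar 2 ^ n \<in> hom_part (int k)" if "i \<le> k" "n \<le> k - i" for i n
  proof -
    have "xform \<kappa> ^ (k - i - n) * mvar 1 ^ i * mvar 2 ^ n \<in> hom_part (int (k - i - n) + int i + int n)"
      by (intro hom_part_mult hom_part_power1) auto
    moreover have "int (k - i - n) + int i + int n = int k" using that by simp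
    ultimately show ?thesis by (simp only:)
  qed
  then have p: "p \<in> hom_part (int k)"
    unfolding p_def by (intro hom_part_sum hom_part_mconst_mult) auto
  define \<zeta> where "\<zeta> = map_poly (map_poly (\<lambda>q::'k poly. poly q 0))"
  have hom0: "comm_ring_hom (\<lambda>q::'k poly. poly q 0)" by unfold_locales simp_all
  interpret h1: map_poly_comm_ring_hom "\<lambda>q::'k poly. poly q 0"
    unfolding map_poly_comm_ring_hom_def by (rule hom0)
  have hom1: "comm_ring_hom (map_poly (\<lambda>q::'k poly. poly q 0))" by unfold_locales
  interpret h2: map_poly_comm_ring_hom "map_poly (\<lambda>q::'k poly. poly q 0)"
    unfolding map_poly_comm_ring_hom_def by (rule hom1)
  have hom2: "comm_ring_hom \<zeta>" unfolding \<zeta>_def by unfold_locales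
  interpret z: comm_ring_hom \<zeta> by (rule hom2)
  have coeff_\<zeta>: "poly.coeff (poly.coeff (\<zeta> r) i) n = poly.coeff (poly.coeff (poly.coeff r i) n) 0" for r i n
    by (simp add: \<zeta>_def coeff_map_poly poly_0_coeff_0)
  have z1: "\<zeta> [:[:[:b:]:]:] = [:[:b:]:]" for b
    by (intro poly_eqI) (simp add: coeff_\<zeta> coeff_pCons split: nat.split)
  have z2: "\<zeta> [:0, 1:] = [:0, 1:]"
    by (intro poly_eqI) (simp add: coeff_\<zeta> coeff_pCons split: nat.split)
  have z3: "\<zeta> [:[:0, 1:], [:[:0, 1:]:]:] = [:[:0, 1:]:]"
    by (intro poly_eqI) (simp add: coeff_\<zeta> coeff_pCons split: nat.split)
  have gx: "gres \<kappa> (xform \<kappa>) = 1"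
    by (simp add: xform_def gres_simps gpt_def flip: one_pCons)
  have mon: "[:[:b:]:] * ([:0, 1:] ^ i * [:[:0, 1:]:] ^ n) = monom (monom b n) i" for b :: 'k and i n
  proof -
    have "[:[:0, 1::'k:]:] ^ n = [:[:0, 1:] ^ n:]"
      by (induction n) (simp_all flip: one_pCons)
    then show ?thesis by (simp add: monom_altdef smult_monom mult.commute)
  qed
  have "\<zeta> (gres \<kappa> p) = (\<Sum>i\<le>k. \<Sum>n\<le>k - i. monom (monom (c i n) n) i)"
    unfolding p_def gres_simps gx
    by (simp only: gpt_def z.hom_sum z.hom_mult z.hom_power z1 z2 z3 if_True if_False distinct_3 refl power_one mult_1_left z.hom_one mon)
  then have coeff: "poly.coeff (poly.coeff (poly.coeff (gres \<kappa> p) i) n) 0 = (if i + n \<le> k then c i n else 0)" for i n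
  proof -
    have "poly.coeff (poly.coeff (\<Sum>i\<le>k. \<Sum>n\<le>k - i. monom (monom (c i n) n) i) i) n
        = (\<Sum>i'\<le>k. if i' = i then (\<Sum>n'\<le>k - i. if n' = n then c i n else 0) else 0)"
      unfolding coeff_sum by (intro sum.cong refl) auto
    also have "\<dots> = (if i + n \<le> k then c i n else 0)" by (auto simp: sum.delta)
    finally show ?thesis using \<open>\<zeta> (gres \<kappa> p) = _\<close> by (simp flip: coeff_\<zeta>)
  qed
  note f = derivationD[OF derivation_flow]
  have "flow (gres \<kappa> p - q) = 0" by (simp add: f flow_gres assms(1))
  moreover have "poly.coeff (poly.coeff (poly.coeff (gres \<kappa> p - q) i) s) 0 = 0" for i s
  proof (cases "i + s \<le> k")
    case True
    then show ?thesis using coeff by (simp add: c_def)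
  next
    case False
    then have "poly.coeff q (i + s) = 0" using deg by (simp add: coeff_eq_0)
    then have "c i s = 0" using flow_0_shift[OF assms(1)] unfolding c_def by blast
    then show ?thesis using coeff[of i s] False by (simp add: c_def)
  qed
  ultimately have "gres \<kappa> p - q = 0" by (rule flow_0_unique)
  then show ?thesis using p by (intro bexI[of _ p]) simp_all
qed

subsection \<open>Arrangements without multiple lines\<close>

lemma (in arr_line) g_eta: "g = (\<lambda>j. res \<kappa> u v (pdiff j (arr m l)))"
  by (auto simp: g_def)

locale arrangement =
  fixes d m :: nat and l :: "nat \<Rightarrow> 3 \<Rightarrow> 'k::{alg_closed_field, field_char_0}" and \<kappa> :: 'k
  assumes m: "m = 2 * d + 1"
    and nonprop: "\<And>i j. i < m \<Longrightarrow> j < m \<Longrightarrow> i \<noteq> j \<Longrightarrow> cross (l i) (l j) \<noteq> 0"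
    and kappa: "\<And>i. i < m \<Longrightarrow> \<kappa> * l i 0 + l i 1 \<noteq> 0 \<or> l i 2 \<noteq> 0"
begin

definition "gg j = gres \<kappa> (pdiff j (arr m l))"

definition special :: "nat \<Rightarrow> 'k \<Rightarrow> 'k \<Rightarrow> (3 \<Rightarrow> 'k poly) \<Rightarrow> bool" where
  "special k u v \<theta> \<longleftrightarrow> \<theta> \<noteq> 0 \<and> (\<forall>j. Polynomial.degree (\<theta> j) \<le> k) \<and> dot \<theta> (\<lambda>j. res \<kappa> u v (pdiff j (arr m l))) = 0"

definition generic :: "nat \<Rightarrow> (3 \<Rightarrow> 'k poly poly poly) \<Rightarrow> bool" where
  "generic k \<omega> \<longleftrightarrow> \<omega> \<noteq> 0 \<and> (\<forall>j. Polynomial.degree (\<omega> j) \<le> k) \<and> dot \<omega> gg = 0"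

lemma spec_gg: "spec u v (gg j) = res \<kappa> u v (pdiff j (arr m l))"
  by (simp add: gg_def spec_gres)

text \<open>Syzygies of degree at most \<open>k\<close> are the solutions of a linear system with
  coefficients in the polynomials in \<open>u\<close> and \<open>v\<close>. Either a solution exists
  there, or a left inverse up to the factor \<open>\<delta>\<close> excludes solutions on every line
  where \<open>\<delta>\<close> is nonzero.\<close>

lemma generic_or_general_none:
  "(\<exists>\<omega>. generic k \<omega>) \<or> (\<exists>\<delta>. \<delta> \<noteq> 0 \<and> (\<forall>u v \<theta>. ev2 u v \<delta> \<noteq> 0 \<longrightarrow> \<not> special k u v \<theta>))"
proof -
  define N where "N = (\<Sum>j\<in>UNIV. Polynomial.degree (gg j))"
  have degN: "Polynomial.degree (gg j) \<le> N" for j unfolding N_def by (rule member_le_sum) auto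
  define J where "J = (UNIV :: 3 set) \<times> {..k}"
  \<comment> \<open>The unknowns are the coefficients of order \<open>s\<close> of the entries
    \<open>j\<close>; the vector belonging to such an unknown lists the coefficients of
    \<open>gg j\<close> multiplied by \<open>t ^ s\<close>.\<close>
  define a where "a = (\<lambda>(j, s) n. if s \<le> n then poly.coeff (gg j) (n - s) else 0)"
  have finJ: "finite J" by (simp add: J_def)
  from dependent_or_dual[OF finJ, of "{..k + N}" a]
  consider x where "\<exists>j\<in>J. x j \<noteq> 0" "\<forall>n\<in>{..k + N}. (\<Sum>j\<in>J. x j * a j n) = 0"
    | b \<delta> where "\<delta> \<noteq> 0" "\<forall>j\<in>J. \<forall>j'\<in>J. (\<Sum>n\<in>{..k + N}. b j n * a j' n) = (if j = j' then \<delta> else 0)"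
    by blast
  then show ?thesis
  proof cases
    case 1
    define \<omega> where "\<omega> j = (\<Sum>s\<le>k. monom (x (j, s)) s)" for j
    have deg: "Polynomial.degree (\<omega> j) \<le> k" for j
      unfolding \<omega>_def by (auto intro!: degree_sum_le order_trans[OF degree_monom_le])
    have coeff: "poly.coeff (\<omega> j) s = x (j, s)" if "s \<le> k" for j s
      using that by (simp add: \<omega>_def coeff_sum sum.delta)
    from 1(1) obtain j s where "s \<le> k" "x (j, s) \<noteq> 0" by (auto simp: J_def)
    then have "poly.coeff (\<omega> j) s \<noteq> 0" using coeff by simp
    then have "\<omega> j \<noteq> 0" by auto
    then have "\<omega> \<noteq> 0" by auto
    moreover have "dot \<omega> gg = 0"
    proof (rule poly_eqI)
      fix n
      show "poly.coeff (dot \<omega> gg) n = poly.coeff 0 n"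
      proof (cases "n \<le> k + N")
        case True
        have "poly.coeff (dot \<omega> gg) n = (\<Sum>j\<in>UNIV. \<Sum>s\<le>k. x (j, s) * a (j, s) n)"
          unfolding dot_def \<omega>_def sum_distrib_right coeff_sum
          by (intro sum.cong refl) (simp add: coeff_monom_mult a_def)
        also have "\<dots> = (\<Sum>j\<in>J. x j * a j n)"
          unfolding J_def by (simp add: sum.cartesian_product)
        finally show ?thesis using 1(2) True by simp
      next
        case False
        have "Polynomial.degree (dot \<omega> gg) \<le> k + N"
          unfolding dot_def using deg degN by (intro degree_sum_le degree_mult_le_add) auto
        with False show ?thesis by (simp add: coeff_eq_0)
      qed
    qed
    ultimately show ?thesis using deg unfolding generic_def by blast
  next
    case 2
    have "\<not> special k u v \<theta>" if nz: "ev2 u v \<delta> \<noteq> 0" for u v \<theta>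
    proof
      assume "special k u v \<theta>"
      then have \<theta>: "\<theta> \<noteq> 0" "\<And>j. Polynomial.degree (\<theta> j) \<le> k" "dot \<theta> (\<lambda>j. spec u v (gg j)) = 0"
        by (auto simp: special_def spec_gg)
      define y where "y = (\<lambda>(j, s). poly.coeff (\<theta> j) s)"
      have zero: "(\<Sum>p\<in>J. y p * ev2 u v (a p n)) = 0" for n
      proof -
        have "(\<Sum>p\<in>J. y p * ev2 u v (a p n)) = (\<Sum>j\<in>UNIV. \<Sum>s\<le>k. y (j, s) * ev2 u v (a (j, s) n))"
          unfolding J_def by (simp add: sum.cartesian_product)
        also have "\<dots> = (\<Sum>j\<in>UNIV. poly.coeff ((\<Sum>s\<le>k. monom (poly.coeff (\<theta> j) s) s) * spec u v (gg j)) n)"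
          unfolding sum_distrib_right coeff_sum
          by (intro sum.cong refl) (simp add: coeff_monom_mult a_def y_def coeff_spec)
        also have "\<dots> = poly.coeff (dot \<theta> (\<lambda>j. spec u v (gg j))) n"
          unfolding dot_def coeff_sum by (simp only: poly_as_sum_of_monoms'[OF \<theta>(2)])
        finally show ?thesis using \<theta>(3) by simp
      qed
      have "y p = 0" if p: "p \<in> J" for p
      proof -
        have "y p * ev2 u v \<delta> = (\<Sum>q\<in>J. y q * (if p = q then ev2 u v \<delta> else 0))"
          using p finJ by (simp add: if_distrib[of "\<lambda>e. _ * e"] sum.delta cong: if_cong)
        also have "\<dots> = (\<Sum>q\<in>J. y q * (\<Sum>n\<in>{..k + N}. ev2 u v (b p n) * ev2 u v (a q n)))"
        proof (rule sum.cong)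
          fix q assume "q \<in> J"
          then have "ev2 u v (\<Sum>n\<in>{..k + N}. b p n * a q n) = ev2 u v (if p = q then \<delta> else 0)"
            using 2(2) p by simp
          then show "y q * (if p = q then ev2 u v \<delta> else 0) = y q * (\<Sum>n\<in>{..k + N}. ev2 u v (b p n) * ev2 u v (a q n))"
            by (simp add: ev2_sum split: if_splits)
        qed simp
        also have "\<dots> = (\<Sum>n\<in>{..k + N}. ev2 u v (b p n) * (\<Sum>q\<in>J. y q * ev2 u v (a q n)))"
          unfolding sum_distrib_left by (subst sum.swap) (simp add: mult_ac)
        also have "\<dots> = 0" by (simp add: zero)
        finally show ?thesis using nz by simp
      qed
      then have coeff0: "poly.coeff (\<theta> j) s = 0" if "s \<le> k" for j s
        using that by (auto simp: J_def y_def)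
      have "poly.coeff (\<theta> j) s = 0" for j s
        using coeff0[of s j] \<theta>(2)[of j] by (cases "s \<le> k") (auto simp: coeff_eq_0)
      then have "\<theta> j = 0" for j by (simp add: poly_eq_iff)
      with \<theta>(1) show False by (auto simp: fun_eq_iff)
    qed
    with 2(1) show ?thesis by blast
  qed
qed

lemma generic_imp_general:
  assumes "generic k \<omega>"
  shows "\<exists>b. b \<noteq> 0 \<and> (\<forall>u v. ev2 u v b \<noteq> 0 \<longrightarrow> (\<exists>\<theta>. special k u v \<theta>))"
proof -
  from assms obtain j where "\<omega> j \<noteq> 0" by (auto simp: generic_def fun_eq_iff)
  then obtain n where n: "poly.coeff (\<omega> j) n \<noteq> 0" by (metis leading_coeff_0_iff)
  have "special k u v (\<lambda>j. spec u v (\<omega> j))" if "ev2 u v (poly.coeff (\<omega> j) n) \<noteq> 0" for u v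
  proof -
    have "poly.coeff (spec u v (\<omega> j)) n \<noteq> 0" using that by (simp add: coeff_spec)
    then have "spec u v (\<omega> j) \<noteq> 0" by auto
    then have "(\<lambda>j. spec u v (\<omega> j)) \<noteq> 0" by (auto simp: fun_eq_iff)
    moreover have "Polynomial.degree (spec u v (\<omega> j)) \<le> k" for j
      using degree_spec[of u v "\<omega> j"] assms by (auto simp: generic_def intro: order_trans)
    moreover have "dot (\<lambda>j. spec u v (\<omega> j)) (\<lambda>j. res \<kappa> u v (pdiff j (arr m l))) = spec u v (dot \<omega> gg)"
      by (simp add: spec_dot spec_gg)
    ultimately show ?thesis using assms by (simp add: special_def generic_def)
  qed
  with n show ?thesis by blast
qed

definition "\<alpha>B i = [:[:l i 0:], [:l i 2:]:]"
definition "\<beta>B i = [:[:\<kappa> * l i 0 + l i 1, l i 2:]:]"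
text \<open>Nonzero at exactly those \<open>u\<close> and \<open>v\<close> for which the arrangement
  meets the parametrised line in distinct finite points, as \<open>arr_line\<close>
  requires.\<close>

definition "good = (\<Prod>i<m. \<beta>B i) * (\<Prod>i<m. \<Prod>j\<in>{..<m} - {i}. \<alpha>B i * \<beta>B j - \<alpha>B j * \<beta>B i)"

lemma good_neq_0: "good \<noteq> 0"
proof -
  have "\<beta>B i \<noteq> 0" if "i < m" for i using kappa[OF that] by (auto simp: \<beta>B_def)
  moreover have "\<alpha>B i * \<beta>B j - \<alpha>B j * \<beta>B i \<noteq> 0" if "i < m" "j < m" "i \<noteq> j" for i j
  proof
    assume "\<alpha>B i * \<beta>B j - \<alpha>B j * \<beta>B i = 0"
    then have eq: "\<alpha>B i * \<beta>B j = \<alpha>B j * \<beta>B i" by simp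
    \<comment> \<open>The coefficients at 1, \<open>v\<close> and \<open>u\<close> are, up to
      multiples of \<open>\<kappa>\<close> that cancel, the three entries of the cross
      product.\<close>
    have 0: "l i 0 * (\<kappa> * l j 0 + l j 1) = l j 0 * (\<kappa> * l i 0 + l i 1)"
      using arg_cong[OF eq, of "\<lambda>b. poly.coeff (poly.coeff b 0) 0"] by (simp add: \<alpha>B_def \<beta>B_def coeff_mult)
    have 1: "l i 0 * l j 2 = l j 0 * l i 2"
      using arg_cong[OF eq, of "\<lambda>b. poly.coeff (poly.coeff b 0) 1"] by (simp add: \<alpha>B_def \<beta>B_def coeff_mult)
    have 2: "l i 2 * (\<kappa> * l j 0 + l j 1) = l j 2 * (\<kappa> * l i 0 + l i 1)"
      using arg_cong[OF eq, of "\<lambda>b. poly.coeff (poly.coeff b 1) 0"] by (simp add: \<alpha>B_def \<beta>B_def coeff_mult)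
    have c2: "l i 0 * l j 1 = l j 0 * l i 1" using 0 by (simp add: algebra_simps)
    have "l i 2 * l j 1 + \<kappa> * (l j 0 * l i 2) = l j 2 * l i 1 + \<kappa> * (l i 0 * l j 2)"
      using 2 by (simp add: algebra_simps)
    then have c0: "l i 2 * l j 1 = l j 2 * l i 1" unfolding 1 by simp
    have "cross (l i) (l j) = 0"
    proof
      fix k show "cross (l i) (l j) k = 0 k"
        using c0 1 c2 by (cases k rule: cases_3) (simp_all add: cross_def mult.commute)
    qed
    with nonprop[OF that] show False by simp
  qed
  ultimately show ?thesis by (auto simp: good_def)
qed

lemma good_arr_line:
  assumes "ev2 u v good \<noteq> 0"
  shows "arr_line d m l \<kappa> u v"
proof
  have ev: "ev2 u v (\<alpha>B i) = l i 0 + u * l i 2" "ev2 u v (\<beta>B i) = \<kappa> * l i 0 + l i 1 + v * l i 2" for i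
    by (simp_all add: ev2_def \<alpha>B_def \<beta>B_def)
  have *: "(\<Prod>i<m. ev2 u v (\<beta>B i)) * (\<Prod>i<m. \<Prod>j\<in>{..<m} - {i}. ev2 u v (\<alpha>B i * \<beta>B j - \<alpha>B j * \<beta>B i)) \<noteq> 0"
    using assms by (simp only: good_def ev2_simps ev2_prod) simp
  show "m = 2 * d + 1" by (rule m)
  show "\<kappa> * l i 0 + l i 1 + v * l i 2 \<noteq> 0" if "i < m" for i
    using * that by (simp only: mult_eq_0_iff prod_zero_iff finite_lessThan) (simp add: ev)
  fix i j assume ij: "i < m" "j < m" "i \<noteq> j"
  have "ev2 u v (\<alpha>B i * \<beta>B j - \<alpha>B j * \<beta>B i) \<noteq> 0"
  proof
    assume "ev2 u v (\<alpha>B i * \<beta>B j - \<alpha>B j * \<beta>B i) = 0"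
    moreover have "j \<in> {..<m} - {i}" "i \<in> {..<m}" using ij by auto
    ultimately have "(\<Prod>i<m. \<Prod>j\<in>{..<m} - {i}. ev2 u v (\<alpha>B i * \<beta>B j - \<alpha>B j * \<beta>B i)) = 0"
      by (meson finite_Diff finite_lessThan prod_zero)
    with * show False by simp
  qed
  then show "(l i 0 + u * l i 2) * (\<kappa> * l j 0 + l j 1 + v * l j 2) \<noteq> (l j 0 + u * l j 2) * (\<kappa> * l i 0 + l i 1 + v * l i 2)"
    by (simp only: ev2_simps ev) simp
qed

lemma special_iff_syz:
  assumes "ev2 u v good \<noteq> 0"
  shows "special k u v \<theta> \<longleftrightarrow> \<theta> \<noteq> 0 \<and> (\<forall>j. Polynomial.degree (\<theta> j) \<le> k) \<and> arr_line.syz m l \<kappa> u v \<theta>"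
proof -
  interpret arr_line d m l \<kappa> u v by (rule good_arr_line[OF assms])
  show ?thesis by (simp add: special_def syz_def g_eta)
qed

text \<open>The Grauert-Muelich argument: on a general line, a syzygy \<open>\<omega>\<close> of degree less than \<open>d\<close> and its
  derivative along the flow are proportional, since \<open>det (E, \<omega>, flow \<omega>)\<close> has degree at most \<open>2 d\<close>
  and vanishes at the \<open>2 d + 1\<close> points of the arrangement. Hence the direction of \<open>\<omega>\<close> depends only
  on the point, not on the line through it.\<close>

lemma cross_flow_eq_0:
  assumes \<omega>: "generic k \<omega>" and k: "k < d"
  shows "cross \<omega> (\<lambda>j. flow (\<omega> j)) = 0"
proof (rule cross_eq_0_of_dot_0)
  note f = derivationD[OF derivation_flow]
  show 1: "dot \<omega> gg = 0" using \<omega> by (simp add: generic_def)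
  have "0 = flow (dot \<omega> gg)" by (simp add: 1 f)
  also have "\<dots> = dot (\<lambda>j. flow (\<omega> j)) gg"
    unfolding dot_def f by (simp add: gg_def flow_gres)
  finally show 2: "dot (\<lambda>j. flow (\<omega> j)) gg = 0" by simp
  from ev2_nonzero[OF good_neq_0] obtain u0 v0 where uv0: "ev2 u0 v0 good \<noteq> 0" by blast
  \<comment> \<open>By Euler's relation it suffices to look at a single line in general
    position.\<close>
  show "dot (gpt \<kappa>) gg \<noteq> 0"
  proof
    assume "dot (gpt \<kappa>) gg = 0"
    then have "spec u0 v0 (dot (gpt \<kappa>) gg) = 0" by simp
    then have 0: "dot (lpt \<kappa> u0 v0) (\<lambda>j. res \<kappa> u0 v0 (pdiff j (arr m l))) = 0"
      by (simp add: spec_dot spec_gpt spec_gg)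
    interpret al: arr_line d m l \<kappa> u0 v0 by (rule good_arr_line[OF uv0])
    have "of_nat m * al.fL = 0" using 0 al.dot_E_g by (simp add: al.g_eta)
    with al.fL_neq_0 m show False by (simp del: of_nat_Suc of_nat_add of_nat_mult)
  qed
  define \<Delta> where "\<Delta> = det3 (gpt \<kappa>) \<omega> (\<lambda>j. flow (\<omega> j))"
  have deg\<omega>: "Polynomial.degree (\<omega> j) \<le> k" for j using \<omega> by (simp add: generic_def)
  have degE: "Polynomial.degree (gpt \<kappa> j) \<le> 1" for j by (simp add: gpt_def)
  have "Polynomial.degree \<Delta> \<le> 1 + (k + Suc k)"
    unfolding \<Delta>_def det3_def dot_def using deg\<omega> degE
    by (intro degree_sum_le degree_mult_le_add degree_cross_le degree_flow) auto
  then have deg\<Delta>: "Polynomial.degree \<Delta> < m" using k m by simp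
  have spec0: "spec u v \<Delta> = 0" if uv: "ev2 u v good \<noteq> 0" for u v
  proof -
    interpret al: arr_line d m l \<kappa> u v by (rule good_arr_line[OF uv])
    let ?a = "\<lambda>j. spec u v (\<omega> j)" and ?b = "\<lambda>j. spec u v (flow (\<omega> j))"
    have syz: "al.syz ?a" "al.syz ?b"
      using 1 2 spec_dot[of u v \<omega> gg] spec_dot[of u v "\<lambda>j. flow (\<omega> j)" gg]
      by (simp_all add: al.syz_def al.g_eta spec_gg)
    show ?thesis
    proof (rule eq_0_of_many_roots[where m = m and r = al.rt])
      fix i assume i: "i < m"
      have "poly (spec u v \<Delta>) (al.rt i) = det3 (al.pt (al.rt i)) (\<lambda>j. poly (?a j) (al.rt i)) (\<lambda>j. poly (?b j) (al.rt i))"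
        by (simp add: \<Delta>_def spec_gpt det3_def cross_def dot_def sum_UNIV_3)
      also have "\<dots> = 0"
      \<comment> \<open>At a point of the arrangement all three vectors are orthogonal to
        \<open>l i\<close>.\<close>
      proof (rule det3_eq_0I[of "l i"])
        show "l i \<noteq> 0" using al.l_neq_0[OF i] by (auto simp: fun_eq_iff)
        have "dot (al.pt (al.rt i)) (l i) = poly [:al.\<alpha> i, al.\<beta> i:] (al.rt i)"
          by (simp add: dot_def sum_UNIV_3 lpt_def algebra_simps)
        then show "dot (al.pt (al.rt i)) (l i) = 0" using al.poly_factor_root[OF i] by simp
        show "dot (\<lambda>j. poly (?a j) (al.rt i)) (l i) = 0" "dot (\<lambda>j. poly (?b j) (al.rt i)) (l i) = 0"
          using al.syz_root[OF syz(1) i] al.syz_root[OF syz(2) i] by (simp_all add: dot_def)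
      qed
      finally show "poly (spec u v \<Delta>) (al.rt i) = 0" .
    qed (use al.root_inj deg\<Delta> degree_spec[of u v \<Delta>] in auto)
  qed
  have "poly.coeff \<Delta> n = 0" for n
  proof (rule ev2_identity[OF good_neq_0])
    fix u v assume "ev2 u v good \<noteq> 0"
    then have "poly.coeff (spec u v \<Delta>) n = 0" using spec0 by simp
    then show "ev2 u v (poly.coeff \<Delta> n) = 0" by (simp add: coeff_spec)
  qed
  then show "det3 (gpt \<kappa>) \<omega> (\<lambda>j. flow (\<omega> j)) = 0"
    by (simp add: poly_eq_iff flip: \<Delta>_def)
qed

text \<open>Proportionality to the derivative passes to the vector \<open>Q\<close> obtained by
  dividing by the gcd of the entries. Then \<open>Q i\<close> divides
  \<open>Q j * flow (Q i)\<close> for all \<open>j\<close>, hence \<open>flow (Q i)\<close> as the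
  \<open>Q j\<close> have no common factor, and such a divisor is invariant.\<close>

lemma generic_flow_invariant:
  assumes \<omega>: "generic k \<omega>" and k: "k < d"
  shows "\<exists>Q. generic k Q \<and> (\<forall>j. flow (Q j) = 0)"
proof -
  note f = derivationD[OF derivation_flow]
  let ?xs = "[\<omega> 0, \<omega> 1, \<omega> 2]"
  define G where "G = some_gcd.listgcd ?xs"
  have "G dvd \<omega> j" for j
    unfolding G_def by (rule some_gcd.listgcd) (cases j rule: cases_3, simp_all)
  then have "\<forall>j. \<exists>q. \<omega> j = G * q" by (simp add: dvd_def)
  then obtain Q where Q: "\<And>j. \<omega> j = G * Q j" by metis
  obtain j0 where j0: "\<omega> j0 \<noteq> 0" using \<omega> by (auto simp: generic_def fun_eq_iff)
  then have G0: "G \<noteq> 0" using Q[of j0] by auto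
  have sym: "Q i * flow (Q j) = Q j * flow (Q i)" for i j
  proof -
    have "cross \<omega> (\<lambda>j. flow (\<omega> j)) k = 0" for k using cross_flow_eq_0[OF \<omega> k] by simp
    then have "cross \<omega> (\<lambda>j. flow (\<omega> j)) 0 = 0" "cross \<omega> (\<lambda>j. flow (\<omega> j)) 1 = 0" "cross \<omega> (\<lambda>j. flow (\<omega> j)) 2 = 0" by blast+
    then have "\<omega> i * flow (\<omega> j) = \<omega> j * flow (\<omega> i)"
      by (cases i rule: cases_3; cases j rule: cases_3) (simp_all add: cross_def mult.commute)
    then have "G * G * (Q i * flow (Q j)) = G * G * (Q j * flow (Q i))"
      unfolding Q f by (simp add: algebra_simps)
    then show ?thesis using G0 by simp
  qed
  have flow0: "flow (Q i) = 0" for i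
  proof (cases "Q i = 0")
    case False
    have "G * Q i dvd \<omega> j * flow (Q i)" for j
    proof -
      have "\<omega> j * flow (Q i) = G * (Q i * flow (Q j))" unfolding Q sym[of i j] by (simp only: mult_ac)
      then show ?thesis by (simp add: dvd_def mult.assoc)
    qed
    then have "G * Q i dvd G * flow (Q i)"
      unfolding G_def by (intro some_gcd.listgcd_greatest_mult) (auto simp: G_def)
    then have "Q i dvd flow (Q i)" using G0 by simp
    then show ?thesis by (rule flow_eq_multiple_imp_0)
  qed (simp add: f)
  have "Polynomial.degree (Q j) \<le> k" for j
  proof (cases "Q j = 0")
    case False
    then have "Polynomial.degree (\<omega> j) = Polynomial.degree G + Polynomial.degree (Q j)"
      unfolding Q using G0 by (rule degree_mult_eq[rotated])
    moreover have "Polynomial.degree (\<omega> j) \<le> k" using \<omega> by (simp add: generic_def)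
    ultimately show ?thesis by simp
  qed simp
  moreover have "Q \<noteq> 0" using j0 Q[of j0] by auto
  moreover have "G * dot Q gg = dot \<omega> gg" by (simp add: dot_def Q sum_distrib_left mult.assoc)
  ultimately have "generic k Q" using \<omega> G0 by (simp add: generic_def)
  with flow0 show ?thesis by blast
qed

text \<open>An invariant syzygy is the restriction of a triple of forms; its relation with the
  gradient holds on all lines of the family, and these are enough to detect a form.\<close>

lemma global_syzygy:
  assumes "generic k \<omega>" "k < d"
  shows "\<exists>P. P \<noteq> 0 \<and> (\<forall>j. P j \<in> hom_part (int k)) \<and> dot P (\<lambda>j. pdiff j (arr m l)) = 0"
proof -
  from generic_flow_invariant[OF assms] obtain Q where Q: "generic k Q" "\<And>j. flow (Q j) = 0" by blast
  have "\<forall>j. \<exists>p\<in>hom_part (int k). gres \<kappa> p = Q j"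
  proof
    fix j
    show "\<exists>p\<in>hom_part (int k). gres \<kappa> p = Q j"
      using Q by (intro flow_invariant_lift) (auto simp: generic_def)
  qed
  then obtain P where P: "\<And>j. P j \<in> hom_part (int k)" "\<And>j. gres \<kappa> (P j) = Q j" by metis
  let ?D = "dot P (\<lambda>j. pdiff j (arr m l))"
  have "gres \<kappa> ?D = dot Q gg" by (simp add: dot_def gres_simps P gg_def)
  then have "gres \<kappa> ?D = 0" using Q(1) by (simp add: generic_def)
  then have "res \<kappa> u v ?D = 0" for u v by (simp flip: spec_gres)
  moreover have "?D \<in> hom_part (int k + (int m - 1))"
    unfolding dot_def by (intro hom_part_sum hom_part_mult P pdiff_arr_hom_part)
  ultimately have "?D = 0" using res_all_eq_0 by blast
  moreover have "P \<noteq> 0"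
  proof
    assume "P = 0"
    then have "Q j = 0" for j using P(2)[of j] by (simp add: gres_simps)
    with Q(1) show False by (auto simp: generic_def fun_eq_iff)
  qed
  ultimately show ?thesis using P(1) by blast
qed

end

section \<open>Destabilising subsheaves\<close>

lemma vscale_vector_space: "vector_space ((\<cdot>) :: 'a::field \<Rightarrow> ('i \<Rightarrow> 'a) \<Rightarrow> 'i \<Rightarrow> 'a)"
  by unfold_locales (auto simp: vscale_def algebra_simps)

lemma vscale_vscale: "a \<cdot> (b \<cdot> v) = (a * b :: 'a::comm_ring_1) \<cdot> v"
  by (auto simp: vscale_def mult.assoc)

definition line_sheaf :: "int \<Rightarrow> ('i \<Rightarrow> 'k ratfun) \<Rightarrow> ('k::field, 'i) sheaf" where
  "line_sheaf n w U = (\<lambda>g. g \<cdot> w) ` twist n U"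

lemma submod_line_sheaf: "submod U (line_sheaf n w U)"
  unfolding submod_def line_sheaf_def
proof (intro conjI ballI)
  show "0 \<in> (\<lambda>g. g \<cdot> w) ` twist n U" by (intro image_eqI[of _ _ 0]) (auto simp: vscale_def)
next
  fix v v' assume "v \<in> (\<lambda>g. g \<cdot> w) ` twist n U" "v' \<in> (\<lambda>g. g \<cdot> w) ` twist n U"
  then obtain g g' where "g \<in> twist n U" "g' \<in> twist n U" "v = g \<cdot> w" "v' = g' \<cdot> w" by blast
  then show "v + v' \<in> (\<lambda>g. g \<cdot> w) ` twist n U"
    by (intro image_eqI[of _ _ "g + g'"]) (auto simp: vscale_def distrib_right)
next
  fix a v assume "a \<in> reg U" "v \<in> (\<lambda>g. g \<cdot> w) ` twist n U"
  then obtain g where "g \<in> twist n U" "v = g \<cdot> w" by blast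
  with \<open>a \<in> reg U\<close> show "a \<cdot> v \<in> (\<lambda>g. g \<cdot> w) ` twist n U"
    by (intro image_eqI[of _ _ "a * g"]) (auto simp: vscale_vscale intro!: reg_mult)
qed

lemma line_sheaf_mono: "V \<subseteq> U \<Longrightarrow> line_sheaf n w U \<subseteq> line_sheaf n w V"
  unfolding line_sheaf_def using twist_mono by blast

text \<open>Products of \<open>n\<close> members of the partition of unity generate
  \<open>O(-n)\<close>. They serve all smaller open sets \<open>V\<close> at once, which is what
  coherence demands of restrictions.\<close>

lemma line_sheaf_generators:
  assumes U: "basic_open U"
  shows "\<exists>S. finite S \<and> S \<subseteq> twist (- int n) U \<and>
    (\<forall>V q. V \<subseteq> U \<longrightarrow> q \<in> twist (- int n) V \<longrightarrow> q \<cdot> w \<in> reg_span V ((\<lambda>s. s \<cdot> w) ` S))"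
proof (induction n)
  case 0
  have "q \<cdot> w \<in> reg_span V ((\<lambda>s. s \<cdot> w) ` {1})" if "q \<in> twist 0 V" for q V
  proof -
    have "1 \<cdot> w = w" by (auto simp: vscale_def)
    then have "w \<in> reg_span V ((\<lambda>s. s \<cdot> w) ` {1})" by (intro reg_span_base) force
    then show ?thesis using that by (rule reg_span_scale)
  qed
  then show ?case by (intro exI[of _ "{1}"]) auto
next
  case (Suc n)
  then obtain S where S: "finite S" "S \<subseteq> twist (- int n) U"
    "\<forall>V q. V \<subseteq> U \<longrightarrow> q \<in> twist (- int n) V \<longrightarrow> q \<cdot> w \<in> reg_span V ((\<lambda>s. s \<cdot> w) ` S)"
    by (elim exE conjE) (rule that)
  from basic_open_unit[OF U] obtain e where e: "\<And>k. e k \<in> twist (- 1) U"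
    "(\<Sum>k\<in>UNIV. e k * to_fract (mvar k)) = 1" by blast
  define S' where "S' = (\<lambda>(s, k). e k * s) ` (S \<times> UNIV)"
  have "finite S'" using S(1) by (simp add: S'_def)
  moreover have "S' \<subseteq> twist (- int (Suc n)) U"
    unfolding S'_def using e(1) S(2) by (auto intro!: twist_mult'[of _ "- 1" _ _ "- int n"])
  moreover have "q \<cdot> w \<in> reg_span V ((\<lambda>s. s \<cdot> w) ` S')" if V: "V \<subseteq> U" and q: "q \<in> twist (- int (Suc n)) V" for V q
  proof -
    let ?R = "reg_span V ((\<lambda>s. s \<cdot> w) ` S')"
    note R = submod_reg_span[of V "(\<lambda>s. s \<cdot> w) ` S'"]
    have "e k \<cdot> ((q * to_fract (mvar k)) \<cdot> w) \<in> ?R" for k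
    proof -
      have "q * to_fract (mvar k) \<in> twist (- int n) V"
        using q by (intro twist_mult'[OF q twist_to_fract[OF hom_part_mvar]]) simp
      from S(3)[rule_format, OF V this] have "(q * to_fract (mvar k)) \<cdot> w \<in> reg_span V ((\<lambda>s. s \<cdot> w) ` S)" .
      moreover have "reg_span V ((\<lambda>s. s \<cdot> w) ` S) \<subseteq> {v. e k \<cdot> v \<in> ?R}"
      proof (rule reg_span_minimal)
        show "(\<lambda>s. s \<cdot> w) ` S \<subseteq> {v. e k \<cdot> v \<in> ?R}"
        proof
          fix x assume "x \<in> (\<lambda>s. s \<cdot> w) ` S"
          then obtain s where s: "s \<in> S" "x = s \<cdot> w" by blast
          have "e k * s \<in> S'" unfolding S'_def using s(1) by force
          then show "x \<in> {v. e k \<cdot> v \<in> ?R}" by (auto simp: s(2) vscale_vscale intro!: reg_span_base)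
        qed
        have 1: "e k \<cdot> 0 = 0" by (auto simp: vscale_def)
        have 2: "e k \<cdot> (x + y) = e k \<cdot> x + e k \<cdot> y" for x y by (auto simp: vscale_def distrib_left)
        have 3: "e k \<cdot> (a \<cdot> x) = a \<cdot> (e k \<cdot> x)" for a x by (simp add: vscale_vscale mult.commute)
        show "submod V {v. e k \<cdot> v \<in> ?R}"
          unfolding submod_def mem_Collect_eq using submod_zero[OF R] submod_add[OF R] submod_scale[OF R]
          by (auto simp: 1 2 3)
      qed
      ultimately show ?thesis by blast
    qed
    then have "(\<Sum>k\<in>UNIV. e k \<cdot> ((q * to_fract (mvar k)) \<cdot> w)) \<in> ?R" by (intro submod_sum[OF R])
    moreover have "(\<Sum>k\<in>UNIV. e k \<cdot> ((q * to_fract (mvar k)) \<cdot> w)) = q \<cdot> w"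
    proof
      fix i
      have "(\<Sum>k\<in>UNIV. e k \<cdot> ((q * to_fract (mvar k)) \<cdot> w)) i = (\<Sum>k\<in>UNIV. e k * to_fract (mvar k)) * (q * w i)"
        by (simp add: sum_fun_apply vscale_def sum_distrib_left sum_distrib_right mult_ac)
      then show "(\<Sum>k\<in>UNIV. e k \<cdot> ((q * to_fract (mvar k)) \<cdot> w)) i = (q \<cdot> w) i"
        by (simp add: e(2) vscale_def)
    qed
    ultimately show ?thesis by simp
  qed
  ultimately show ?case by blast
qed

lemma coherent_line_sheaf: "coherent (line_sheaf (- int n) w)"
  unfolding coherent_def
proof (intro allI impI conjI)
  fix U :: "'a point set" assume U: "basic_open U"
  from line_sheaf_generators[OF U, of n w] obtain S where S: "finite S" "S \<subseteq> twist (- int n) U"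
    "\<forall>V q. V \<subseteq> U \<longrightarrow> q \<in> twist (- int n) V \<longrightarrow> q \<cdot> w \<in> reg_span V ((\<lambda>s. s \<cdot> w) ` S)"
    by (elim exE conjE) (rule that)
  have sub: "(\<lambda>s. s \<cdot> w) ` S \<subseteq> line_sheaf (- int n) w U" using S(2) by (auto simp: line_sheaf_def)
  have span: "line_sheaf (- int n) w V \<subseteq> reg_span V ((\<lambda>s. s \<cdot> w) ` S)" if "V \<subseteq> U" for V
    using S(3)[rule_format, OF that] by (auto simp: line_sheaf_def)
  have "line_sheaf (- int n) w U = reg_span U ((\<lambda>s. s \<cdot> w) ` S)"
    using span[of U] reg_span_minimal[OF sub submod_line_sheaf] by blast
  then show "\<exists>S. finite S \<and> line_sheaf (- int n) w U = reg_span U S" using S(1) by blast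
  fix V :: "'a point set" assume "basic_open V \<and> V \<subseteq> U"
  then have V: "V \<subseteq> U" by blast
  show "line_sheaf (- int n) w V = reg_span V (line_sheaf (- int n) w U)"
  proof
    show "line_sheaf (- int n) w V \<subseteq> reg_span V (line_sheaf (- int n) w U)"
      using span[OF V] reg_span_mono[OF order_refl sub, of V] by blast
    show "reg_span V (line_sheaf (- int n) w U) \<subseteq> line_sheaf (- int n) w V"
      by (rule reg_span_minimal[OF line_sheaf_mono[OF V] submod_line_sheaf])
  qed
qed

definition coord_open :: "3 \<Rightarrow> 'k::field point set" where
  "coord_open i = {p. p \<noteq> 0 \<and> eval (mvar i) p \<noteq> 0}"

lemma basic_open_coord: "basic_open (coord_open i :: 'k::field point set)"
  unfolding basic_open_def coord_open_def
  by (intro exI[of _ "mvar i"] exI[of _ 1]) (auto simp: mvar_neq_0)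

lemma rank_line_sheaf:
  fixes w :: "'i \<Rightarrow> 'k::field ratfun"
  assumes "w \<noteq> 0"
  shows "rank (line_sheaf (- int n) w) = 1"
proof -
  interpret vs: vector_space "(\<cdot>) :: 'k ratfun \<Rightarrow> ('i \<Rightarrow> 'k ratfun) \<Rightarrow> _" by (rule vscale_vector_space)
  let ?V = "\<Union>U\<in>Collect basic_open. line_sheaf (- int n) w U"
  have "?V \<subseteq> vs.span {w}"
    by (auto simp: line_sheaf_def intro: vs.span_scale[OF vs.span_base])
  moreover have "w \<in> vs.span ?V"
  proof -
    \<comment> \<open>For \<open>n > 0\<close> the vector \<open>w\<close> is not of the degree of a
      section, but its quotient by \<open>?h\<close> is one, and the scalars of the span come from
      the whole field of fractions.\<close>
    let ?h = "mvar 0 ^ n :: 'k mpoly3"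
    have h0: "?h \<noteq> 0" by (simp add: mvar_neq_0)
    have "to_fract 1 / to_fract ?h \<in> twist (- int n) (coord_open 0)"
      by (intro twist_divide[of _ "int n"] hom_part_power1) (auto simp: coord_open_def eval_simps)
    then have "(to_fract 1 / to_fract ?h) \<cdot> w \<in> ?V"
      using basic_open_coord by (auto simp: line_sheaf_def)
    then have "to_fract ?h \<cdot> ((to_fract 1 / to_fract ?h) \<cdot> w) \<in> vs.span ?V"
      by (intro vs.span_scale vs.span_base)
    moreover have "to_fract ?h \<cdot> ((to_fract 1 / to_fract ?h) \<cdot> w) = w"
      using h0 by (auto simp: vscale_def)
    ultimately show ?thesis by simp
  qed
  ultimately have "vs.span {w} = vs.span ?V"
    using vs.span_eq[of "{w}" ?V] by blast
  moreover have "vs.independent {w}" using assms by simp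
  ultimately have "vs.dim ?V = card {w}" by (intro vs.dim_eq_card)
  then show ?thesis by (simp add: rank_def)
qed

lemma permutes_lessThan_1: "{\<pi>. \<pi> permutes {..<1::nat}} = {id}"
  by (auto simp: lessThan_Suc permutes_sing)

lemma permutes_lessThan_2: "{\<pi>. \<pi> permutes {..<2::nat}} = {id, Transposition.transpose 0 1}"
proof -
  have "{..<2::nat} = {0, 1}" by auto
  show ?thesis unfolding \<open>{..<2} = _\<close> permutes_doubleton_iff by auto
qed

lemma wedge_1: "wedge 1 v = (\<lambda>\<sigma>. v 0 (\<sigma> 0))"
  unfolding wedge_def permutes_lessThan_1 by (simp add: lessThan_Suc)

lemma wedge_2: "wedge 2 v = (\<lambda>\<sigma>. v 0 (\<sigma> 0) * v 1 (\<sigma> 1) - v 0 (\<sigma> 1) * v 1 (\<sigma> 0))"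
proof -
  have "id \<noteq> Transposition.transpose 0 (1::nat)" by (metis id_apply transpose_apply_first zero_neq_one)
  moreover have "{..<2::nat} = {0, 1}" by auto
  ultimately show ?thesis
    unfolding wedge_def permutes_lessThan_2 by (simp add: sign_swap_id sign_id)
qed

lemma has_c1_line_sheaf:
  fixes w :: "'i \<Rightarrow> 'k::field ratfun"
  assumes "w \<noteq> 0"
  shows "has_c1 (line_sheaf (- int n) w) (- int n)"
  unfolding has_c1_def rank_line_sheaf[OF assms]
proof (rule exI[of _ "\<lambda>\<sigma>. w (\<sigma> 0)"], rule exI[of _ "{}"], intro conjI allI impI)
  fix p :: "'k point" assume "p \<noteq> 0 \<and> (\<forall>w\<in>{}. \<not> proportional p w)"
  then obtain i where i: "p i \<noteq> 0" by (auto simp: fun_eq_iff)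
  let ?U = "coord_open i :: 'k point set"
  let ?w = "\<lambda>\<sigma>::nat \<Rightarrow> 'i. w (\<sigma> 0)"
  have "{wedge 1 v |v. \<forall>j<1. v j \<in> line_sheaf (- int n) w ?U} = line_sheaf (- int n) ?w ?U"
  proof (intro subset_antisym subsetI)
    fix x assume "x \<in> {wedge 1 v |v. \<forall>j<1. v j \<in> line_sheaf (- int n) w ?U}"
    then obtain v g where "x = wedge 1 v" "g \<in> twist (- int n) ?U" "v 0 = g \<cdot> w" by (auto simp: line_sheaf_def)
    then show "x \<in> line_sheaf (- int n) ?w ?U"
      unfolding line_sheaf_def wedge_1 by (intro image_eqI[of _ _ g]) (auto simp: vscale_def)
  next
    fix x assume "x \<in> line_sheaf (- int n) ?w ?U"
    then obtain g where "g \<in> twist (- int n) ?U" "x = g \<cdot> ?w" by (auto simp: line_sheaf_def)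
    then have "x = wedge 1 (\<lambda>_. g \<cdot> w)" "g \<cdot> w \<in> line_sheaf (- int n) w ?U"
      by (auto simp: wedge_1[unfolded One_nat_def] vscale_def line_sheaf_def)
    then show "x \<in> {wedge 1 v |v. \<forall>j<1. v j \<in> line_sheaf (- int n) w ?U}" by blast
  qed
  then have "ext_power 1 (line_sheaf (- int n) w) ?U = reg_span ?U (line_sheaf (- int n) ?w ?U)"
    by (simp add: ext_power_def)
  also have "\<dots> = line_sheaf (- int n) ?w ?U"
    using reg_span_minimal[OF order_refl submod_line_sheaf] reg_span_base by blast
  finally show "\<exists>U. basic_open U \<and> p \<in> U \<and> ext_power 1 (line_sheaf (- int n) w) U = (\<lambda>g. g \<cdot> ?w) ` twist (- int n) U"
    using basic_open_coord[of i] i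
    by (intro exI[of _ ?U]) (auto simp: coord_open_def eval_simps line_sheaf_def)
qed simp

subsection \<open>Rank and first Chern class of the derivation bundle\<close>

text \<open>Solving \<open>\<Sum> s\<^sub>k \<partial>f/\<partial>x\<^sub>k = 0\<close> for the coordinate \<open>j\<close>.\<close>

definition koszul :: "'k::field mpoly3 \<Rightarrow> 3 \<Rightarrow> 3 \<Rightarrow> 3 \<Rightarrow> 'k ratfun" where
  "koszul f j i = (\<lambda>k. (if k = i then 1 else 0) - (if k = j then gradf f i / gradf f j else 0))"

lemma koszul_dot:
  assumes "gradf f j \<noteq> 0" shows "dot (koszul f j i) (gradf f) = 0"
  using assms by (simp add: dot_def koszul_def left_diff_distrib sum_subtractf
      if_distrib[of "\<lambda>u. u * _"] sum.delta cong: if_cong)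

lemma koszul_span:
  assumes "gradf f j \<noteq> 0" "dot s (gradf f) = 0"
  shows "s = (\<Sum>i\<in>UNIV - {j}. s i \<cdot> koszul f j i)"
proof
  fix k
  have "koszul f j j = 0" using assms(1) by (auto simp: koszul_def)
  then have "(\<Sum>i\<in>UNIV - {j}. s i \<cdot> koszul f j i) k = (\<Sum>i\<in>UNIV. (s i \<cdot> koszul f j i)) k"
    by (subst (2) sum.remove[of _ j]) (auto simp: vscale_def)
  also have "\<dots> = (\<Sum>i\<in>UNIV. if k = i then s i else 0) - (if k = j then (\<Sum>i\<in>UNIV. s i * gradf f i) / gradf f j else 0)"
    by (simp add: sum_fun_apply vscale_def koszul_def right_diff_distrib sum_subtractf
        if_distrib[of "\<lambda>u. _ * u"] sum_divide_distrib cong: if_cong)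
  also have "\<dots> = s k" using assms(2) by (simp add: dot_def sum.delta)
  finally show "s k = (\<Sum>i\<in>UNIV - {j}. s i \<cdot> koszul f j i) k" by simp
qed

lemma koszul_cross:
  assumes "gradf f j \<noteq> 0"
  shows "\<exists>a b. cross (koszul f j a) (koszul f j b) = (\<lambda>k. gradf f k / gradf f j)"
proof (cases j rule: cases_3)
  case 1
  then show ?thesis using assms by (intro exI[of _ 1] exI[of _ 2] ext, rename_tac k)
      (case_tac k rule: cases_3; simp add: cross_def koszul_def)
next
  case 2
  then show ?thesis using assms by (intro exI[of _ 2] exI[of _ 0] ext, rename_tac k)
      (case_tac k rule: cases_3; simp add: cross_def koszul_def)
next
  case 3
  then show ?thesis using assms by (intro exI[of _ 0] exI[of _ 1] ext, rename_tac k)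
      (case_tac k rule: cases_3; simp add: cross_def koszul_def)
qed

lemma card_UNIV_3_minus: "card (UNIV - {j :: 3}) = 2"
  by (simp add: card_Diff_singleton)

context
  fixes f :: "'k::field mpoly3" and n :: nat
  assumes n: "n > 0" and F: "\<And>k. pdiff k f \<in> hom_part (int n)"
begin

definition "grad_open j = {p. p \<noteq> 0 \<and> eval (pdiff j f) p \<noteq> 0}"

lemma basic_open_grad: "pdiff j f \<noteq> 0 \<Longrightarrow> basic_open (grad_open j)"
  unfolding basic_open_def grad_open_def using n F by (intro exI[of _ "pdiff j f"] exI[of _ "int n"]) auto

lemma inverse_grad_twist: "inverse (gradf f j) \<in> twist (- int n) (grad_open j)"
proof -
  have "to_fract 1 / to_fract (pdiff j f) \<in> twist (- int n) (grad_open j)"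
    by (rule twist_divide[OF _ F]) (auto simp: grad_open_def)
  then show ?thesis by (simp add: gradf_def divide_inverse)
qed

lemma koszul_section:
  assumes "pdiff j f \<noteq> 0"
  shows "koszul f j i \<in> derivation_bundle f (grad_open j)"
proof -
  have "gradf f i * inverse (gradf f j) \<in> twist 0 (grad_open j)"
    using F inverse_grad_twist by (intro twist_mult'[of _ "int n" _ _ "- int n"]) (auto simp: gradf_def intro: twist_to_fract)
  then have "koszul f j i k \<in> twist 0 (grad_open j)" for k
    by (auto simp: koszul_def divide_inverse)
  moreover have "gradf f j \<noteq> 0" using assms by (simp add: gradf_def)
  ultimately show ?thesis by (simp add: derivation_bundle_iff koszul_dot)
qed

lemma rank_derivation_bundle:
  assumes j: "pdiff j f \<noteq> 0"
  shows "rank (derivation_bundle f) = 2"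
proof -
  interpret vs: vector_space "(\<cdot>) :: 'k ratfun \<Rightarrow> (3 \<Rightarrow> 'k ratfun) \<Rightarrow> _" by (rule vscale_vector_space)
  have Fj: "gradf f j \<noteq> 0" using j by (simp add: gradf_def)
  let ?V = "\<Union>U\<in>Collect basic_open. derivation_bundle f U"
  let ?B = "koszul f j ` (UNIV - {j})"
  have val: "koszul f j i k = (if k = i then 1 else 0)" if "k \<noteq> j" for i k using that by (simp add: koszul_def)
  have inj: "inj_on (koszul f j) (UNIV - {j})"
  proof (rule inj_onI)
    fix a b assume "a \<in> UNIV - {j}" "b \<in> UNIV - {j}" "koszul f j a = koszul f j b"
    then have "koszul f j a a = koszul f j b a" "a \<noteq> j" by auto
    then show "a = b" by (simp add: val split: if_splits)
  qed
  have "?V \<subseteq> vs.span ?B"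
  proof
    fix s assume "s \<in> ?V"
    then have "dot s (gradf f) = 0" by (auto simp: derivation_bundle_iff)
    from koszul_span[OF Fj this] show "s \<in> vs.span ?B"
      by (metis (no_types, lifting) vs.span_sum vs.span_scale vs.span_base imageI)
  qed
  moreover have "?B \<subseteq> vs.span ?V"
    using koszul_section[OF j] basic_open_grad[OF j] by (auto intro!: vs.span_base)
  ultimately have "vs.span ?B = vs.span ?V" using vs.span_eq[of ?B ?V] by blast
  moreover have "vs.independent ?B"
  proof (rule vs.independent_if_scalars_zero)
    fix c v assume sum: "(\<Sum>v\<in>?B. c v \<cdot> v) = 0" and "v \<in> ?B"
    then obtain i where i: "i \<noteq> j" "v = koszul f j i" by auto
    have "0 = (\<Sum>v\<in>?B. c v \<cdot> v) i" using sum by simp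
    also have "\<dots> = (\<Sum>a\<in>UNIV - {j}. c (koszul f j a) * koszul f j a i)"
      by (simp add: sum.reindex[OF inj] sum_fun_apply vscale_def)
    also have "\<dots> = (\<Sum>a\<in>UNIV - {j}. if a = i then c (koszul f j a) else 0)"
      by (rule sum.cong) (auto simp: val[OF i(1)])
    also have "\<dots> = c v" using i by (simp add: sum.delta)
    finally show "c v = 0" by simp
  qed simp
  ultimately have "vs.dim ?V = card ?B" by (intro vs.dim_eq_card)
  then show ?thesis using card_image[OF inj] by (simp add: rank_def card_UNIV_3_minus)
qed

text \<open>The gradient read as a 2-vector: the minors of two vectors are the coordinates of their
  cross product, written in the indexing of \<open>wedge\<close>.\<close>

definition vol :: "(nat \<Rightarrow> 3) \<Rightarrow> 'k ratfun" where
  "vol \<sigma> = dot (gradf f) (cross (\<lambda>k. if k = \<sigma> 0 then 1 else 0) (\<lambda>k. if k = \<sigma> 1 then 1 else 0))"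

lemma minor_eq_dot_cross:
  "v a * v' b - v b * v' a = dot (cross v v') (cross (\<lambda>k. if k = a then 1 else 0) (\<lambda>k. if k = b then 1 else 0))"
  for v v' :: "3 \<Rightarrow> 'a::comm_ring_1"
  by (cases a rule: cases_3; cases b rule: cases_3) (simp_all add: vec3_defs algebra_simps)

lemma wedge_2_vol:
  assumes "cross (v 0) (v 1) = (\<lambda>k. c * gradf f k)"
  shows "wedge 2 v = c \<cdot> vol"
  unfolding wedge_2 minor_eq_dot_cross assms
  by (auto simp: vscale_def vol_def dot_def sum_distrib_left mult.assoc)

text \<open>Two sections are orthogonal to the gradient, so their cross product is a multiple of it;
  where the partial derivative \<open>j\<close> is nonzero, dividing by it shows that the factor is
  a section of \<open>O(-n)\<close>. The Koszul sections realise all such factors.\<close>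

lemma ext_power_derivation_bundle:
  assumes j: "pdiff j f \<noteq> 0"
  shows "ext_power 2 (derivation_bundle f) (grad_open j) = (\<lambda>g. g \<cdot> vol) ` twist (- int n) (grad_open j)"
proof -
  let ?U = "grad_open j" and ?E = "derivation_bundle f"
  have Fj: "gradf f j \<noteq> 0" using j by (simp add: gradf_def)
  let ?W = "{wedge 2 v |v. \<forall>i<2. v i \<in> ?E ?U}"
  have "?W \<subseteq> line_sheaf (- int n) vol ?U"
  proof
    fix x assume "x \<in> ?W"
    then obtain v where v: "x = wedge 2 v" "v 0 \<in> ?E ?U" "v 1 \<in> ?E ?U" by auto
    have "cross (cross (v 0) (v 1)) (gradf f) i = 0" for i
    proof -
      have "cross (cross (v 0) (v 1)) (gradf f) i = - cross (gradf f) (cross (v 0) (v 1)) i"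
        by (simp add: cross_def algebra_simps)
      also have "\<dots> = 0" using v by (simp add: cross_triple derivation_bundle_iff dot_commute)
      finally show ?thesis .
    qed
    then have "cross (cross (v 0) (v 1)) (gradf f) = 0" by auto
    moreover have "gradf f \<noteq> 0" using Fj by auto
    ultimately obtain c where c: "cross (v 0) (v 1) = (\<lambda>k. c * gradf f k)" using cross_eq_0_imp_scalar by blast
    have "c = (c * gradf f j) * inverse (gradf f j)" using Fj by simp
    also have "\<dots> = cross (v 0) (v 1) j * inverse (gradf f j)" by (simp only: c)
    also have "\<dots> \<in> twist (- int n) ?U"
      using v inverse_grad_twist
      by (intro reg_mult cross_twist[where n = 0 and k = 0]) (auto simp: derivation_bundle_iff)
    finally show "x \<in> line_sheaf (- int n) vol ?U"
      using v(1) wedge_2_vol[OF c] by (auto simp: line_sheaf_def)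
  qed
  then have "ext_power 2 ?E ?U \<subseteq> line_sheaf (- int n) vol ?U"
    unfolding ext_power_def by (rule reg_span_minimal[OF _ submod_line_sheaf])
  moreover have "line_sheaf (- int n) vol ?U \<subseteq> ext_power 2 ?E ?U"
  proof
    fix x assume "x \<in> line_sheaf (- int n) vol ?U"
    then obtain g where g: "g \<in> twist (- int n) ?U" "x = g \<cdot> vol" by (auto simp: line_sheaf_def)
    from koszul_cross[OF Fj] obtain a b where ab: "cross (koszul f j a) (koszul f j b) = (\<lambda>k. gradf f k / gradf f j)" by blast
    let ?v = "\<lambda>i::nat. if i = 0 then koszul f j a else koszul f j b"
    have "wedge 2 ?v = inverse (gradf f j) \<cdot> vol"
      by (rule wedge_2_vol) (simp add: ab divide_inverse mult.commute)
    moreover have "\<forall>i<2. ?v i \<in> ?E ?U" using koszul_section[OF j] by simp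
    ultimately have "inverse (gradf f j) \<cdot> vol \<in> ?W"
      unfolding mem_Collect_eq by (intro exI[of _ ?v]) simp
    moreover have "g * gradf f j \<in> reg ?U"
      using g(1) F by (intro twist_mult'[of _ "- int n" _ _ "int n"]) (auto simp: gradf_def intro: twist_to_fract)
    ultimately have "(g * gradf f j) \<cdot> (inverse (gradf f j) \<cdot> vol) \<in> reg_span ?U ?W"
      by (intro reg_span_scale reg_span_base)
    moreover have "(g * gradf f j) \<cdot> (inverse (gradf f j) \<cdot> vol) = x"
      using Fj by (simp add: g(2) vscale_vscale mult.assoc)
    ultimately show "x \<in> ext_power 2 ?E ?U" by (simp add: ext_power_def)
  qed
  ultimately show ?thesis by (simp only: line_sheaf_def[symmetric] subset_antisym)
qed

lemma has_c1_derivation_bundle: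
  assumes "finite W" and sing: "\<And>p. p \<noteq> 0 \<Longrightarrow> (\<And>j. eval (pdiff j f) p = 0) \<Longrightarrow> \<exists>w\<in>W. proportional p w"
    and j0: "pdiff j0 f \<noteq> 0"
  shows "has_c1 (derivation_bundle f) (- int n)"
  unfolding has_c1_def rank_derivation_bundle[OF j0]
proof (rule exI[of _ vol], rule exI[of _ W], intro conjI allI impI)
  fix p assume p: "p \<noteq> 0 \<and> (\<forall>w\<in>W. \<not> proportional p w)"
  then obtain j where j: "eval (pdiff j f) p \<noteq> 0" using sing by blast
  then have "pdiff j f \<noteq> 0" by (auto simp: eval_simps)
  then show "\<exists>U. basic_open U \<and> p \<in> U \<and> ext_power 2 (derivation_bundle f) U = (\<lambda>g. g \<cdot> vol) ` twist (- int n) U"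
    using basic_open_grad ext_power_derivation_bundle p j
    by (intro exI[of _ "grad_open j"]) (auto simp: grad_open_def)
qed (rule assms(1))

end

text \<open>The multiples of a global syzygy of degree \<open>k\<close> form a copy of
  \<open>O(-k)\<close>, of slope -k, in a sheaf of rank 2 and first Chern class -2 d, of slope -d.
  The Chern class is read off outside the finitely many points where two lines meet, since the
  gradient is nonzero elsewhere.\<close>

lemma unstable_of_global_syzygy:
  fixes l :: "nat \<Rightarrow> 3 \<Rightarrow> 'k::field_char_0"
  assumes m: "m = 2 * d + 1"
    and nonprop: "\<And>i j. i < m \<Longrightarrow> j < m \<Longrightarrow> i \<noteq> j \<Longrightarrow> cross (l i) (l j) \<noteq> 0"
    and P: "P \<noteq> 0" "\<And>j. P j \<in> hom_part (int k)" "dot P (\<lambda>j. pdiff j (arr m l)) = 0" and k: "k < d"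
  shows "unstable (derivation_bundle (arr m l))"
proof -
  let ?f = "arr m l" and ?E = "derivation_bundle (arr m l)"
  define w where "w = (\<lambda>j. to_fract (P j))"
  \<comment> \<open>The points where two lines meet. The pairs with equal indices contribute the
    zero vector, to which no point is proportional.\<close>
  define W where "W = (\<lambda>(i, j). cross (l i) (l j)) ` ({..<m} \<times> {..<m})"
  have lnz: "l i \<noteq> 0" if "i < m" for i
  proof -
    obtain j where "j < m" "j \<noteq> i" using m k by (cases "i = 0") (auto intro: that[of 1] that[of 0])
    with nonprop[of i j] that have "cross (l i) (l j) \<noteq> 0" by blast
    moreover have "cross 0 (l j) = 0" by (auto simp: cross_def)
    ultimately show ?thesis by metis
  qed
  have hom: "pdiff j ?f \<in> hom_part (int (2 * d))" for j
  proof -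
    have "int m - 1 = int (2 * d)" using m by simp
    with pdiff_arr_hom_part[of j m l] show ?thesis by (simp only:)
  qed
  have d2: "2 * d > 0" using k by simp
  have sing: "\<exists>w\<in>W. proportional p w" if p: "p \<noteq> 0" and zero: "\<And>j. eval (pdiff j ?f) p = 0" for p
  proof -
    have "0 = eval (\<Sum>j\<in>UNIV. mvar j * pdiff j ?f) p" by (simp add: eval_simps zero)
    also have "\<dots> = of_nat m * eval ?f p"
      unfolding euler_arr by (simp only: mconst_of_nat[symmetric] eval_simps)
    finally have "eval ?f p = 0" using m by (simp del: of_nat_Suc of_nat_add of_nat_mult)
    then obtain i where i: "i < m" "eval (lform (l i)) p = 0" by (auto simp: arr_def eval_simps)
    \<comment> \<open>On the line \<open>l i\<close> only the summand that omits its form survives,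
      so a zero of the gradient lies on a second line.\<close>
    have ev: "eval (pdiff j ?f) p = (\<Prod>k\<in>{..<m} - {i}. eval (lform (l k)) p) * l i j" for j
    proof -
      have "eval (pdiff j ?f) p = (\<Sum>n<m. (\<Prod>k\<in>{..<m} - {n}. eval (lform (l k)) p) * l n j)"
        by (simp only: pdiff_arr eval_simps)
      also have "\<dots> = (\<Sum>n\<in>{i}. (\<Prod>k\<in>{..<m} - {n}. eval (lform (l k)) p) * l n j)"
      proof (rule sum.mono_neutral_right)
        show "\<forall>n\<in>{..<m} - {i}. (\<Prod>k\<in>{..<m} - {n}. eval (lform (l k)) p) * l n j = 0"
        proof
          fix n assume "n \<in> {..<m} - {i}"
          with i have "(\<Prod>k\<in>{..<m} - {n}. eval (lform (l k)) p) = 0"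
            by (intro prod_zero) auto
          then show "(\<Prod>k\<in>{..<m} - {n}. eval (lform (l k)) p) * l n j = 0" by simp
        qed
      qed (use i in auto)
      finally show ?thesis by simp
    qed
    from lnz[OF i(1)] obtain j where "l i j \<noteq> 0" by (auto simp: fun_eq_iff)
    with ev[of j] zero[of j] have "(\<Prod>k\<in>{..<m} - {i}. eval (lform (l k)) p) = 0" by simp
    then obtain i' where i': "i' < m" "i' \<noteq> i" "eval (lform (l i')) p = 0" by auto
    have "dot p (l i) = 0" "dot p (l i') = 0"
      using i(2) i'(3) by (simp_all add: eval_lform dot_def mult.commute)
    then have "cross p (cross (l i) (l i')) = 0" by (auto simp: cross_triple)
    then obtain c where c: "p = (\<lambda>j. c * cross (l i) (l i') j)"
      using cross_eq_0_imp_scalar[OF _ nonprop[OF i(1) i'(1)]] i'(2) by metis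
    then have "c \<noteq> 0" using p by (auto simp: fun_eq_iff)
    then have "proportional p (cross (l i) (l i'))"
      using c unfolding proportional_def vscale_def by blast
    then show ?thesis using i i' unfolding W_def by force
  qed
  have "\<exists>j0. pdiff j0 ?f \<noteq> 0"
  proof (rule ccontr)
    assume "\<not> ?thesis"
    then have "of_nat m * ?f = 0" using euler_arr[of m l] by simp
    moreover have "?f \<noteq> 0" using lnz by (simp add: arr_def lform_eq_0_iff)
    ultimately show False using m by (simp del: of_nat_Suc of_nat_add of_nat_mult)
  qed
  then obtain j0 where j0: "pdiff j0 ?f \<noteq> 0" by blast
  have w0: "w \<noteq> 0" using P(1) by (auto simp: w_def fun_eq_iff)
  let ?F = "line_sheaf (- int k) w"
  have sub: "subsheaf ?F ?E"
    unfolding subsheaf_def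
  proof (intro allI impI subsetI)
    fix U v assume "v \<in> ?F U"
    then obtain g where g: "g \<in> twist (- int k) U" "v = g \<cdot> w" by (auto simp: line_sheaf_def)
    have "g * w i \<in> twist 0 U" for i
      unfolding w_def using g(1) P(2) by (intro twist_mult'[OF g(1) twist_to_fract]) auto
    moreover have "dot w (gradf ?f) = to_fract (dot P (\<lambda>j. pdiff j ?f))"
      by (simp add: dot_def w_def gradf_def to_fract_sum)
    ultimately show "v \<in> ?E U" using g(2) P(3) by (simp add: derivation_bundle_iff dot_vscale) (simp add: vscale_def)
  qed
  have rE: "rank ?E = 2" by (rule rank_derivation_bundle[OF d2 hom j0])
  have cE: "has_c1 ?E (- int (2 * d))"
    by (rule has_c1_derivation_bundle[OF d2 hom _ sing j0]) (simp add: W_def)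
  have "\<not> real_of_int (- int k) / real (rank ?F) \<le> real_of_int (- int (2 * d)) / real (rank ?E)"
    using k by (simp add: rE rank_line_sheaf[OF w0])
  moreover have "coherent ?F \<and> subsheaf ?F ?E \<and> 0 < rank ?F \<and> rank ?F < rank ?E \<and> has_c1 ?F (- int k) \<and> has_c1 ?E (- int (2 * d))"
    using coherent_line_sheaf sub rank_line_sheaf[OF w0] rE has_c1_line_sheaf[OF w0] cE by simp
  ultimately show ?thesis unfolding semistable_def by blast
qed

section \<open>The two implications for an arrangement\<close>

context arrangement
begin

abbreviation "power_ideal \<equiv> ideal_gen ((\<lambda>i. lform (l i) ^ d) ` {..<m})"

lemma fails_SLP_iff:
  "fails_SLP power_ideal 2 (int d - 2) \<longleftrightarrow>
    (\<exists>b. b \<noteq> 0 \<and> (\<forall>c u v. c \<noteq> 0 \<and> ev2 u v b \<noteq> 0 \<longrightarrow>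
      \<not> inj_on (quot_mult power_ideal (lform (\<lambda>i. c * ldual \<kappa> u v i) ^ 2)) (quot_part power_ideal (int d - 2)) \<and>
      quot_mult power_ideal (lform (\<lambda>i. c * ldual \<kappa> u v i) ^ 2) ` quot_part power_ideal (int d - 2)
        \<noteq> quot_part power_ideal (int d)))"
  unfolding fails_SLP_def for_general_linear_form_iff[of _ \<kappa>] by simp

text \<open>Failure of surjectivity gives a syzygy on every line of an open set. A nonzero
  \<open>\<delta>\<close> that excludes syzygies on general lines would contradict this, as two
  nonempty open sets meet.\<close>

lemma generic_of_fails_SLP:
  assumes "fails_SLP power_ideal 2 (int d - 2)"
  shows "d > 0 \<and> (\<exists>\<omega>. generic (d - 1) \<omega>)"
proof -
  from assms obtain b where b: "b \<noteq> 0" "\<And>c u v. c \<noteq> 0 \<Longrightarrow> ev2 u v b \<noteq> 0 \<Longrightarrow>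
      quot_mult power_ideal (lform (\<lambda>i. c * ldual \<kappa> u v i) ^ 2) ` quot_part power_ideal (int d - 2)
        \<noteq> quot_part power_ideal (int d)"
    unfolding fails_SLP_iff by blast
  have special: "d > 0 \<and> (\<exists>\<theta>. special (d - 1) u v \<theta>)" if uv: "ev2 u v (b * good) \<noteq> 0" for u v
  proof -
    have good: "ev2 u v good \<noteq> 0" and "ev2 u v b \<noteq> 0" using uv by auto
    interpret arr_line d m l \<kappa> u v by (rule good_arr_line[OF good])
    from not_surj_imp_syz[of 1, unfolded J_def, OF one_neq_zero b(2)[OF one_neq_zero \<open>ev2 u v b \<noteq> 0\<close>]]
    show ?thesis by (auto simp: special_iff_syz[OF good])
  qed
  have "b * good \<noteq> 0" using b(1) good_neq_0 by simp
  then have "d > 0" using ev2_nonzero special by blast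
  moreover have "\<exists>\<omega>. generic (d - 1) \<omega>"
  proof (rule ccontr)
    assume "\<not> ?thesis"
    then obtain \<delta> where \<delta>: "\<delta> \<noteq> 0" "\<And>u v \<theta>. ev2 u v \<delta> \<noteq> 0 \<Longrightarrow> \<not> special (d - 1) u v \<theta>"
      using generic_or_general_none by blast
    have "b * good * \<delta> \<noteq> 0" using b(1) good_neq_0 \<delta>(1) by simp
    then obtain u v where uv: "ev2 u v (b * good * \<delta>) \<noteq> 0" using ev2_nonzero by blast
    then have "ev2 u v (b * good) \<noteq> 0" "ev2 u v \<delta> \<noteq> 0" by auto
    then show False using special \<delta>(2) by blast
  qed
  ultimately show ?thesis by blast
qed

text \<open>On a general line there is a syzygy of degree at most \<open>a\<close> and, by the
  choice of \<open>\<delta>\<close>, none of smaller degree; so it is primitive and splits the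
  bundle.\<close>

lemma splitting_type_of_generic:
  assumes \<omega>: "generic a \<omega>" and min: "\<And>k \<omega>. k < a \<Longrightarrow> \<not> generic k \<omega>" and a: "a \<le> d"
  shows "splitting_type (derivation_bundle (arr m l)) (int a) (int (2 * d - a))"
proof -
  obtain b where b: "b \<noteq> 0" "\<And>u v. ev2 u v b \<noteq> 0 \<Longrightarrow> \<exists>\<theta>. special a u v \<theta>"
    using generic_imp_general[OF \<omega>] by blast
  obtain \<delta> where \<delta>: "\<delta> \<noteq> 0" "\<And>u v k \<theta>. ev2 u v \<delta> \<noteq> 0 \<Longrightarrow> k < a \<Longrightarrow> \<not> special k u v \<theta>"
  proof (cases "a = 0")
    case True
    then show ?thesis using that[of 1] by simp
  next
    case False
    then have "\<nexists>\<omega>. generic (a - 1) \<omega>" using min by simp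
    then obtain \<delta> where \<delta>: "\<delta> \<noteq> 0" "\<And>u v \<theta>. ev2 u v \<delta> \<noteq> 0 \<Longrightarrow> \<not> special (a - 1) u v \<theta>"
      using generic_or_general_none by blast
    show ?thesis
    proof (rule that[OF \<delta>(1)])
      fix u v k \<theta> assume "ev2 u v \<delta> \<noteq> 0" "k < a"
      moreover have "special (a - 1) u v \<theta>" if "special k u v \<theta>"
        using that \<open>k < a\<close> unfolding special_def by (auto intro: order_trans[of _ k])
      ultimately show "\<not> special k u v \<theta>" using \<delta>(2) by blast
    qed
  qed
  have "line_iso (lform (\<lambda>i. c * ldual \<kappa> u v i)) (derivation_bundle (arr m l))
      (twist_sum (\<lambda>i::bool. if i then - int (2 * d - a) else - int a))"
    if c: "c \<noteq> 0" and uv: "ev2 u v (b * good * \<delta>) \<noteq> 0" for c u v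
  proof -
    have good: "ev2 u v good \<noteq> 0" and "ev2 u v b \<noteq> 0" and nd: "ev2 u v \<delta> \<noteq> 0" using uv by auto
    interpret arr_line d m l \<kappa> u v by (rule good_arr_line[OF good])
    from b(2)[OF \<open>ev2 u v b \<noteq> 0\<close>] obtain \<theta> where
      \<theta>: "\<theta> \<noteq> 0" "\<And>j. Polynomial.degree (\<theta> j) \<le> a" "syz \<theta>"
      unfolding special_iff_syz[OF good] by blast
    have min': "\<not> (\<forall>j. Polynomial.degree (\<theta>' j) < a)" if "syz \<theta>'" "\<theta>' \<noteq> 0" for \<theta>'
    proof
      assume *: "\<forall>j. Polynomial.degree (\<theta>' j) < a"
      then have "a > 0" by (metis gr_zeroI not_less0)
      moreover have "special (a - 1) u v \<theta>'" unfolding special_iff_syz[OF good]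
        using that * by (auto simp: less_eq_Suc_le[symmetric] le_diff_conv2 \<open>a > 0\<close> Suc_leI)
      ultimately show False using \<delta>(2)[OF nd, of "a - 1"] by auto
    qed
    show ?thesis
      using line_iso_of_primitive_syz[OF c a \<theta>(3,2)] minimal_syz_primitive[OF \<theta>(3,1,2) min'] by blast
  qed
  moreover have "b * good * \<delta> \<noteq> 0" using b(1) good_neq_0 \<delta>(1) by simp
  ultimately show ?thesis
    unfolding splitting_type_def for_general_linear_form_iff[of _ \<kappa>] using a
    by (intro conjI exI[of _ "b * good * \<delta>"]) simp_all
qed

text \<open>With \<open>a\<close> the least degree of a generic syzygy, the shift is
  \<open>s = d - a\<close>. As \<open>a < d\<close>, a syzygy of degree \<open>a\<close> exists on
  the plane and destabilises.\<close>

lemma fails_SLP_imp_unstable: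
  assumes "fails_SLP power_ideal 2 (int d - 2)"
  shows "unstable (derivation_bundle (arr m l)) \<and>
    (\<exists>s\<ge>1. splitting_type (derivation_bundle (arr m l)) (int d - s) (int d + s))"
proof -
  define a where "a = (LEAST k. \<exists>\<omega>. generic k \<omega>)"
  from generic_of_fails_SLP[OF assms] have d: "d > 0" and ex: "\<exists>\<omega>. generic (d - 1) \<omega>" by auto
  have "\<exists>\<omega>. generic a \<omega>" unfolding a_def by (rule LeastI[of "\<lambda>k. \<exists>\<omega>. generic k \<omega>", OF ex])
  then obtain \<omega> where \<omega>: "generic a \<omega>" by blast
  have "a \<le> d - 1" unfolding a_def by (rule Least_le[of "\<lambda>k. \<exists>\<omega>. generic k \<omega>", OF ex])
  then have a: "a < d" using d by simp
  have "\<not> generic k \<omega>" if "k < a" for k \<omega>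
    using not_less_Least[of k "\<lambda>k. \<exists>\<omega>. generic k \<omega>"] that unfolding a_def by blast
  from splitting_type_of_generic[OF \<omega> this] a
  have "splitting_type (derivation_bundle (arr m l)) (int d - (int d - int a)) (int d + (int d - int a))"
    by (simp add: of_nat_diff)
  moreover have "int d - int a \<ge> 1" using a by simp
  moreover from global_syzygy[OF \<omega> a] obtain P where P:
    "P \<noteq> 0" "\<And>j. P j \<in> hom_part (int a)" "dot P (\<lambda>j. pdiff j (arr m l)) = 0" by blast
  have "unstable (derivation_bundle (arr m l))"
    by (rule unstable_of_global_syzygy[OF m nonprop P a])
  ultimately show ?thesis by blast
qed

text \<open>The summand \<open>O(-(d - s))\<close> yields on a general line a syzygy of degree at
  most \<open>d - s\<close>, hence at most \<open>d - 1\<close>, and the hypothesis on aligned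
  points makes the powers independent.\<close>

lemma splitting_imp_fails_SLP:
  assumes nz: "\<And>i. i < m \<Longrightarrow> l i \<noteq> 0"
    and aligned: "\<And>S. S \<subseteq> l ` {..<m} \<Longrightarrow> aligned S \<Longrightarrow> card S \<le> d + 1"
    and s: "s \<ge> 1" and split: "splitting_type (derivation_bundle (arr m l)) (int d - s) (int d + s)"
  shows "fails_SLP power_ideal 2 (int d - 2)"
proof -
  from split obtain b where b: "b \<noteq> 0" "\<And>c u v. c \<noteq> 0 \<Longrightarrow> ev2 u v b \<noteq> 0 \<Longrightarrow>
    line_iso (lform (\<lambda>i. c * ldual \<kappa> u v i)) (derivation_bundle (arr m l))
      (twist_sum (\<lambda>i::bool. if i then - (int d + s) else - (int d - s)))"
    unfolding splitting_type_def for_general_linear_form_iff[of _ \<kappa>] by blast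
  have indep: "y i = 0" if "(\<Sum>i<m. mconst (y i) * lform (l i) ^ d) = 0" "i < m" for y i
    using linear_independent_powers[of d l y i] nz nonprop aligned that unfolding m by blast
  have "\<not> inj_on (quot_mult power_ideal (lform (\<lambda>i. c * ldual \<kappa> u v i) ^ 2)) (quot_part power_ideal (int d - 2)) \<and>
      quot_mult power_ideal (lform (\<lambda>i. c * ldual \<kappa> u v i) ^ 2) ` quot_part power_ideal (int d - 2)
        \<noteq> quot_part power_ideal (int d)"
    if c: "c \<noteq> 0" and uv: "ev2 u v (b * good) \<noteq> 0" for c u v
  proof -
    have good: "ev2 u v good \<noteq> 0" and "ev2 u v b \<noteq> 0" using uv by auto
    interpret arr_line d m l \<kappa> u v by (rule good_arr_line[OF good])
    from syz_of_line_iso[OF c b(2)[OF c \<open>ev2 u v b \<noteq> 0\<close>]] obtain \<theta> where \<theta>: "syz \<theta>" "\<theta> \<noteq> 0"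
      "\<And>j. \<theta> j \<noteq> 0 \<Longrightarrow> int (Polynomial.degree (\<theta> j)) \<le> int d - s" by blast
    from \<theta>(2) obtain j where "\<theta> j \<noteq> 0" by (auto simp: fun_eq_iff)
    from \<theta>(3)[OF this] s have d: "d > 0" by linarith
    have deg: "Polynomial.degree (\<theta> j) \<le> d - 1" for j
    proof (cases "\<theta> j = 0")
      case False
      from \<theta>(3)[OF this] s show ?thesis by linarith
    qed simp
    show ?thesis
      using syz_imp_fails[OF c d _ \<theta>(1,2) deg] indep unfolding J_def by blast
  qed
  moreover have "b * good \<noteq> 0" using b(1) good_neq_0 by simp
  ultimately show ?thesis unfolding fails_SLP_iff by blast
qed

end

text \<open>For such a \<open>\<kappa>\<close> the slopes \<open>\<kappa> l\<^sub>0 + l\<^sub>1 + v l\<^sub>2\<close> are nonzero for general \<open>v\<close>.\<close>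

lemma ex_kappa:
  fixes l :: "nat \<Rightarrow> 3 \<Rightarrow> 'k::field_char_0"
  assumes "\<And>i. i < m \<Longrightarrow> l i \<noteq> 0"
  shows "\<exists>\<kappa>. \<forall>i<m. \<kappa> * l i 0 + l i 1 \<noteq> 0 \<or> l i 2 \<noteq> 0"
proof -
  have "finite ((\<lambda>i. - l i 1 / l i 0) ` {..<m})" by simp
  then obtain \<kappa> where \<kappa>: "\<kappa> \<notin> (\<lambda>i. - l i 1 / l i 0) ` {..<m}"
    using ex_new_if_finite[OF infinite_UNIV_char_0] by blast
  have "\<kappa> * l i 0 + l i 1 \<noteq> 0 \<or> l i 2 \<noteq> 0" if i: "i < m" for i
  proof (rule ccontr)
    assume "\<not> ?thesis"
    then have *: "\<kappa> * l i 0 + l i 1 = 0" "l i 2 = 0" by auto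
    show False
    proof (cases "l i 0 = 0")
      case True
      then have "l i = 0" using * by (auto simp: fun_eq_iff all_3)
      then show False using assms[OF i] by blast
    next
      case False
      then have "\<kappa> = - l i 1 / l i 0" using *(1) by (simp add: field_simps eq_neg_iff_add_eq_0)
      then show False using \<kappa> i by blast
    qed
  qed
  then show ?thesis by blast
qed

theorem proposition22:
  fixes d :: nat
    and l :: "nat \<Rightarrow> 'k::{alg_closed_field, field_char_0} mpoly3"
    and I :: "'k mpoly3 set"
    and Z :: "(3 \<Rightarrow> 'k) set"
  assumes "\<And>i. i < 2 * d + 1 \<Longrightarrow> linear_form (l i)"
    and "\<And>i j. i < 2 * d + 1 \<Longrightarrow> j < 2 * d + 1 \<Longrightarrow> i \<noteq> j \<Longrightarrow>
           \<not> proportional (dual_point (l i)) (dual_point (l j))"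
    and "I = ideal_gen ((\<lambda>i. l i ^ d) ` {..<2 * d + 1})"
    and "artinian_ideal I"
    and "Z = (\<lambda>i. dual_point (l i)) ` {..<2 * d + 1}"
    and "\<And>S. S \<subseteq> Z \<Longrightarrow> aligned S \<Longrightarrow> card S \<le> d + 1"
  shows "fails_SLP I 2 (int d - 2) \<longleftrightarrow>
    (unstable (derivation_bundle (\<Prod>i<2 * d + 1. l i)) \<and>
     (\<exists>s\<ge>1. splitting_type (derivation_bundle (\<Prod>i<2 * d + 1. l i)) (int d - s) (int d + s)))"
proof -
  let ?p = "\<lambda>i. dual_point (l i)"
  have nz: "?p i \<noteq> 0" if "i < 2 * d + 1" for i by (rule linear_form_dual_nz[OF assms(1)[OF that]])
  have lin: "l i = lform (?p i)" if "i < 2 * d + 1" for i by (rule linear_form_eq[OF assms(1)[OF that]])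
  obtain \<kappa> where \<kappa>: "\<And>i. i < 2 * d + 1 \<Longrightarrow> \<kappa> * ?p i 0 + ?p i 1 \<noteq> 0 \<or> ?p i 2 \<noteq> 0"
    using ex_kappa[of "2 * d + 1" ?p] nz by blast
  have cross: "cross (?p i) (?p j) \<noteq> 0" if ij: "i < 2 * d + 1" "j < 2 * d + 1" "i \<noteq> j" for i j
  proof
    assume "cross (?p i) (?p j) = 0"
    from cross_eq_0_imp_scalar[OF this nz[OF ij(2)]] obtain c where c: "?p i = (\<lambda>k. c * ?p j k)" by blast
    then have "c \<noteq> 0" using nz[OF ij(1)] by (auto simp: fun_eq_iff)
    then show False using assms(2)[OF ij] c by (auto simp: proportional_def vscale_def)
  qed
  interpret arrangement d "2 * d + 1" ?p \<kappa> using cross \<kappa> by unfold_locales auto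
  have I: "I = power_ideal"
    unfolding assms(3) by (intro arg_cong[of _ _ ideal_gen] image_cong) (auto simp: lin[symmetric])
  have arr: "(\<Prod>i<2 * d + 1. l i) = arr (2 * d + 1) ?p"
    unfolding arr_def by (intro prod.cong) (auto simp: lin[symmetric])
  show ?thesis
    unfolding I arr using fails_SLP_imp_unstable splitting_imp_fails_SLP[OF nz assms(6)[unfolded assms(5)]] by blast
qed

end
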